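(* Fix $\tau>0$ and $a,c\in\mathbb{R}$ such that $a+c>0$. Then there exists a (real-valued) Markov process $(Y_t)_{t\in[0,\tau]}$ such that for every integer $d\ge 0$ and all $0=t_0<t_1<\dots<t_d<t_{d+1}=\tau$, the law of $(Y_{t_0},\dots,Y_{t_{d+1}})$ has density with respect to Lebesgue measure on $\mathbb{R}^{d+2}$ given by $$f_{\mathbf t}(\mathbf x)=\frac{1}{C^{(\tau)}_{a,c}}\,e^{c x_0+a x_{d+1}}\prod_{k=1}^{d+1}p_{t_k-t_{k-1}}(x_{k-1},x_k),\qquad \mathbf x=(x_0,\dots,x_{d+1})\in\mathbb{R}^{d+2},$$ where $\mathbf t=(t_0,\dots,t_{d+1})$ and $$C^{(\tau)}_{a,c}:=\int_{\mathbb{R}}\int_{\mathbb{R}}e^{ax+cy}\,p_\tau(x,y)\,dx\,dy .$$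
   Context: For $u\in\mathbb{R}$, $x>0$, $K_{iu}(x)=\int_0^\infty e^{-x\cosh w}\cos(uw)\,dw$ is the modified Bessel function. Let $\mu(du)=\frac{2}{\pi}\frac{du}{|\Gamma(iu)|^2}=\frac{2}{\pi^2}u\sinh(\pi u)\,du$ on $(0,\infty)$. The Yakubovich heat kernel is $$p_t(x,y)=\int_0^\infty e^{-tu^2}K_{iu}(e^x)K_{iu}(e^y)\,\mu(du),\qquad x,y\in\mathbb{R},\ t>0.$$ The finiteness of $C^{(\tau)}_{a,c}$ is part of the assertion. *)

theory Defs
  imports "HOL-Probability.Probability"
begin

definition bessel_K :: "real \<Rightarrow> real \<Rightarrow> real" where
  "bessel_K u x = (LBINT w:{0..}. exp (- x * cosh w) * cos (u * w))"
  \<comment> \<open>\<open>bessel_K u x\<close> is \<open>K\<^sub>\<nu>(x)\<close> for the imaginary order \<open>\<nu> = \<i>u\<close>, meaningful for \<open>x > 0\<close>.\<close>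

definition yakubovich_measure :: "real measure" where
  "yakubovich_measure = density lborel
     (\<lambda>u. ennreal (indicator {0<..} u * (2 / pi / (cmod (Gamma (\<i> * complex_of_real u)))\<^sup>2)))"

lemma yakubovich_density_eq:
  fixes u :: real
  assumes "u > 0"
  shows "2 / pi / (cmod (Gamma (\<i> * complex_of_real u)))\<^sup>2 = 2 / pi\<^sup>2 * u * sinh (pi * u)"
proof -
  let ?z = "\<i> * complex_of_real u"
  have "cnj (Gamma ?z) = Gamma (- ?z)"
    by (simp add: cnj_Gamma)
  then have "complex_of_real ((cmod (Gamma ?z))\<^sup>2) = Gamma ?z * Gamma (- ?z)"
    by (metis complex_norm_square)
  also have "\<dots> = - of_real pi / (?z * sin (of_real pi * ?z))"
    by (rule Gamma_reflection_complex')
  also have "sin (of_real pi * ?z) = \<i> * of_real (sinh (pi * u))"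
    by (simp add: complex_eq_iff Re_sin Im_sin sinh_def field_simps)
  also have "- of_real pi / (?z * (\<i> * of_real (sinh (pi * u))))
      = complex_of_real (pi / (u * sinh (pi * u)))"
  proof -
    have "?z * (\<i> * of_real (sinh (pi * u))) = - of_real (u * sinh (pi * u))"
      by (simp add: algebra_simps flip: mult.assoc)
    then show ?thesis by (simp only: of_real_divide minus_divide_left [symmetric] minus_divide_right [symmetric] minus_minus)
  qed
  finally have "(cmod (Gamma ?z))\<^sup>2 = pi / (u * sinh (pi * u))"
    by (simp only: of_real_eq_iff)
  then show ?thesis
    by (simp add: power2_eq_square)
qed

definition yakubovich_kernel :: "real \<Rightarrow> real \<Rightarrow> real \<Rightarrow> real" where
  "yakubovich_kernel t x y =
     (LINT u|yakubovich_measure. exp (- t * u\<^sup>2) * bessel_K u (exp x) * bessel_K u (exp y))"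

definition norm_const :: "real \<Rightarrow> real \<Rightarrow> real \<Rightarrow> real" where
  "norm_const \<tau> a c = (LBINT y. LBINT x. exp (a * x + c * y) * yakubovich_kernel \<tau> x y)"

text \<open>The random vector \<open>X\<close> has the real-valued density \<open>f\<close> with respect to \<open>N\<close>. Nonnegativity is
  required separately, because \<open>ennreal\<close> truncates negative values to \<open>0\<close>.\<close>

definition has_real_density ::
  "'w measure \<Rightarrow> 'b measure \<Rightarrow> ('w \<Rightarrow> 'b) \<Rightarrow> ('b \<Rightarrow> real) \<Rightarrow> bool" where
  "has_real_density M N X f \<longleftrightarrow>
     f \<in> borel_measurable N \<and> (AE x in N. 0 \<le> f x) \<and> distributed M N X (\<lambda>x. ennreal (f x))"

definition past_algebra ::
  "'w measure \<Rightarrow> real set \<Rightarrow> (real \<Rightarrow> 'w \<Rightarrow> real) \<Rightarrow> real \<Rightarrow> 'w measure" where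
  "past_algebra M T Y s =
     sigma (space M) {Y r -` A \<inter> space M | r A. r \<in> T \<and> r \<le> s \<and> A \<in> sets borel}"

text \<open>The Markov property with respect to the natural filtration: for \<open>s \<le> t\<close>,
  \<open>P (Y\<^sub>t \<in> A | \<sigma>(Y\<^sub>r, r \<le> s)) = P (Y\<^sub>t \<in> A | \<sigma>(Y\<^sub>s))\<close> almost surely. Time-homogeneity is not
  required.\<close>

definition markov_process ::
  "'w measure \<Rightarrow> real set \<Rightarrow> (real \<Rightarrow> 'w \<Rightarrow> real) \<Rightarrow> bool" where
  "markov_process M T Y \<longleftrightarrow>
     prob_space M \<and>
     (\<forall>t\<in>T. Y t \<in> borel_measurable M) \<and>
     (\<forall>s\<in>T. \<forall>t\<in>T. s \<le> t \<longrightarrow> (\<forall>A\<in>sets borel. AE \<omega> in M.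
        real_cond_exp M (past_algebra M T Y s) (\<lambda>\<omega>. indicator A (Y t \<omega>)) \<omega> =
        real_cond_exp M (vimage_algebra (space M) (Y s) borel) (\<lambda>\<omega>. indicator A (Y t \<omega>)) \<omega>))"

definition fdd_density ::
  "real \<Rightarrow> real \<Rightarrow> real \<Rightarrow> nat \<Rightarrow> (nat \<Rightarrow> real) \<Rightarrow> (nat \<Rightarrow> real) \<Rightarrow> real" where
  "fdd_density \<tau> a c d t x =
     1 / norm_const \<tau> a c * exp (c * x 0 + a * x (d + 1)) *
     (\<Prod>k = 1..d + 1. yakubovich_kernel (t k - t (k - 1)) (x (k - 1)) (x k))"

end

theory Submission
  imports Defs "HOL-Real_Asymp.Real_Asymp"
begin

text \<open>
  The function \<open>E(y, w) = exp (- e\<^sup>y cosh w)\<close> intertwines \<open>\<partial>\<^sub>y\<^sup>2 - e\<^sup>2\<^sup>y\<close> with \<open>\<partial>\<^sub>w\<^sup>2\<close>, and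
  \<open>K\<^sub>i\<^sub>u(e\<^sup>y)\<close> is half its Fourier transform in \<open>w\<close>. Hence integrating \<open>p\<^sub>t(x, y)\<close> against \<open>E(y, w)\<close>
  gives the Gaussian average of \<open>E(x, \<cdot>)\<close> around \<open>w\<close> with variance \<open>2 t\<close>; the only special
  value needed is the Fourier transform \<open>\<bar>\<Gamma>(1 + i u)\<bar>\<^sup>2\<close> of the logistic density. Since \<open>E(y, arcosh k)\<close>
  is the \<open>k\<close>-th power of \<open>exp (- e\<^sup>y)\<close>, the Weierstrass theorem turns positivity of \<open>p\<^sub>t\<close> into positivity of
  explicit Gaussian averages, which follows from a splitting scheme. Integrating the
  intertwining relation against \<open>cos (u w)\<close> shows that \<open>K\<^sub>i\<^sub>u(e\<^sup>y)\<close> is an eigenfunction, which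
  yields the Chapman-Kolmogorov equation, and integrating it against exponentials bounds
  the exponential moments, hence \<open>C < \<infinity>\<close>. The process is then the \<open>h\<close>-transform of the
  semigroup, constructed by Kolmogorov extension.
\<close>

section \<open>The Bessel function as a cosine transform\<close>

text \<open>Two obstacles fix the order of the argument. Neither the sign nor the decay of p_t is
  visible in its oscillatory integral: the direct bound is a multiple of K_0(e^x) K_0(e^y), which
  grows linearly as y -> -\<infinity>, exactly where E(y, w) tends to 1. So Fubini cannot be applied
  to p_t times E at the outset. The intertwining relation is therefore first proved for -(d/dw) E =
  e^y sinh(w) E, whose factor e^y restores absolute convergence. This form suffices for positivity;
  once p_t >= 0 is known, Tonelli integrates it over (w, \<infinity>) and recovers the relation for
  E itself.

  The second obstacle is that Chapman-Kolmogorov is usually read off from the orthogonality of the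
  functions K_iu, that is, from the inversion of an index transform. The eigenfunction property
  takes its place: only one of the two kernels is expanded over u, and the other acts on K_iu(e^y)
  as multiplication by e^{-su^2}.\<close>

lemma power_le_fact_mult_exp:
  fixes x :: real
  assumes "0 \<le> x"
  shows "x ^ n \<le> fact n * exp x"
proof -
  have "x ^ n / fact n \<le> (\<Sum>k. x ^ k / fact k)"
    using sum_le_suminf[OF summable_exp, of "{n}" x] assms by (simp add: field_simps)
  also have "\<dots> = exp x"
    by (simp add: exp_def scaleR_conv_of_real divide_inverse mult.commute)
  finally show ?thesis
    by (simp add: field_simps)
qed

lemma exp_abs_le_cosh: "exp \<bar>v\<bar> \<le> 2 * cosh (v :: real)"
  by (auto simp: cosh_field_def abs_if)

lemma abs_sinh_le_cosh: "\<bar>sinh v\<bar> \<le> cosh (v :: real)"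
  using exp_ge_zero[of v] exp_ge_zero[of "- v"] by (auto simp: cosh_field_def sinh_field_def abs_if field_simps simp del: exp_ge_zero)

lemma abs_sinh_le_exp: "\<bar>sinh v\<bar> \<le> exp \<bar>v :: real\<bar>"
  using exp_ge_zero[of v] exp_ge_zero[of "- v"]
  by (auto simp: sinh_field_def abs_if field_simps simp del: exp_ge_zero)

lemma abs_le_cosh: "\<bar>v\<bar> \<le> cosh (v :: real)"
proof -
  have "exp \<bar>v\<bar> \<ge> 1 + \<bar>v\<bar> + \<bar>v\<bar>\<^sup>2 / 2"
    by (rule exp_lower_Taylor_quadratic) auto
  moreover have "1 + \<bar>v\<bar>\<^sup>2 / 2 \<ge> \<bar>v\<bar>"
    using sum_squares_bound[of "1::real" "\<bar>v\<bar>"] zero_le_power2[of "\<bar>v\<bar> - 1"]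
    by (simp add: power2_eq_square algebra_simps)
  ultimately show ?thesis
    using exp_abs_le_cosh[of v] by linarith
qed

lemma integrable_exp_minus_abs:
  fixes k :: real
  assumes "0 < k"
  shows "integrable lborel (\<lambda>x. exp (- k * \<bar>x\<bar>))"
proof -
  have *: "integrable lborel (\<lambda>x::real. indicator {0..} x * exp (- x))"
    using has_bochner_integral_I0i_power_exp_m'[of 0] by (auto simp: has_bochner_integral_iff mult.commute)
  have "integrable lborel (\<lambda>x::real. indicator {0..} (0 + (-1) * x) * exp (- (0 + (-1) * x)))"
    by (rule lborel_integrable_real_affine[OF *]) simp
  then have "integrable lborel (\<lambda>x::real. indicator {0..} x * exp (- x) + indicator {0..} (-x) * exp x)"
    using * by (intro Bochner_Integration.integrable_add) simp_all
  then have "integrable lborel (\<lambda>x::real. exp (- \<bar>x\<bar>))"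
    by (rule Bochner_Integration.integrable_bound) (auto simp: indicator_def)
  then have "integrable lborel (\<lambda>x::real. exp (- \<bar>0 + k * x\<bar>))"
    by (rule lborel_integrable_real_affine) (use assms in auto)
  then show ?thesis
    using assms by (simp add: abs_mult)
qed

lemma set_integral_even:
  fixes f :: "real \<Rightarrow> real"
  assumes f: "integrable lborel f" and even: "\<And>x. f (- x) = f x"
  shows "(LBINT x:{0..}. f x) = (LINT x|lborel. f x) / 2"
proof -
  have [measurable]: "f \<in> borel_measurable borel"
    using f by auto
  have "(LINT x|lborel. f x) = (LINT x|lborel. indicator {0..} x * f x + indicator {..<0} x * f x)"
    by (intro Bochner_Integration.integral_cong) (auto simp: indicator_def)
  also have "\<dots> = (LINT x|lborel. indicator {0..} x * f x) + (LINT x|lborel. indicator {..<0} x * f x)"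
    by (intro Bochner_Integration.integral_add Bochner_Integration.integrable_bound[OF f])
       (auto simp: indicator_def)
  also have "(LINT x|lborel. indicator {..<0} x * f x) = (LINT x|lborel. indicator {..<0} (0 + (-1) * x) * f (0 + (-1) * x))"
    by (subst lborel_integral_real_affine[where c = "-1" and t = 0]) auto
  also have "\<dots> = (LINT x|lborel. indicator {0<..} x * f x)"
    by (intro Bochner_Integration.integral_cong) (auto simp: indicator_def even)
  also have "\<dots> = (LINT x|lborel. indicator {0..} x * f x)"
    by (intro integral_cong_AE) (auto intro!: AE_I[of _ _ "{0}"] simp: indicator_def)
  finally show ?thesis
    by (simp add: set_lebesgue_integral_def)
qed

section \<open>The kernel exp(-e^y cosh v) and its decay in v\<close>

definition cosh_ker :: "real \<Rightarrow> real \<Rightarrow> real" where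
  "cosh_ker y v = exp (- exp y * cosh v)"

text \<open>Minus the derivative of \<open>cosh_ker\<close> in its second argument.\<close>

definition cosh_ker' :: "real \<Rightarrow> real \<Rightarrow> real" where
  "cosh_ker' y v = exp y * sinh v * cosh_ker y v"

lemma cosh_ker_pos: "0 < cosh_ker y v"
  by (simp add: cosh_ker_def)

lemma cosh_ker_le_1: "cosh_ker y v \<le> 1"
  by (simp add: cosh_ker_def)

lemma cosh_ker_minus [simp]: "cosh_ker y (- v) = cosh_ker y v"
  by (simp add: cosh_ker_def)

lemma cosh_ker'_minus [simp]: "cosh_ker' y (- v) = - cosh_ker' y v"
  by (simp add: cosh_ker'_def)

lemma measurable_cosh_ker [measurable (raw)]:
  assumes [measurable]: "f \<in> borel_measurable M" "g \<in> borel_measurable M"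
  shows "(\<lambda>x. cosh_ker (f x) (g x)) \<in> borel_measurable M"
  unfolding cosh_ker_def cosh_field_def by measurable

lemma measurable_cosh_ker' [measurable (raw)]:
  assumes [measurable]: "f \<in> borel_measurable M" "g \<in> borel_measurable M"
  shows "(\<lambda>x. cosh_ker' (f x) (g x)) \<in> borel_measurable M"
  unfolding cosh_ker'_def sinh_field_def by measurable

text \<open>Double exponential decay is traded for a single exponential: e^{-q} <= n!/q^n with q =
  e^y e^{|v|} / 2, which is at most e^y cosh v. Taking \<open>n\<close> beyond \<open>b\<close>
  leaves a decaying exponential, so every exponential moment in v is finite.\<close>

lemma cosh_ker_le_exp:
  assumes "b < real n"
  shows "exp (b * \<bar>v\<bar>) * cosh_ker y v \<le> fact n * (2 / exp y) ^ n * exp (- (real n - b) * \<bar>v\<bar>)"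
proof -
  let ?q = "exp y * exp \<bar>v\<bar> / 2"
  have "?q ^ n \<le> fact n * exp ?q"
    by (rule power_le_fact_mult_exp) simp
  then have "exp (- ?q) \<le> fact n / ?q ^ n"
    by (simp add: exp_minus field_simps)
  moreover have "cosh_ker y v \<le> exp (- ?q)"
    unfolding cosh_ker_def using exp_abs_le_cosh[of v] by (simp add: mult_left_mono)
  ultimately have "cosh_ker y v \<le> fact n / ?q ^ n"
    by linarith
  also have "\<dots> = fact n * (2 / exp y) ^ n * exp (- real n * \<bar>v\<bar>)"
    by (simp add: power_divide power_mult_distrib exp_minus field_simps flip: exp_of_nat_mult)
  finally show ?thesis
    by (simp add: algebra_simps exp_diff exp_add exp_minus field_simps)
qed

lemma integrable_exp_cosh_ker: "integrable lborel (\<lambda>v. exp (b * \<bar>v\<bar>) * cosh_ker y v)"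
proof -
  obtain n :: nat where n: "b < real n"
    using reals_Archimedean2 by blast
  have "integrable lborel (\<lambda>v::real. fact n * (2 / exp y) ^ n * exp (- (real n - b) * \<bar>v\<bar>))"
    using n by (intro integrable_mult_right integrable_exp_minus_abs) auto
  then show ?thesis
    by (rule Bochner_Integration.integrable_bound)
       (use cosh_ker_le_exp[OF n] cosh_ker_pos in \<open>auto simp: abs_mult less_imp_le\<close>)
qed

lemma integrable_cosh_ker: "integrable lborel (cosh_ker y)"
  using integrable_exp_cosh_ker[of 0] by simp

lemma integrable_cosh_ker': "integrable lborel (cosh_ker' y)"
proof -
  have "integrable lborel (\<lambda>v. exp y * (exp (1 * \<bar>v\<bar>) * cosh_ker y v))"
    by (intro integrable_mult_right integrable_exp_cosh_ker)
  then show ?thesis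
  proof (rule Bochner_Integration.integrable_bound)
    show "AE v in lborel. norm (cosh_ker' y v) \<le> norm (exp y * (exp (1 * \<bar>v\<bar>) * cosh_ker y v))"
    proof (rule AE_I2)
      fix v :: real
      show "norm (cosh_ker' y v) \<le> norm (exp y * (exp (1 * \<bar>v\<bar>) * cosh_ker y v))"
        using cosh_ker_pos[of y v] abs_sinh_le_exp[of v] by (simp add: cosh_ker'_def abs_mult mult_right_mono less_imp_le)
    qed
  qed measurable
qed

lemma integrable_mult_bounded:
  fixes f g :: "'a \<Rightarrow> real"
  assumes f: "integrable M f" and [measurable]: "g \<in> borel_measurable M"
    and g: "\<And>x. \<bar>g x\<bar> \<le> B"
  shows "integrable M (\<lambda>x. f x * g x)"
proof (rule Bochner_Integration.integrable_bound)
  show "integrable M (\<lambda>x. B * \<bar>f x\<bar>)"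
    using f by auto
  show "AE x in M. norm (f x * g x) \<le> norm (B * \<bar>f x\<bar>)"
  proof (rule AE_I2)
    fix x
    have "\<bar>f x\<bar> * \<bar>g x\<bar> \<le> \<bar>f x\<bar> * \<bar>B\<bar>"
      using g[of x] by (intro mult_left_mono) auto
    then show "norm (f x * g x) \<le> norm (B * \<bar>f x\<bar>)"
      by (simp add: abs_mult mult.commute)
  qed
qed (use f in measurable)

lemma bessel_K_exp_eq: "bessel_K u (exp y) = (LINT v|lborel. cosh_ker y v * cos (u * v)) / 2"
proof -
  have "bessel_K u (exp y) = (LBINT v:{0..}. cosh_ker y v * cos (u * v))"
    by (simp add: bessel_K_def cosh_ker_def)
  also have "\<dots> = (LINT v|lborel. cosh_ker y v * cos (u * v)) / 2"
    by (intro set_integral_even integrable_mult_bounded[where B = 1] integrable_cosh_ker) simp_all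
  finally show ?thesis .
qed

lemma bessel_K_0_exp: "bessel_K 0 (exp y) = (LINT v|lborel. cosh_ker y v) / 2"
  by (simp add: bessel_K_exp_eq)

lemma lborel_integral_pos:
  fixes f :: "real \<Rightarrow> real"
  assumes f: "integrable lborel f" and pos: "\<And>x. 0 < f x"
  shows "0 < (LINT x|lborel. f x)"
proof -
  have "(LINT x|lborel. f x) \<noteq> 0"
  proof
    assume "(LINT x|lborel. f x) = 0"
    then have "AE x in lborel. f x = 0"
      using f pos by (subst (asm) integral_nonneg_eq_0_iff_AE) (auto simp: less_imp_le)
    then have "AE x in (lborel :: real measure). False"
      by eventually_elim (use pos in \<open>simp add: less_imp_neq [symmetric]\<close>)
    then show False
      by (simp add: AE_iff_measurable[OF _ refl])
  qed
  moreover have "0 \<le> (LINT x|lborel. f x)"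
    using pos by (intro Bochner_Integration.integral_nonneg) (simp add: less_imp_le)
  ultimately show ?thesis
    by simp
qed

lemma bessel_K_0_exp_pos: "0 < bessel_K 0 (exp y)"
  unfolding bessel_K_0_exp
  by (intro divide_pos_pos lborel_integral_pos integrable_cosh_ker cosh_ker_pos) simp

text \<open>The cosine is at most 1 under the integral. As the majorant is free of u, it serves in
  the exchanges of the u-integral with an integral in y.\<close>

lemma abs_bessel_K_le: "\<bar>bessel_K u (exp y)\<bar> \<le> bessel_K 0 (exp y)"
proof -
  have "\<bar>LINT v|lborel. cosh_ker y v * cos (u * v)\<bar> \<le> (LINT v|lborel. \<bar>cosh_ker y v * cos (u * v)\<bar>)"
    by (rule integral_abs_bound)
  also have "\<dots> \<le> (LINT v|lborel. cosh_ker y v)"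
    using cosh_ker_pos[of y] integrable_cosh_ker
    by (intro integral_mono integrable_abs integrable_mult_bounded[where B = 1])
       (auto simp: abs_mult less_imp_le intro!: mult_left_le)
  finally show ?thesis
    by (simp add: bessel_K_exp_eq)
qed

lemma measurable_bessel_K [measurable (raw)]:
  assumes [measurable]: "f \<in> borel_measurable M" "g \<in> borel_measurable M"
  shows "(\<lambda>x. bessel_K (f x) (exp (g x))) \<in> borel_measurable M"
proof -
  have [measurable]: "(\<lambda>(u, y). LINT v|lborel. cosh_ker y v * cos (u * v)) \<in> borel_measurable (borel \<Otimes>\<^sub>M borel)"
    by measurable
  have "(\<lambda>x. (\<lambda>(u, y). LINT v|lborel. cosh_ker y v * cos (u * v)) (f x, g x) / 2) \<in> borel_measurable M"
    by measurable
  then show ?thesis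
    by (simp add: bessel_K_exp_eq)
qed

text \<open>Half the density of the Yakubovich measure, extended evenly to the whole line.\<close>

definition yak_weight :: "real \<Rightarrow> real" where
  "yak_weight u = u * sinh (pi * u) / pi\<^sup>2"

lemma yak_weight_nonneg: "0 \<le> yak_weight u"
proof -
  have "0 \<le> u * sinh (pi * u)"
    by (cases "0 \<le> u") (auto simp: zero_le_mult_iff mult_le_0_iff)
  then show ?thesis
    by (simp add: yak_weight_def)
qed

lemma measurable_yak_weight [measurable]: "yak_weight \<in> borel_measurable borel"
  unfolding yak_weight_def sinh_field_def by measurable

text \<open>Completing the square makes the integrand a constant multiple of the normal density with
  mean k/(2t) and variance 1/(2t).\<close>

lemma integrable_exp_square:
  fixes t k :: real
  assumes "0 < t"
  shows "integrable lborel (\<lambda>u. exp (- t * u\<^sup>2 + k * u))"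
proof -
  define s where "s = sqrt (1 / (2 * t))"
  have s: "s\<^sup>2 = 1 / (2 * t)" "0 < s"
    using assms by (simp_all add: s_def)
  have "integrable lborel (\<lambda>u. sqrt (2 * pi * s\<^sup>2) * exp (k\<^sup>2 / (4 * t)) * normal_density (k / (2 * t)) s u)"
    by (intro integrable_mult_right integrable_normal_density) (use s in auto)
  moreover have "sqrt (2 * pi * s\<^sup>2) * exp (k\<^sup>2 / (4 * t)) * normal_density (k / (2 * t)) s u
      = exp (- t * u\<^sup>2 + k * u)" for u
  proof -
    have "k\<^sup>2 / (4 * t) + - (u - k / (2 * t))\<^sup>2 / (2 * s\<^sup>2) = - t * u\<^sup>2 + k * u"
      unfolding s(1) using assms by (simp add: power2_eq_square field_simps)
    then have "exp (k\<^sup>2 / (4 * t)) * exp (- (u - k / (2 * t))\<^sup>2 / (2 * s\<^sup>2)) = exp (- t * u\<^sup>2 + k * u)"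
      by (metis exp_add)
    then show ?thesis
      using s(2) by (simp add: normal_density_def)
  qed
  ultimately show ?thesis
    by simp
qed

lemma integrable_gauss_exp_abs:
  fixes t k :: real
  assumes "0 < t"
  shows "integrable lborel (\<lambda>u. exp (- t * u\<^sup>2) * exp (k * \<bar>u\<bar>))"
proof (rule Bochner_Integration.integrable_bound)
  show "integrable lborel (\<lambda>u. exp (- t * u\<^sup>2 + k * u) + exp (- t * u\<^sup>2 + (- k) * u))"
    by (intro Bochner_Integration.integrable_add integrable_exp_square assms)
  show "AE u in lborel. norm (exp (- t * u\<^sup>2) * exp (k * \<bar>u\<bar>))
      \<le> norm (exp (- t * u\<^sup>2 + k * u) + exp (- t * u\<^sup>2 + (- k) * u))"
  proof (rule AE_I2)
    fix u :: real
    have "exp (- t * u\<^sup>2) * exp (k * \<bar>u\<bar>) = exp (- t * u\<^sup>2 + k * u) \<or>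
        exp (- t * u\<^sup>2) * exp (k * \<bar>u\<bar>) = exp (- t * u\<^sup>2 + (- k) * u)"
      unfolding exp_add [symmetric] by (cases "0 \<le> u") auto
    then show "norm (exp (- t * u\<^sup>2) * exp (k * \<bar>u\<bar>))
      \<le> norm (exp (- t * u\<^sup>2 + k * u) + exp (- t * u\<^sup>2 + (- k) * u))"
      using exp_ge_zero[of "- t * u\<^sup>2 + k * u"] exp_ge_zero[of "- t * u\<^sup>2 + (- k) * u"]
      unfolding real_norm_def by linarith
  qed
qed measurable

text \<open>The weight grows like |u| e^{pi |u|}, and |u| <= e^{|u|} turns this into a pure
  exponential, which the Gaussian factor beats.\<close>

lemma integrable_yak_weight:
  assumes "0 < t"
  shows "integrable lborel (\<lambda>u. yak_weight u * exp (- t * u\<^sup>2))"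
proof (rule Bochner_Integration.integrable_bound)
  show "integrable lborel (\<lambda>u. exp (- t * u\<^sup>2) * exp ((1 + pi) * \<bar>u\<bar>) / pi\<^sup>2)"
    by (intro integrable_divide integrable_gauss_exp_abs assms)
  show "AE u in lborel. norm (yak_weight u * exp (- t * u\<^sup>2)) \<le> norm (exp (- t * u\<^sup>2) * exp ((1 + pi) * \<bar>u\<bar>) / pi\<^sup>2)"
  proof (rule AE_I2)
    fix u :: real
    have "\<bar>u\<bar> \<le> exp \<bar>u\<bar>"
      using exp_ge_add_one_self[of "\<bar>u\<bar>"] by linarith
    moreover have "\<bar>sinh (pi * u)\<bar> \<le> exp (pi * \<bar>u\<bar>)"
      using abs_sinh_le_exp[of "pi * u"] by (simp add: abs_mult)
    ultimately have "\<bar>u * sinh (pi * u)\<bar> \<le> exp \<bar>u\<bar> * exp (pi * \<bar>u\<bar>)"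
      unfolding abs_mult by (intro mult_mono) auto
    then show "norm (yak_weight u * exp (- t * u\<^sup>2)) \<le> norm (exp (- t * u\<^sup>2) * exp ((1 + pi) * \<bar>u\<bar>) / pi\<^sup>2)"
      by (simp add: yak_weight_def abs_mult divide_right_mono mult.commute exp_add algebra_simps)
  qed
qed measurable

lemma integrable_yak_kernel:
  assumes "0 < t"
  shows "integrable lborel (\<lambda>u. yak_weight u * exp (- t * u\<^sup>2) * bessel_K u (exp x) * bessel_K u (exp y))"
  by (rule integrable_mult_bounded[OF integrable_mult_bounded[OF integrable_yak_weight[OF assms] _ abs_bessel_K_le] _ abs_bessel_K_le])
     measurable

text \<open>The integrand is even in u, so the half line becomes the whole line at the cost of the
  factor 2 left out of \<open>yak_weight\<close>. The whole line is what the Fourier computations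
  work on.\<close>

lemma yak_kernel_eq:
  assumes "0 < t"
  shows "yakubovich_kernel t x y =
    (LINT u|lborel. yak_weight u * exp (- t * u\<^sup>2) * bessel_K u (exp x) * bessel_K u (exp y))"
proof -
  let ?g = "\<lambda>u. exp (- t * u\<^sup>2) * bessel_K u (exp x) * bessel_K u (exp y)"
  have *: "indicator {0<..} u * (2 / pi / (cmod (Gamma (\<i> * complex_of_real u)))\<^sup>2)
      = indicator {0<..} u * (2 * yak_weight u)" for u :: real
    using yakubovich_density_eq[of u] by (auto simp: indicator_def yak_weight_def)
  have ev: "bessel_K (- u) z = bessel_K u z" for u z
    by (simp add: bessel_K_def)
  have "yakubovich_kernel t x y = (LINT u|lborel. indicator {0<..} u * (2 * yak_weight u) * ?g u)"
    unfolding yakubovich_kernel_def yakubovich_measure_def * 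
    by (subst integral_density) (auto simp: yak_weight_nonneg)
  also have "\<dots> = (LBINT u:{0..}. 2 * (yak_weight u * exp (- t * u\<^sup>2) * bessel_K u (exp x) * bessel_K u (exp y)))"
    unfolding set_lebesgue_integral_def
    by (intro integral_cong_AE) (auto intro!: AE_I[of _ _ "{0}"] simp: indicator_def)
  also have "\<dots> = (LINT u|lborel. 2 * (yak_weight u * exp (- t * u\<^sup>2) * bessel_K u (exp x) * bessel_K u (exp y))) / 2"
    by (intro set_integral_even integrable_mult_right integrable_yak_kernel assms) (simp add: ev yak_weight_def)
  finally show ?thesis
    by simp
qed

lemma yak_kernel_sym: "yakubovich_kernel t x y = yakubovich_kernel t y x"
  by (simp add: yakubovich_kernel_def mult.commute mult.left_commute)

lemma measurable_yak_kernel [measurable (raw)]: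
  assumes t: "0 < t" and [measurable]: "f \<in> borel_measurable M" "g \<in> borel_measurable M"
  shows "(\<lambda>x. yakubovich_kernel t (f x) (g x)) \<in> borel_measurable M"
proof -
  have [measurable]: "(\<lambda>(x, y). LINT u|lborel. yak_weight u * exp (- t * u\<^sup>2) * bessel_K u (exp x) * bessel_K u (exp y))
     \<in> borel_measurable (borel \<Otimes>\<^sub>M borel)"
    by measurable
  have "(\<lambda>z. (\<lambda>(x, y). LINT u|lborel. yak_weight u * exp (- t * u\<^sup>2) * bessel_K u (exp x) * bessel_K u (exp y)) (f z, g z)) \<in> borel_measurable M"
    by measurable
  then show ?thesis
    by (simp add: yak_kernel_eq[OF t])
qed

definition yak_mass :: "real \<Rightarrow> real" where
  "yak_mass t = (LINT u|lborel. yak_weight u * exp (- t * u\<^sup>2))"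

lemma yak_mass_nonneg: "0 \<le> yak_mass t"
  unfolding yak_mass_def by (intro Bochner_Integration.integral_nonneg) (simp add: yak_weight_nonneg)

text \<open>All cancellation in u is given up in exchange for separated variables. Since K_0(e^y)
  grows only linearly as y -> -\<infinity>, any additional factor e^{\<alpha>y} with \<alpha> > 0
  makes the bound integrable there.\<close>

lemma abs_yak_kernel_le:
  assumes "0 < t"
  shows "\<bar>yakubovich_kernel t x y\<bar> \<le> yak_mass t * bessel_K 0 (exp x) * bessel_K 0 (exp y)"
proof -
  have "\<bar>yakubovich_kernel t x y\<bar> \<le>
      (LINT u|lborel. \<bar>yak_weight u * exp (- t * u\<^sup>2) * bessel_K u (exp x) * bessel_K u (exp y)\<bar>)"
    unfolding yak_kernel_eq[OF assms] by (rule integral_abs_bound)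
  also have "\<dots> \<le> (LINT u|lborel. yak_weight u * exp (- t * u\<^sup>2) * (bessel_K 0 (exp x) * bessel_K 0 (exp y)))"
  proof (intro integral_mono integrable_abs integrable_yak_kernel integrable_mult_left integrable_yak_weight assms)
    fix u
    have "\<bar>bessel_K u (exp x) * bessel_K u (exp y)\<bar> \<le> bessel_K 0 (exp x) * bessel_K 0 (exp y)"
      unfolding abs_mult by (intro mult_mono abs_bessel_K_le) (auto simp: bessel_K_0_exp_pos less_imp_le)
    then show "\<bar>yak_weight u * exp (- t * u\<^sup>2) * bessel_K u (exp x) * bessel_K u (exp y)\<bar>
        \<le> yak_weight u * exp (- t * u\<^sup>2) * (bessel_K 0 (exp x) * bessel_K 0 (exp y))"
      using yak_weight_nonneg[of u] by (simp add: abs_mult mult.assoc mult_left_mono)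
  qed
  also have "\<dots> = yak_mass t * bessel_K 0 (exp x) * bessel_K 0 (exp y)"
    unfolding yak_mass_def integral_mult_left_zero by (simp add: mult.assoc)
  finally show ?thesis .
qed

section \<open>Gumbel and logistic densities\<close>

lemma integral_FTC_real_line:
  fixes f F :: "real \<Rightarrow> real"
  assumes F: "\<And>x. (F has_real_derivative f x) (at x)" and cont: "\<And>x. isCont f x"
    and int: "integrable lborel f"
    and A: "(F \<longlongrightarrow> A) at_bot" and B: "(F \<longlongrightarrow> B) at_top"
  shows "(LINT x|lborel. f x) = B - A"
proof -
  have "(LBINT x=-\<infinity>..\<infinity>. f x) = B - A"
    by (rule interval_integral_FTC_integrable)
       (use assms in \<open>auto simp: has_real_derivative_iff_has_vector_derivative set_integrable_def ereal_tendsto_simps\<close>)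
  then show ?thesis
    by (simp add: interval_lebesgue_integral_def set_lebesgue_integral_def)
qed

lemma integrable_lborel_prod_bound:
  fixes f :: "real \<Rightarrow> real \<Rightarrow> real"
  assumes [measurable]: "(\<lambda>(x, y). f x y) \<in> borel_measurable (borel \<Otimes>\<^sub>M borel)"
    and g: "integrable lborel g" and h: "integrable lborel h"
    and le: "\<And>x y. \<bar>f x y\<bar> \<le> g x * h y"
  shows "integrable (lborel \<Otimes>\<^sub>M lborel) (\<lambda>(x, y). f x y)"
proof (rule Bochner_Integration.integrable_bound)
  have [measurable]: "g \<in> borel_measurable borel" "h \<in> borel_measurable borel"
    using g h by auto
  show "integrable (lborel \<Otimes>\<^sub>M lborel) (\<lambda>(x, y). g x * h y)"
    by (rule lborel_pair.Fubini_integrable) (use g h in \<open>auto simp: abs_mult intro!: integrable_mult_left integrable_abs\<close>)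
  show "AE p in lborel \<Otimes>\<^sub>M lborel. norm (case p of (x, y) \<Rightarrow> f x y) \<le> norm (case p of (x, y) \<Rightarrow> g x * h y)"
    by (intro AE_I2) (auto intro: order_trans[OF le])
qed measurable

lemma lborel_integral_swap:
  fixes f :: "real \<Rightarrow> real \<Rightarrow> real"
  assumes [measurable]: "(\<lambda>(x, y). f x y) \<in> borel_measurable (borel \<Otimes>\<^sub>M borel)"
    and g: "integrable lborel g" and h: "integrable lborel h"
    and le: "\<And>x y. \<bar>f x y\<bar> \<le> g x * h y"
  shows "(LINT y|lborel. LINT x|lborel. f x y) = (LINT x|lborel. LINT y|lborel. f x y)"
  by (rule lborel_pair.Fubini_integral, rule integrable_lborel_prod_bound[OF assms])

text \<open>For y <= 0 the factor e^{\<alpha>y} decays by itself; for y > 0 the double exponential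
  takes over through e^{-q} <= n!/q^n with n > \<alpha>.\<close>

lemma integrable_exp_minus_exp:
  fixes \<alpha> s :: real
  assumes "0 < \<alpha>" "0 < s"
  shows "integrable lborel (\<lambda>y. exp (\<alpha> * y) * exp (- exp y * s))"
proof -
  obtain n :: nat where n: "\<alpha> < real n"
    using reals_Archimedean2 by blast
  have "integrable lborel (\<lambda>y::real. exp (- \<alpha> * \<bar>y\<bar>) + fact n / s ^ n * exp (- (real n - \<alpha>) * \<bar>y\<bar>))"
    using n assms by (intro Bochner_Integration.integrable_add integrable_mult_right integrable_exp_minus_abs) auto
  then show ?thesis
  proof (rule Bochner_Integration.integrable_bound)
    show "AE y in lborel. norm (exp (\<alpha> * y) * exp (- exp y * s))
        \<le> norm (exp (- \<alpha> * \<bar>y\<bar>) + fact n / s ^ n * exp (- (real n - \<alpha>) * \<bar>y\<bar>))"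
    proof (rule AE_I2)
      fix y :: real
      have "exp (\<alpha> * y) * exp (- exp y * s) \<le> exp (- \<alpha> * \<bar>y\<bar>) + fact n / s ^ n * exp (- (real n - \<alpha>) * \<bar>y\<bar>)"
      proof (cases "y \<le> 0")
        case True
        have "exp (\<alpha> * y) * exp (- exp y * s) \<le> exp (\<alpha> * y)"
          using assms by (intro mult_left_le) auto
        then show ?thesis
          using True assms by (auto intro!: add_increasing2)
      next
        case False
        have "(exp y * s) ^ n \<le> fact n * exp (exp y * s)"
          using assms by (intro power_le_fact_mult_exp) auto
        then have "exp (- exp y * s) \<le> fact n / (exp y * s) ^ n"
          using assms by (simp add: exp_minus field_simps)
        also have "\<dots> = fact n / s ^ n * exp (- real n * y)"
          by (simp add: power_mult_distrib exp_minus field_simps flip: exp_of_nat_mult)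
        finally have "exp (\<alpha> * y) * exp (- exp y * s) \<le> exp (\<alpha> * y) * (fact n / s ^ n * exp (- real n * y))"
          by (rule mult_left_mono) simp
        also have "\<dots> = fact n / s ^ n * exp (- (real n - \<alpha>) * y)"
          by (simp add: algebra_simps exp_diff exp_add exp_minus field_simps)
        finally show ?thesis
          using False by (auto intro!: add_increasing)
      qed
      then show "norm (exp (\<alpha> * y) * exp (- exp y * s))
        \<le> norm (exp (- \<alpha> * \<bar>y\<bar>) + fact n / s ^ n * exp (- (real n - \<alpha>) * \<bar>y\<bar>))"
        by simp
    qed
  qed measurable
qed

text \<open>This is Gamma(\<alpha>) after the substitution x = e^y; its values at 1 and 2 follow
  from explicit antiderivatives.\<close>

definition gumbel_moment :: "real \<Rightarrow> real" where
  "gumbel_moment \<alpha> = (LINT y|lborel. exp (\<alpha> * y) * exp (- exp y))"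

lemma gumbel_moment_nonneg: "0 \<le> gumbel_moment \<alpha>"
  unfolding gumbel_moment_def by (rule Bochner_Integration.integral_nonneg) simp

text \<open>Translation of y by ln s. It also covers the divergent case, where both integrals take
  the default value 0.\<close>

lemma integral_exp_minus_exp:
  assumes "0 < s"
  shows "(LINT y|lborel. exp (\<alpha> * y) * exp (- exp y * s)) = gumbel_moment \<alpha> * s powr (- \<alpha>)"
proof -
  have "(LINT y|lborel. exp (\<alpha> * y) * exp (- exp y * s))
      = (LINT y|lborel. exp (\<alpha> * (- ln s + 1 * y)) * exp (- exp (- ln s + 1 * y) * s))"
    by (subst lborel_integral_real_affine[where c = 1 and t = "- ln s"]) auto
  also have "\<dots> = (LINT y|lborel. exp (\<alpha> * y) * exp (- exp y) * s powr (- \<alpha>))"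
    using assms by (intro Bochner_Integration.integral_cong refl)
      (simp add: algebra_simps exp_diff exp_minus powr_minus powr_def field_simps)
  finally show ?thesis
    by (simp add: gumbel_moment_def)
qed

lemma gumbel_moment_1: "gumbel_moment 1 = 1"
proof -
  have "(LINT y|lborel. exp (1 * y) * exp (- exp y)) = (0 :: real) - (- 1)"
  proof (rule integral_FTC_real_line[where F = "\<lambda>y. - exp (- exp y)"])
    show "integrable lborel (\<lambda>y. exp (1 * y) * exp (- exp y) :: real)"
      using integrable_exp_minus_exp[of 1 1] by simp
    show "((\<lambda>y::real. - exp (- exp y)) \<longlongrightarrow> - 1) at_bot" "((\<lambda>y::real. - exp (- exp y)) \<longlongrightarrow> 0) at_top"
      by real_asymp+
  qed (auto intro!: derivative_eq_intros)
  then show ?thesis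
    by (simp add: gumbel_moment_def)
qed

lemma gumbel_moment_2: "gumbel_moment 2 = 1"
proof -
  have "(LINT y|lborel. exp (2 * y) * exp (- exp y)) = (0 :: real) - (- 1)"
  proof (rule integral_FTC_real_line[where F = "\<lambda>y. - (1 + exp y) * exp (- exp y)"])
    show "integrable lborel (\<lambda>y. exp (2 * y) * exp (- exp y) :: real)"
      using integrable_exp_minus_exp[of 2 1] by simp
    show "((\<lambda>y::real. - (1 + exp y) * exp (- exp y)) \<longlongrightarrow> - 1) at_bot"
         "((\<lambda>y::real. - (1 + exp y) * exp (- exp y)) \<longlongrightarrow> 0) at_top"
      by real_asymp+
    fix y :: real
    have "exp (2 * y) = exp y * exp y"
      by (simp flip: exp_add)
    then show "((\<lambda>y. - (1 + exp y) * exp (- exp y)) has_real_derivative exp (2 * y) * exp (- exp y)) (at y)"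
      by (auto intro!: derivative_eq_intros simp: algebra_simps)
  qed (auto intro!: continuous_intros)
  then show ?thesis
    by (simp add: gumbel_moment_def)
qed

lemma integral_exp_exp_minus_exp:
  fixes s :: real
  assumes "0 < s"
  shows "(LINT y|lborel. exp y * exp (- exp y * s)) = 1 / s"
  using integral_exp_minus_exp[of s 1] assms by (simp add: gumbel_moment_1 powr_minus_divide)

lemma cosh_ker'_eq: "cosh_ker' y w = exp y * sinh w * exp (- exp y * cosh w)"
  by (simp add: cosh_ker'_def cosh_ker_def)

text \<open>The exponentials merge into exp(-e^y s) with s = cosh v + cosh w, and the factor e^y
  makes the integral 1/s. With \<open>cosh_ker\<close> in place of \<open>cosh_ker'\<close> the
  integral would diverge at y -> -\<infinity>.\<close>

lemma integral_cosh_ker'_left: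
  "(LINT y|lborel. cosh_ker' y w * cosh_ker y v) = sinh w / (cosh v + cosh w)"
proof -
  have s: "0 < cosh v + cosh w"
    using cosh_real_pos[of v] cosh_real_pos[of w] by linarith
  have "(LINT y|lborel. cosh_ker' y w * cosh_ker y v)
      = (LINT y|lborel. sinh w * (exp y * exp (- exp y * (cosh v + cosh w))))"
    by (intro Bochner_Integration.integral_cong refl)
       (simp add: cosh_ker'_eq cosh_ker_def exp_add[symmetric] algebra_simps)
  then show ?thesis
    using integral_exp_exp_minus_exp[OF s] by simp
qed

lemma integrable_sinh_div_cosh:
  fixes w :: real
  shows "integrable lborel (\<lambda>v. sinh w / (cosh v + cosh w))"
proof (rule Bochner_Integration.integrable_bound)
  show "integrable lborel (\<lambda>v. 2 * \<bar>sinh w\<bar> * exp (- 1 * \<bar>v\<bar>))"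
    by (intro integrable_mult_right integrable_exp_minus_abs) simp
  show "AE v in lborel. norm (sinh w / (cosh v + cosh w)) \<le> norm (2 * \<bar>sinh w\<bar> * exp (- 1 * \<bar>v\<bar>))"
  proof (rule AE_I2)
    fix v :: real
    have "0 < cosh v + cosh w"
      using cosh_real_pos[of v] cosh_real_pos[of w] by linarith
    moreover have "exp \<bar>v\<bar> \<le> 2 * (cosh v + cosh w)"
      by (rule order_trans[OF exp_abs_le_cosh[of v]]) (simp add: less_imp_le)
    ultimately have "\<bar>sinh w\<bar> / (cosh v + cosh w) \<le> 2 * \<bar>sinh w\<bar> / exp \<bar>v\<bar>"
      using mult_left_mono[of "exp \<bar>v\<bar>" "2 * (cosh v + cosh w)" "\<bar>sinh w\<bar>"] by (simp add: field_simps)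
    then show "norm (sinh w / (cosh v + cosh w)) \<le> norm (2 * \<bar>sinh w\<bar> * exp (- 1 * \<bar>v\<bar>))"
      using \<open>0 < cosh v + cosh w\<close> by (simp add: exp_minus field_simps)
  qed
qed (unfold cosh_field_def sinh_field_def, measurable)

lemma integrable_cosh_ker'_left:
  "integrable lborel (\<lambda>y. cosh_ker' y w * cosh_ker y v)"
proof -
  have "0 < cosh v + cosh w"
    using cosh_real_pos[of v] cosh_real_pos[of w] by linarith
  then have "integrable lborel (\<lambda>y. sinh w * (exp (1 * y) * exp (- exp y * (cosh v + cosh w))))"
    by (intro integrable_mult_right integrable_exp_minus_exp) auto
  also have "(\<lambda>y. sinh w * (exp (1 * y) * exp (- exp y * (cosh v + cosh w)))) = (\<lambda>y. cosh_ker' y w * cosh_ker y v)"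
    by (rule ext) (simp add: cosh_ker'_eq cosh_ker_def exp_add[symmetric] algebra_simps)
  finally show ?thesis .
qed

lemma abs_cosh_ker'_eq: "\<bar>cosh_ker' y w\<bar> = cosh_ker' y \<bar>w\<bar>"
  using cosh_ker_pos[of y w] by (simp add: cosh_ker'_eq abs_mult)

text \<open>\<open>cosh_ker' y\<close> is odd, so its absolute value at w is its value at |w|, and
  the inner integral of the absolute value is known exactly.\<close>

lemma integrable_cosh_ker'_pair:
  "integrable (lborel \<Otimes>\<^sub>M lborel) (\<lambda>(v, y). cosh_ker' y w * cosh_ker y v)"
proof (rule lborel_pair.Fubini_integrable)
  have "(LINT y|lborel. norm (case (v, y) of (v, y) \<Rightarrow> cosh_ker' y w * cosh_ker y v)) = sinh \<bar>w\<bar> / (cosh v + cosh \<bar>w\<bar>)" for v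
    using integral_cosh_ker'_left[of "\<bar>w\<bar>" v]
    by (simp add: abs_mult abs_cosh_ker'_eq cosh_ker_pos less_imp_le)
  then show "integrable lborel (\<lambda>v. LINT y|lborel. norm (case (v, y) of (v, y) \<Rightarrow> cosh_ker' y w * cosh_ker y v))"
    using integrable_sinh_div_cosh[of "\<bar>w\<bar>"] by simp
qed (auto simp: integrable_cosh_ker'_left)

lemma integrable_cosh_ker'_cos_pair:
  "integrable (lborel \<Otimes>\<^sub>M lborel) (\<lambda>(v, y). cosh_ker' y w * (cosh_ker y v * cos (u * v)))"
  by (rule Bochner_Integration.integrable_bound[OF integrable_cosh_ker'_pair[of w]])
     (auto simp: abs_mult mult_left_le intro!: AE_I2 mult_left_mono)

lemma integrable_cosh_ker'_bessel: "integrable lborel (\<lambda>y. cosh_ker' y w * bessel_K u (exp y))"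
  using integrable_divide[OF lborel_pair.integrable_snd[OF integrable_cosh_ker'_cos_pair[of w u]], of 2]
  by (simp add: bessel_K_exp_eq)

text \<open>Writing K_iu as a cosine transform and integrating in y first leaves the cosine
  transform of an explicit function, which the logistic law then evaluates.\<close>

lemma integral_cosh_ker'_bessel:
  "(LINT y|lborel. cosh_ker' y w * bessel_K u (exp y)) = (LINT v|lborel. cos (u * v) * (sinh w / (cosh v + cosh w))) / 2"
proof -
  have "(LINT y|lborel. cosh_ker' y w * bessel_K u (exp y))
      = (LINT y|lborel. LINT v|lborel. cosh_ker' y w * (cosh_ker y v * cos (u * v))) / 2"
    by (simp add: bessel_K_exp_eq)
  also have "\<dots> = (LINT v|lborel. LINT y|lborel. cosh_ker' y w * (cosh_ker y v * cos (u * v))) / 2"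
    using lborel_pair.Fubini_integral[OF integrable_cosh_ker'_cos_pair[of w u]] by simp
  also have "\<dots> = (LINT v|lborel. cos (u * v) * (sinh w / (cosh v + cosh w))) / 2"
    by (simp add: integral_cosh_ker'_left flip: mult.assoc) (simp add: mult.commute)
  finally show ?thesis .
qed

section \<open>The logistic and Gumbel laws and the Gamma function\<close>

definition logistic_density :: "real \<Rightarrow> real" where
  "logistic_density v = exp v / (1 + exp v)\<^sup>2"

text \<open>The density of ln X for a standard exponential X, so that its characteristic function at
  u is Gamma(1 + iu).\<close>

definition gumbel_density :: "real \<Rightarrow> real" where
  "gumbel_density y = exp y * exp (- exp y)"

lemma measurable_logistic_density [measurable]: "logistic_density \<in> borel_measurable borel"
  unfolding logistic_density_def by measurable

lemma measurable_gumbel_density [measurable]: "gumbel_density \<in> borel_measurable borel"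
  unfolding gumbel_density_def by measurable

lemma gumbel_density_nonneg: "0 \<le> gumbel_density y"
  by (simp add: gumbel_density_def)

lemma logistic_density_nonneg: "0 \<le> logistic_density v"
  by (simp add: logistic_density_def)

lemma integrable_gumbel_density: "integrable lborel gumbel_density"
  using integrable_exp_minus_exp[of 1 1] by (simp add: gumbel_density_def[abs_def])

lemma logistic_density_minus: "logistic_density (- v) = logistic_density v"
proof -
  have "1 + exp v \<noteq> 0"
    using exp_gt_zero[of v] by linarith
  then show ?thesis
    by (simp add: logistic_density_def exp_minus field_simps power2_eq_square)
qed

lemma logistic_density_le: "logistic_density v \<le> exp (- 1 * \<bar>v\<bar>)"
proof -
  have *: "logistic_density v \<le> exp (- v)" for v
  proof -
    have "exp v * exp v \<le> (1 + exp v)\<^sup>2"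
      by (simp add: power2_eq_square algebra_simps)
    then show ?thesis
      using add_pos_pos[OF zero_less_one exp_gt_zero[of v]] by (simp add: logistic_density_def exp_minus field_simps)
  qed
  show ?thesis
    using *[of v] *[of "- v"] by (auto simp: logistic_density_minus abs_if)
qed

lemma integrable_logistic_density: "integrable lborel logistic_density"
  by (rule Bochner_Integration.integrable_bound[OF integrable_exp_minus_abs[of 1]])
     (use logistic_density_le in \<open>auto simp: logistic_density_nonneg\<close>)

lemma integral_lincomb:
  fixes f g :: "'a \<Rightarrow> real"
  assumes "integrable M f" "integrable M g"
  shows "(LINT x|M. a * f x + b * g x) = a * (LINT x|M. f x) + b * (LINT x|M. g x)"
  using assms by (subst Bochner_Integration.integral_add) auto

text \<open>The difference of two independent Gumbel variables is logistic. The exponentials merge,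
  and what remains is a rescaled \<open>gumbel_moment 2\<close>.\<close>

lemma gumbel_autocorrelation:
  "(LINT b|lborel. gumbel_density b * gumbel_density (b + v)) = logistic_density v"
proof -
  have p: "0 < 1 + exp v"
    using exp_gt_zero[of v] by linarith
  have "(LINT b|lborel. gumbel_density b * gumbel_density (b + v))
      = (LINT b|lborel. exp v * (exp (2 * b) * exp (- exp b * (1 + exp v))))"
    by (intro Bochner_Integration.integral_cong refl)
       (simp add: gumbel_density_def exp_add[symmetric] algebra_simps)
  also have "\<dots> = logistic_density v"
    using integral_exp_minus_exp[OF p, of 2] p
    by (simp add: gumbel_moment_2 logistic_density_def powr_minus powr_numeral divide_inverse)
  finally show ?thesis .
qed

text \<open>Euler's integral under t = e^y, where t^{iu} becomes \<open>cis (u * y)\<close>. Real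
  and imaginary parts are separated so that the later computations stay real.\<close>

lemma Gamma_one_plus_imaginary:
  "Re (Gamma (1 + \<i> * of_real u)) = (LINT y|lborel. cos (u * y) * gumbel_density y)"
  "Im (Gamma (1 + \<i> * of_real u)) = (LINT y|lborel. sin (u * y) * gumbel_density y)"
proof -
  let ?z = "1 + \<i> * complex_of_real u"
  let ?f = "\<lambda>t. complex_of_real t powr (?z - 1) / of_real (exp t)"
  let ?g = "\<lambda>y. complex_of_real (gumbel_density y) * cis (u * y)"
  have range: "range (exp :: real \<Rightarrow> real) = {0<..}"
    by (auto simp: image_iff) (metis exp_ln)
  have "?f absolutely_integrable_on exp ` UNIV \<and> integral (exp ` UNIV) ?f = Gamma ?z"
    unfolding range using absolutely_integrable_Gamma_integral'[of ?z] Gamma_integral_complex'[of ?z]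
    by (auto intro: integral_unique)
  then have *: "(\<lambda>y. \<bar>exp y\<bar> *\<^sub>R ?f (exp y)) absolutely_integrable_on UNIV \<and>
      integral UNIV (\<lambda>y. \<bar>exp y\<bar> *\<^sub>R ?f (exp y)) = Gamma ?z"
    by (subst has_absolute_integral_change_of_variables_real) (auto intro!: derivative_eq_intros simp: inj_on_def)
  have eq: "\<bar>exp y\<bar> *\<^sub>R ?f (exp y) = ?g y" for y
  proof -
    have "complex_of_real (exp y) powr (?z - 1) = cis (u * y)"
      by (simp add: powr_def Ln_of_real cis_conv_exp mult_ac)
    then show ?thesis
      by (simp add: gumbel_density_def scaleR_conv_of_real exp_minus divide_inverse)
  qed
  from *[unfolded eq] have G: "integral\<^sup>L lebesgue ?g = Gamma ?z" "integrable lebesgue ?g"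
    using set_lebesgue_integral_eq_integral(2)[of UNIV ?g]
    by (simp_all add: set_integrable_def set_lebesgue_integral_def)
  \<comment> \<open>The change of variables yields an integral over the completed measure; Borel
    measurability brings it back to \<open>lborel\<close>.\<close>
  have [measurable]: "?g \<in> borel_measurable lborel"
    by (simp add: cis_conv_exp)
  have g: "integrable lborel ?g" "integral\<^sup>L lborel ?g = Gamma ?z"
    using G by (simp_all add: integrable_completion integral_completion)
  have "Re (integral\<^sup>L lborel ?g) = (LINT y|lborel. Re (?g y))"
       "Im (integral\<^sup>L lborel ?g) = (LINT y|lborel. Im (?g y))"
    using g(1) by (simp_all only: integral_Re integral_Im)
  then show "Re (Gamma (1 + \<i> * of_real u)) = (LINT y|lborel. cos (u * y) * gumbel_density y)"
            "Im (Gamma (1 + \<i> * of_real u)) = (LINT y|lborel. sin (u * y) * gumbel_density y)"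
    unfolding g(2) by (simp_all add: mult.commute)
qed

definition logistic_cf :: "real \<Rightarrow> real" where
  "logistic_cf u = (LINT v|lborel. cos (u * v) * logistic_density v)"

lemma integrable_cos_logistic: "integrable lborel (\<lambda>v. logistic_density v * cos (u * v))"
  by (rule integrable_mult_bounded[OF integrable_logistic_density, where B = 1]) auto

text \<open>For independent Gumbel variables X and X', |E e^{iuX}|^2 is the characteristic function
  of X' - X, whose density is logistic. It is real because that density is even.\<close>

lemma norm_Gamma_one_plus_imaginary: "(cmod (Gamma (1 + \<i> * of_real u)))\<^sup>2 = logistic_cf u"
proof -
  let ?\<phi> = gumbel_density
  let ?C = "LINT y|lborel. cos (u * y) * ?\<phi> y" and ?S = "LINT y|lborel. sin (u * y) * ?\<phi> y"
  have int: "integrable lborel (\<lambda>y. ?\<phi> y * cos (u * y))" "integrable lborel (\<lambda>y. ?\<phi> y * sin (u * y))"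
    by (rule integrable_mult_bounded[OF integrable_gumbel_density, where B = 1]; simp)+
  have pair0: "integrable (lborel \<Otimes>\<^sub>M lborel) (\<lambda>(b, v). ?\<phi> b * ?\<phi> (b + v))"
  proof (rule lborel_pair.Fubini_integrable)
    have sh: "integrable lborel (\<lambda>v. ?\<phi> (b + v))" "(LINT v|lborel. ?\<phi> (b + v)) = (LINT v|lborel. ?\<phi> v)" for b
      using lborel_integrable_real_affine[OF integrable_gumbel_density, of 1 b]
        lborel_integral_real_affine[of 1 ?\<phi> b] by simp_all
    show "integrable lborel (\<lambda>b. LINT v|lborel. norm (case (b, v) of (b, v) \<Rightarrow> ?\<phi> b * ?\<phi> (b + v)))"
      using integrable_gumbel_density by (simp add: abs_mult gumbel_density_nonneg sh)
    show "AE b in lborel. integrable lborel (\<lambda>v. case (b, v) of (b, v) \<Rightarrow> ?\<phi> b * ?\<phi> (b + v))"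
      using sh by auto
  qed measurable
  have pair: "integrable (lborel \<Otimes>\<^sub>M lborel) (\<lambda>(b, v). cos (u * v) * (?\<phi> b * ?\<phi> (b + v)))"
    by (rule Bochner_Integration.integrable_bound[OF pair0])
       (auto simp: abs_mult gumbel_density_nonneg logistic_density_nonneg intro!: AE_I2 mult_left_le_one_le)
  have "logistic_cf u = (LINT v|lborel. LINT b|lborel. cos (u * v) * (?\<phi> b * ?\<phi> (b + v)))"
    unfolding logistic_cf_def gumbel_autocorrelation[symmetric] by simp
  also have "\<dots> = (LINT b|lborel. LINT v|lborel. cos (u * v) * (?\<phi> b * ?\<phi> (b + v)))"
    by (rule lborel_pair.Fubini_integral[OF pair])
  \<comment> \<open>The translation v -> v - b turns cos(uv) into cos(u(v - b)); the addition
    formula then produces C^2 + S^2, the squared modulus in real form.\<close>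
  also have "\<dots> = (LINT b|lborel. ?C * (cos (u * b) * ?\<phi> b) + ?S * (sin (u * b) * ?\<phi> b))"
  proof (intro Bochner_Integration.integral_cong refl)
    fix b :: real
    have "(LINT v|lborel. cos (u * v) * (?\<phi> b * ?\<phi> (b + v)))
        = (LINT v|lborel. cos (u * (- b + 1 * v)) * (?\<phi> b * ?\<phi> (b + (- b + 1 * v))))"
      by (subst lborel_integral_real_affine[where c = 1 and t = "- b"]) auto
    also have "\<dots> = (LINT v|lborel. cos (u * b) * ?\<phi> b * (?\<phi> v * cos (u * v)) + sin (u * b) * ?\<phi> b * (?\<phi> v * sin (u * v)))"
      by (intro Bochner_Integration.integral_cong refl) (simp add: algebra_simps cos_diff)
    also have "\<dots> = ?C * (cos (u * b) * ?\<phi> b) + ?S * (sin (u * b) * ?\<phi> b)"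
    proof -
      have "?C = (LINT v|lborel. ?\<phi> v * cos (u * v))" "?S = (LINT v|lborel. ?\<phi> v * sin (u * v))"
        by (simp_all add: mult.commute)
      then show ?thesis
        unfolding integral_lincomb[OF int] by simp
    qed
    finally show "(LINT v|lborel. cos (u * v) * (?\<phi> b * ?\<phi> (b + v)))
        = ?C * (cos (u * b) * ?\<phi> b) + ?S * (sin (u * b) * ?\<phi> b)" .
  qed
  also have "\<dots> = ?C\<^sup>2 + ?S\<^sup>2"
    using int by (subst Bochner_Integration.integral_add) (auto simp: mult.commute power2_eq_square)
  finally show ?thesis
    by (simp add: cmod_power2 Gamma_one_plus_imaginary)
qed

text \<open>Since |Gamma(1 + iu)| = |u| |Gamma(iu)|, the Gamma factor of the spectral measure
  cancels exactly. Of the remaining u^2, one factor will cancel the denominator of sin(uw)/u and the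
  other will turn K_iu into a sine transform.\<close>

lemma yak_weight_mult_logistic_cf: "yak_weight u * logistic_cf u = u\<^sup>2 / pi"
proof -
  have pos: "yak_weight u * logistic_cf u = u\<^sup>2 / pi" if "0 < u" for u
  proof -
    have ni: "\<i> * complex_of_real u \<notin> \<int>\<^sub>\<le>\<^sub>0"
      using that by (auto elim!: nonpos_Ints_cases simp: complex_eq_iff)
    then have "Gamma (1 + \<i> * complex_of_real u) = \<i> * complex_of_real u * Gamma (\<i> * complex_of_real u)"
      using Gamma_plus1[of "\<i> * complex_of_real u"] by (simp add: add.commute)
    then have "logistic_cf u = u\<^sup>2 * (cmod (Gamma (\<i> * complex_of_real u)))\<^sup>2"
      using norm_Gamma_one_plus_imaginary[of u] that by (simp add: norm_mult power_mult_distrib)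
    moreover have "yak_weight u = 1 / pi / (cmod (Gamma (\<i> * complex_of_real u)))\<^sup>2"
      using yakubovich_density_eq[OF that] by (simp add: yak_weight_def)
    moreover have "Gamma (\<i> * complex_of_real u) \<noteq> 0"
      using ni by (simp add: Gamma_eq_zero_iff)
    ultimately show ?thesis
      by simp
  qed
  have "yak_weight (- u) = yak_weight u" "logistic_cf (- u) = logistic_cf u"
    by (simp_all add: yak_weight_def logistic_cf_def)
  moreover have "yak_weight 0 = 0"
    by (simp add: yak_weight_def)
  ultimately show ?thesis
    using pos[of u] pos[of "- u"] by (cases u "0::real" rule: linorder_cases) auto
qed

text \<open>The ratio is the increment of the logistic distribution function over \<open>[v - w, v + w]\<close>.\<close>

lemma integral_logistic_density_shift:
  assumes "0 \<le> w"
  shows "(LINT z|lborel. logistic_density (v + z) * indicator {-w..w} z) = sinh w / (cosh v + cosh w)"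
proof -
  have p: "1 + exp x > 0" for x :: real
    using exp_gt_zero[of x] by linarith
  have s: "0 < cosh v + cosh w"
    using cosh_real_pos[of v] cosh_real_pos[of w] by linarith
  have "(LINT z|lborel. logistic_density (v + z) * indicator {-w..w} z)
      = - inverse (1 + exp (v + w)) - (- inverse (1 + exp (v + - w)))"
  proof (rule integral_FTC_Icc_real)
    fix z :: real
    show "((\<lambda>z. - inverse (1 + exp (v + z))) has_real_derivative logistic_density (v + z)) (at z)"
      using p[of "v + z"]
      by (auto intro!: derivative_eq_intros simp: logistic_density_def power2_eq_square field_simps)
    show "isCont (\<lambda>z. logistic_density (v + z)) z"
      unfolding logistic_density_def using p[of "v + z"] by (intro continuous_intros) auto
  qed (use assms in auto)
  also have "\<dots> = sinh w / (cosh v + cosh w)"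
  proof -
    have *: "2 * exp v * exp w * (cosh v + cosh w) = (1 + exp (v + w)) * (exp v + exp w)"
      by (simp add: cosh_field_def exp_add exp_minus field_simps)
    have "1 + exp (v + - w) = (exp v + exp w) / exp w"
      using exp_add[of w "v - w"] by (simp add: field_simps)
    then have "- inverse (1 + exp (v + w)) - (- inverse (1 + exp (v + - w)))
       = exp w / (exp v + exp w) - 1 / (1 + exp (v + w))"
      by (simp add: inverse_eq_divide)
    also have "\<dots> = (exp w * (1 + exp (v + w)) - (exp v + exp w)) / ((1 + exp (v + w)) * (exp v + exp w))"
      using p[of "v + w"] exp_gt_zero[of v] exp_gt_zero[of w] add_pos_pos[OF exp_gt_zero[of v] exp_gt_zero[of w]]
      by (simp add: field_simps)
    also have "\<dots> = (2 * exp v * exp w * sinh w) / (2 * exp v * exp w * (cosh v + cosh w))"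
    proof -
      have "exp w * (1 + exp (v + w)) - (exp v + exp w) = 2 * exp v * exp w * sinh w"
        by (simp add: sinh_field_def exp_add exp_minus field_simps)
      then show ?thesis
        unfolding * by simp
    qed
    also have "\<dots> = sinh w / (cosh v + cosh w)"
      by simp
    finally show ?thesis .
  qed
  finally show ?thesis .
qed

text \<open>The ratio is the convolution of the logistic density with the indicator of [-w, w]. Its
  transform is therefore a product, with 2 sin(uw)/u coming from the indicator; the sine part
  vanishes because the logistic density is even.\<close>

lemma integral_cos_sinh_div_cosh:
  assumes w: "0 \<le> w" and u: "u \<noteq> 0"
  shows "(LINT v|lborel. cos (u * v) * (sinh w / (cosh v + cosh w))) = 2 * sin (u * w) / u * logistic_cf u"
proof -
  let ?I = "indicator {-w..w} :: real \<Rightarrow> real"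
  have sh: "integrable lborel (\<lambda>v. logistic_density (v + z))"
      "(LINT v|lborel. logistic_density (v + z)) = (LINT v|lborel. logistic_density v)" for z
    using lborel_integrable_real_affine[OF integrable_logistic_density, of 1 z]
        lborel_integral_real_affine[of 1 logistic_density z] by (simp_all add: add.commute)
  have I: "integrable lborel ?I"
    by (simp add: integrable_indicator_iff emeasure_lborel_Icc_eq)
  have pair0: "integrable (lborel \<Otimes>\<^sub>M lborel) (\<lambda>(z, v). ?I z * logistic_density (v + z))"
  proof (rule lborel_pair.Fubini_integrable)
    show "integrable lborel (\<lambda>z. LINT v|lborel. norm (case (z, v) of (z, v) \<Rightarrow> ?I z * logistic_density (v + z)))"
      using I by (simp add: abs_mult logistic_density_nonneg sh)
    show "AE z in lborel. integrable lborel (\<lambda>v. case (z, v) of (z, v) \<Rightarrow> ?I z * logistic_density (v + z))"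
      using sh by auto
  qed measurable
  have pair: "integrable (lborel \<Otimes>\<^sub>M lborel) (\<lambda>(z, v). cos (u * v) * (?I z * logistic_density (v + z)))"
    by (rule Bochner_Integration.integrable_bound[OF pair0])
       (auto simp: abs_mult gumbel_density_nonneg logistic_density_nonneg intro!: AE_I2 mult_left_le_one_le)
  have sin0: "(LINT v|lborel. logistic_density v * sin (u * v)) = 0"
  proof -
    have "(LINT v|lborel. logistic_density v * sin (u * v)) = (LINT v|lborel. logistic_density (0 + (-1) * v) * sin (u * (0 + (-1) * v)))"
      by (subst lborel_integral_real_affine[where c = "-1" and t = 0]) auto
    then show ?thesis
      by (simp add: logistic_density_minus)
  qed
  have int: "integrable lborel (\<lambda>v. logistic_density v * sin (u * v))"
    by (rule integrable_mult_bounded[OF integrable_logistic_density, where B = 1]) auto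
  have "(LINT v|lborel. cos (u * v) * (sinh w / (cosh v + cosh w)))
      = (LINT v|lborel. LINT z|lborel. cos (u * v) * (?I z * logistic_density (v + z)))"
    unfolding integral_logistic_density_shift[OF w, symmetric] by (simp add: mult.commute)
  also have "\<dots> = (LINT z|lborel. LINT v|lborel. cos (u * v) * (?I z * logistic_density (v + z)))"
    by (rule lborel_pair.Fubini_integral[OF pair])
  also have "\<dots> = (LINT z|lborel. logistic_cf u * (cos (u * z) * ?I z))"
  proof (intro Bochner_Integration.integral_cong refl)
    fix z :: real
    have "(LINT v|lborel. cos (u * v) * (?I z * logistic_density (v + z)))
      = (LINT v|lborel. cos (u * (- z + 1 * v)) * (?I z * logistic_density (- z + 1 * v + z)))"
      by (subst lborel_integral_real_affine[where c = 1 and t = "- z"]) auto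
    also have "\<dots> = (LINT v|lborel. ?I z * cos (u * z) * (logistic_density v * cos (u * v)) + ?I z * sin (u * z) * (logistic_density v * sin (u * v)))"
      by (intro Bochner_Integration.integral_cong refl) (simp add: algebra_simps cos_diff)
    also have "\<dots> = logistic_cf u * (cos (u * z) * ?I z)"
      unfolding integral_lincomb[OF integrable_cos_logistic int] sin0
      by (simp add: logistic_cf_def mult.commute[of "cos _" "logistic_density _"])
    finally show "(LINT v|lborel. cos (u * v) * (?I z * logistic_density (v + z))) = logistic_cf u * (cos (u * z) * ?I z)" .
  qed
  also have "\<dots> = logistic_cf u * (sin (u * w) / u - sin (u * - w) / u)"
    unfolding integral_mult_right_zero
    by (subst integral_FTC_Icc_real[where F = "\<lambda>z. sin (u * z) / u"])
       (use w u in \<open>auto intro!: derivative_eq_intros\<close>)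
  finally show ?thesis
    using u by (simp add: field_simps)
qed

lemma yak_weight_mult_integral_bessel:
  assumes "0 \<le> w"
  shows "yak_weight u * (LINT y|lborel. cosh_ker' y w * bessel_K u (exp y)) = u * sin (u * w) / pi"
proof (cases "u = 0")
  case True
  then show ?thesis by (simp add: yak_weight_def)
next
  case False
  have "yak_weight u * (LINT y|lborel. cosh_ker' y w * bessel_K u (exp y)) = (yak_weight u * logistic_cf u) * sin (u * w) / u"
    unfolding integral_cosh_ker'_bessel integral_cos_sinh_div_cosh[OF assms False] by simp
  then show ?thesis
    using False by (simp add: yak_weight_mult_logistic_cf power2_eq_square)
qed

section \<open>The intertwining relation\<close>

lemma cosh_ker_has_derivative:
  "((\<lambda>v. cosh_ker y v) has_real_derivative - cosh_ker' y v) (at v)"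
  unfolding cosh_ker_def cosh_ker'_def by (auto intro!: derivative_eq_intros simp: field_simps)

lemma cosh_ker_tendsto_0:
  "(cosh_ker y \<longlongrightarrow> 0) at_top" "(cosh_ker y \<longlongrightarrow> 0) at_bot"
proof -
  have *: "(cosh_ker y \<longlongrightarrow> 0) F" if "((\<lambda>v::real. exp (- \<bar>v\<bar> * exp y)) \<longlongrightarrow> 0) F" for F
  proof (rule tendsto_sandwich[OF _ _ tendsto_const that])
    show "\<forall>\<^sub>F v in F. 0 \<le> cosh_ker y v"
      by (simp add: cosh_ker_pos less_imp_le)
    show "\<forall>\<^sub>F v in F. cosh_ker y v \<le> exp (- \<bar>v\<bar> * exp y)"
      using abs_le_cosh by (simp add: cosh_ker_def mult.commute)
  qed
  have e: "0 < exp y" by simp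
  have "((\<lambda>v::real. exp (- \<bar>v\<bar> * c)) \<longlongrightarrow> 0) at_top" "((\<lambda>v::real. exp (- \<bar>v\<bar> * c)) \<longlongrightarrow> 0) at_bot"
    if "0 < c" for c :: real
    using that by real_asymp+
  from this[OF e] show "(cosh_ker y \<longlongrightarrow> 0) at_top" "(cosh_ker y \<longlongrightarrow> 0) at_bot"
    by (auto intro: *)
qed

text \<open>Integration by parts, in the form that the derivative of
  \<open>cosh_ker x v * sin (u * v)\<close> has integral 0. It absorbs the spare factor u, so that
  \<open>cosh_ker'\<close> appears on both sides of the intertwining relation.\<close>

lemma bessel_K_by_parts:
  "u * bessel_K u (exp x) = (LINT v|lborel. cosh_ker' x v * sin (u * v)) / 2"
proof -
  have i1: "integrable lborel (\<lambda>v. cosh_ker x v * cos (u * v))"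
    by (rule integrable_mult_bounded[OF integrable_cosh_ker, where B = 1]) auto
  have i2: "integrable lborel (\<lambda>v. cosh_ker' x v * sin (u * v))"
    by (rule integrable_mult_bounded[OF integrable_cosh_ker', where B = 1]) auto
  have lim: "((\<lambda>v. cosh_ker x v * sin (u * v)) \<longlongrightarrow> 0) F" if "(cosh_ker x \<longlongrightarrow> 0) F" for F
  proof (rule Lim_null_comparison[OF _ that])
    show "\<forall>\<^sub>F v in F. norm (cosh_ker x v * sin (u * v)) \<le> cosh_ker x v"
      using cosh_ker_pos[of x] by (auto simp: abs_mult less_imp_le intro!: always_eventually mult_left_le)
  qed
  have "(LINT v|lborel. u * (cosh_ker x v * cos (u * v)) + (-1) * (cosh_ker' x v * sin (u * v))) = 0 - 0"
  proof (rule integral_FTC_real_line[where F = "\<lambda>v. cosh_ker x v * sin (u * v)"])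
    show "integrable lborel (\<lambda>v. u * (cosh_ker x v * cos (u * v)) + (-1) * (cosh_ker' x v * sin (u * v)))"
      using i1 i2 by (intro Bochner_Integration.integrable_add integrable_mult_right)
    show "((\<lambda>v. cosh_ker x v * sin (u * v)) has_real_derivative
        u * (cosh_ker x v * cos (u * v)) + (-1) * (cosh_ker' x v * sin (u * v))) (at v)" for v
      by (auto intro!: derivative_eq_intros cosh_ker_has_derivative)
    show "isCont (\<lambda>v. u * (cosh_ker x v * cos (u * v)) + (-1) * (cosh_ker' x v * sin (u * v))) v" for v
      unfolding cosh_ker'_def cosh_ker_def by (intro continuous_intros)
  qed (intro lim cosh_ker_tendsto_0)+
  then show ?thesis
    unfolding integral_lincomb[OF i1 i2] by (simp add: bessel_K_exp_eq)
qed

section \<open>Gaussian integrals and the intertwining relation for the derivative\<close>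

lemma integral_std_normal_cos: "(LINT x|lborel. std_normal_density x * cos (z * x)) = exp (- z\<^sup>2 / 2)"
proof -
  have i: "complex_integrable lborel (\<lambda>x. std_normal_density x *\<^sub>R iexp (z * x))"
    by (rule Bochner_Integration.integrable_bound[OF integrable_normal_density[of 1 0]]) auto
  have "complex_of_real (exp (- z\<^sup>2 / 2)) = char std_normal_distribution z"
    by (simp add: char_std_normal_distribution)
  also have "\<dots> = (LINT x|lborel. std_normal_density x *\<^sub>R iexp (z * x))"
    unfolding char_def by (subst integral_density) auto
  finally have "exp (- z\<^sup>2 / 2) = Re (LINT x|lborel. std_normal_density x *\<^sub>R iexp (z * x))"
    by (metis Re_complex_of_real)
  also have "\<dots> = (LINT x|lborel. Re (std_normal_density x *\<^sub>R iexp (z * x)))"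
    by (rule integral_Re[OF i, symmetric])
  finally show ?thesis
    by (simp add: Re_exp)
qed

lemma normal_density_shift: "normal_density \<mu> \<sigma> x = normal_density 0 \<sigma> (\<mu> - x)"
  by (simp add: normal_density_def power2_commute)

text \<open>e^{-tu^2} is the characteristic function of the centred normal law of variance 2t,
  whence the standard deviation \<open>sqrt (2 * t)\<close> from here on.\<close>

lemma integral_gauss_cos:
  assumes "0 < t"
  shows "(LINT u|lborel. exp (- t * u\<^sup>2) * cos (z * u)) = 2 * pi * normal_density 0 (sqrt (2 * t)) z"
proof -
  define s where "s = sqrt (2 * t)"
  have s: "0 < s" "s\<^sup>2 = 2 * t"
    using assms by (simp_all add: s_def)
  have "(LINT x|lborel. std_normal_density x * cos (z / s * x))
      = s * (LINT u|lborel. std_normal_density (0 + s * u) * cos (z / s * (0 + s * u)))"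
    using s by (subst lborel_integral_real_affine[where c = s and t = 0]) auto
  also have "(LINT u|lborel. std_normal_density (0 + s * u) * cos (z / s * (0 + s * u)))
      = (LINT u|lborel. 1 / sqrt (2 * pi) * (exp (- t * u\<^sup>2) * cos (z * u)))"
    using s by (intro Bochner_Integration.integral_cong refl) (simp add: std_normal_density_def power_mult_distrib)
  finally have "exp (- (z / s)\<^sup>2 / 2) = s / sqrt (2 * pi) * (LINT u|lborel. exp (- t * u\<^sup>2) * cos (z * u))"
    unfolding integral_std_normal_cos by simp
  moreover have "normal_density 0 s z = exp (- (z / s)\<^sup>2 / 2) / (s * sqrt (2 * pi))"
    using s(1) by (simp add: normal_density_def power_divide real_sqrt_mult mult.commute)
  ultimately have "sqrt (2 * pi) * sqrt (2 * pi) * normal_density 0 s z = (LINT u|lborel. exp (- t * u\<^sup>2) * cos (z * u))"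
    using s(1) by (simp del: real_sqrt_mult_self)
  then show ?thesis
    unfolding s_def [symmetric] by simp
qed

lemma integrable_gauss:
  assumes "0 < (t :: real)"
  shows "integrable lborel (\<lambda>u. exp (- t * u\<^sup>2))"
  using integrable_gauss_exp_abs[OF assms, of 0] by simp

text \<open>By the product formula for sines this is a multiple of the heat kernel on the half line
  with absorption at 0, in the form given by the method of images.\<close>

lemma integral_gauss_sin_sin:
  assumes "0 < t"
  shows "(LINT u|lborel. exp (- t * u\<^sup>2) * (sin (u * w) * sin (u * v)))
     = pi * (normal_density 0 (sqrt (2 * t)) (w - v) - normal_density 0 (sqrt (2 * t)) (w + v))"
proof -
  have i: "integrable lborel (\<lambda>u. exp (- t * u\<^sup>2) * cos (z * u))" for z
    by (rule integrable_mult_bounded[OF integrable_gauss[OF assms], where B = 1]) auto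
  have "(LINT u|lborel. exp (- t * u\<^sup>2) * (sin (u * w) * sin (u * v)))
     = (LINT u|lborel. 1 / 2 * (exp (- t * u\<^sup>2) * cos ((w - v) * u)) + (- 1 / 2) * (exp (- t * u\<^sup>2) * cos ((w + v) * u)))"
    by (intro Bochner_Integration.integral_cong refl) (simp add: algebra_simps cos_add cos_diff)
  then show ?thesis
    unfolding integral_lincomb[OF i i] integral_gauss_cos[OF assms] by (simp add: algebra_simps)
qed

lemma integrable_normal_density_mult:
  assumes f: "integrable lborel f"
  shows "integrable lborel (\<lambda>v. f v * normal_density \<mu> \<sigma> v)"
proof (cases "\<sigma> = 0")
  case True then show ?thesis by (simp add: normal_density_def)
next
  case False
  show ?thesis
  proof (rule integrable_mult_bounded[OF f, where B = "1 / sqrt (2 * pi * \<sigma>\<^sup>2)"])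
    show "\<bar>normal_density \<mu> \<sigma> v\<bar> \<le> 1 / sqrt (2 * pi * \<sigma>\<^sup>2)" for v
      using False by (simp add: normal_density_def divide_simps)
  qed simp
qed

text \<open>Against an odd function the substitution v -> -v turns the image term into minus the
  direct term, so the difference doubles and the reflection disappears.\<close>

lemma integral_odd_gauss_difference:
  assumes f: "integrable lborel f" and odd: "\<And>v. f (- v) = - f v"
  shows "(LINT v|lborel. f v * (normal_density 0 \<sigma> (w - v) - normal_density 0 \<sigma> (w + v)))
     = 2 * (LINT v|lborel. f v * normal_density w \<sigma> v)"
proof -
  have [measurable]: "f \<in> borel_measurable borel"
    using f by auto
  have i1: "integrable lborel (\<lambda>v. f v * normal_density w \<sigma> v)"
    by (rule integrable_normal_density_mult[OF f])
  have i2: "integrable lborel (\<lambda>v. f v * normal_density (- w) \<sigma> v)"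
    by (rule integrable_normal_density_mult[OF f])
  have e: "normal_density (- w) \<sigma> v = normal_density 0 \<sigma> (w + v)" for v
    by (simp add: normal_density_def power2_commute add.commute)
  have "(LINT v|lborel. f v * normal_density (- w) \<sigma> v) = (LINT v|lborel. f (0 + (-1) * v) * normal_density (- w) \<sigma> (0 + (-1) * v))"
    by (subst lborel_integral_real_affine[where c = "-1" and t = 0]) auto
  also have "\<dots> = (LINT v|lborel. - (f v * normal_density w \<sigma> v))"
    by (intro Bochner_Integration.integral_cong refl) (simp add: odd normal_density_def power2_commute)
  finally have s: "(LINT v|lborel. f v * normal_density (- w) \<sigma> v) = - (LINT v|lborel. f v * normal_density w \<sigma> v)"
    by simp
  have "(LINT v|lborel. f v * (normal_density 0 \<sigma> (w - v) - normal_density 0 \<sigma> (w + v)))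
      = (LINT v|lborel. f v * normal_density w \<sigma> v - f v * normal_density (- w) \<sigma> v)"
    by (simp add: e normal_density_shift[of w] algebra_simps)
  also have "\<dots> = 2 * (LINT v|lborel. f v * normal_density w \<sigma> v)"
    using i1 i2 s by simp
  finally show ?thesis .
qed

lemma integrable_yak_kernel_cosh_ker':
  assumes "0 < t"
  shows "integrable lborel (\<lambda>y. yakubovich_kernel t x y * cosh_ker' y w)"
proof (rule Bochner_Integration.integrable_bound)
  show "integrable lborel (\<lambda>y. yak_mass t * bessel_K 0 (exp x) * (cosh_ker' y w * bessel_K 0 (exp y)))"
    by (intro integrable_mult_right integrable_cosh_ker'_bessel)
  show "AE y in lborel. norm (yakubovich_kernel t x y * cosh_ker' y w)
      \<le> norm (yak_mass t * bessel_K 0 (exp x) * (cosh_ker' y w * bessel_K 0 (exp y)))"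
  proof (rule AE_I2)
    fix y
    have "\<bar>yakubovich_kernel t x y\<bar> * \<bar>cosh_ker' y w\<bar> \<le> yak_mass t * bessel_K 0 (exp x) * bessel_K 0 (exp y) * \<bar>cosh_ker' y w\<bar>"
      by (intro mult_right_mono abs_yak_kernel_le assms) simp
    then show "norm (yakubovich_kernel t x y * cosh_ker' y w)
      \<le> norm (yak_mass t * bessel_K 0 (exp x) * (cosh_ker' y w * bessel_K 0 (exp y)))"
      using bessel_K_0_exp_pos[of x] bessel_K_0_exp_pos[of y] yak_mass_nonneg[of t]
      by (simp add: abs_mult mult_ac)
  qed
qed (use assms in measurable)

lemma yak_kernel_cosh_ker':
  assumes t: "0 < t" and w: "0 \<le> w"
  shows "(LINT y|lborel. yakubovich_kernel t x y * cosh_ker' y w)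
     = (LINT v|lborel. cosh_ker' x v * normal_density w (sqrt (2 * t)) v)"
proof -
  let ?n = "normal_density 0 (sqrt (2 * t))"
  have "(LINT y|lborel. yakubovich_kernel t x y * cosh_ker' y w)
     = (LINT y|lborel. LINT u|lborel. yak_weight u * exp (- t * u\<^sup>2) * bessel_K u (exp x) * (cosh_ker' y w * bessel_K u (exp y)))"
    unfolding yak_kernel_eq[OF t] integral_mult_left_zero[symmetric]
    by (simp add: mult_ac)
  also have "\<dots> = (LINT u|lborel. LINT y|lborel. yak_weight u * exp (- t * u\<^sup>2) * bessel_K u (exp x) * (cosh_ker' y w * bessel_K u (exp y)))"
  proof (rule lborel_integral_swap[where g = "\<lambda>u. yak_weight u * exp (- t * u\<^sup>2)" and
        h = "\<lambda>y. bessel_K 0 (exp x) * \<bar>cosh_ker' y w * bessel_K 0 (exp y)\<bar>"])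
    show "integrable lborel (\<lambda>y. bessel_K 0 (exp x) * \<bar>cosh_ker' y w * bessel_K 0 (exp y)\<bar>)"
      by (intro integrable_mult_right integrable_abs integrable_cosh_ker'_bessel)
    fix u y
    have "\<bar>bessel_K u (exp x)\<bar> * (\<bar>cosh_ker' y w\<bar> * \<bar>bessel_K u (exp y)\<bar>) \<le> bessel_K 0 (exp x) * (\<bar>cosh_ker' y w\<bar> * \<bar>bessel_K 0 (exp y)\<bar>)"
      using bessel_K_0_exp_pos[of x] bessel_K_0_exp_pos[of y]
      by (intro mult_mono abs_bessel_K_le order_trans[OF abs_bessel_K_le abs_ge_self]) auto
    from mult_left_mono[OF this, of "yak_weight u * exp (- t * u\<^sup>2)"]
    show "\<bar>yak_weight u * exp (- t * u\<^sup>2) * bessel_K u (exp x) * (cosh_ker' y w * bessel_K u (exp y))\<bar>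
        \<le> yak_weight u * exp (- t * u\<^sup>2) * (bessel_K 0 (exp x) * \<bar>cosh_ker' y w * bessel_K 0 (exp y)\<bar>)"
      by (simp add: abs_mult yak_weight_nonneg mult_ac)
  qed (use integrable_yak_weight[OF t] in \<open>simp_all\<close>)
  \<comment> \<open>The y-integral cancels the spectral weight and leaves u sin(uw) / pi; the factor
    u is grouped with K_iu for the integration by parts.\<close>
  also have "\<dots> = (LINT u|lborel. exp (- t * u\<^sup>2) * (u * bessel_K u (exp x)) * sin (u * w) / pi)"
  proof (intro Bochner_Integration.integral_cong refl)
    fix u :: real
    have "(LINT y|lborel. yak_weight u * exp (- t * u\<^sup>2) * bessel_K u (exp x) * (cosh_ker' y w * bessel_K u (exp y)))
       = exp (- t * u\<^sup>2) * bessel_K u (exp x) * (yak_weight u * (LINT y|lborel. cosh_ker' y w * bessel_K u (exp y)))"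
      by (simp only: integral_mult_right_zero[symmetric] mult_ac)
    then show "(LINT y|lborel. yak_weight u * exp (- t * u\<^sup>2) * bessel_K u (exp x) * (cosh_ker' y w * bessel_K u (exp y)))
       = exp (- t * u\<^sup>2) * (u * bessel_K u (exp x)) * sin (u * w) / pi"
      unfolding yak_weight_mult_integral_bessel[OF w] by (simp add: mult_ac)
  qed
  \<comment> \<open>u K_iu(e^x) is half the sine transform of \<open>cosh_ker' x\<close>, which
    supplies the second sine and the factor 2 in the denominator.\<close>
  also have "\<dots> = (LINT u|lborel. LINT v|lborel. exp (- t * u\<^sup>2) * (sin (u * w) * sin (u * v)) * cosh_ker' x v) / (2 * pi)"
    unfolding bessel_K_by_parts integral_divide_zero[symmetric] integral_mult_left_zero[symmetric] integral_mult_right_zero[symmetric]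
    by (simp add: mult_ac)
  also have "(LINT u|lborel. LINT v|lborel. exp (- t * u\<^sup>2) * (sin (u * w) * sin (u * v)) * cosh_ker' x v)
      = (LINT v|lborel. LINT u|lborel. exp (- t * u\<^sup>2) * (sin (u * w) * sin (u * v)) * cosh_ker' x v)"
  proof (rule lborel_integral_swap[where h = "\<lambda>u. exp (- t * u\<^sup>2)" and g = "\<lambda>v. \<bar>cosh_ker' x v\<bar>"])
    fix u v
    have "\<bar>sin (u * w)\<bar> * \<bar>sin (u * v)\<bar> \<le> 1 * 1"
      by (intro mult_mono) auto
    from mult_left_mono[OF this, of "\<bar>cosh_ker' x v\<bar> * exp (- t * u\<^sup>2)"]
    show "\<bar>exp (- t * u\<^sup>2) * (sin (u * w) * sin (u * v)) * cosh_ker' x v\<bar> \<le> \<bar>cosh_ker' x v\<bar> * exp (- t * u\<^sup>2)"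
      by (simp add: abs_mult mult_ac)
  qed (use integrable_gauss[OF t] integrable_cosh_ker' in auto)
  also have "\<dots> = (LINT v|lborel. pi * (cosh_ker' x v * (?n (w - v) - ?n (w + v))))"
    by (simp add: integral_gauss_sin_sin[OF t, simplified]) (simp add: mult_ac)
  also have "\<dots> / (2 * pi) = (LINT v|lborel. cosh_ker' x v * normal_density w (sqrt (2 * t)) v)"
    by (simp add: integral_odd_gauss_difference[OF integrable_cosh_ker'])
  finally show ?thesis .
qed

section \<open>Positivity\<close>

lemma taylor_second_order_bound:
  fixes f f1 f2 f3 :: "real \<Rightarrow> real"
  assumes f: "\<And>x. (f has_real_derivative f1 x) (at x)"
    and f1: "\<And>x. (f1 has_real_derivative f2 x) (at x)"
    and f2: "\<And>x. (f2 has_real_derivative f3 x) (at x)"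
    and B: "\<And>x. \<bar>f3 x\<bar> \<le> B"
  shows "\<bar>f (x + h) - (f x + h * f1 x + h\<^sup>2 / 2 * f2 x)\<bar> \<le> B / 6 * \<bar>h\<bar> ^ 3"
proof -
  define diff where "diff m s = ([f, f1, f2, f3] ! m) (x + s)" for m :: nat and s :: real
  have D: "(diff m has_real_derivative diff (Suc m) s) (at s)" if "m < 3" for m s
  proof -
    have sh: "((\<lambda>s. g (x + s)) has_real_derivative g' (x + s)) (at s)"
      if "\<And>x. (g has_real_derivative g' x) (at x)" for g g'
      using that[of "x + s"] DERIV_shift[of g "g' (x + s)" s x] by (simp add: add.commute)
    from \<open>m < 3\<close> have "m = 0 \<or> m = 1 \<or> m = 2" by auto
    then show ?thesis
      using sh[OF f] sh[OF f1] sh[OF f2] by (auto simp: diff_def[abs_def] numeral_3_eq_3 numeral_2_eq_2)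
  qed
  have "\<exists>t. \<bar>t\<bar> \<le> \<bar>h\<bar> \<and> f (x + h) = (\<Sum>m<3. diff m 0 / fact m * h ^ m) + diff 3 t / fact 3 * h ^ 3"
  proof (rule Maclaurin_bi_le[where f = "\<lambda>s. f (x + s)" and diff = diff])
    show "diff 0 = (\<lambda>s. f (x + s))"
      by (simp add: diff_def[abs_def])
  qed (use D in blast)
  then obtain t where "f (x + h) = (\<Sum>m<3. diff m 0 / fact m * h ^ m) + diff 3 t / fact 3 * h ^ 3"
    by blast
  then have eq: "f (x + h) - (f x + h * f1 x + h\<^sup>2 / 2 * f2 x) = f3 (x + t) / 6 * h ^ 3"
    by (simp add: diff_def numeral_3_eq_3 numeral_2_eq_2 lessThan_Suc)
  show ?thesis
    unfolding eq using B[of "x + t"] by (simp add: abs_mult power_abs mult_right_mono)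
qed

lemma power_mult_exp_minus_le_fact:
  assumes "0 \<le> (b :: real)"
  shows "b ^ n * exp (- b) \<le> fact n"
  using power_le_fact_mult_exp[OF assms, of n] by (simp add: exp_minus field_simps)

text \<open>Write a = \<open>exp_sinh y v\<close> and b = \<open>exp_cosh y v\<close>.
  Differentiation in v exchanges a and b and differentiation in y fixes both, so all derivatives of
  \<open>cosh_ker'\<close> are polynomials in a and b times e^{-b}. Together with |a| <= b and b^n
  e^{-b} <= n! this bounds them uniformly in both variables.\<close>

definition exp_sinh :: "real \<Rightarrow> real \<Rightarrow> real" where
  "exp_sinh y v = exp y * sinh v"

definition exp_cosh :: "real \<Rightarrow> real \<Rightarrow> real" where
  "exp_cosh y v = exp y * cosh v"

lemma exp_cosh_nonneg: "0 \<le> exp_cosh y v"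
  by (simp add: exp_cosh_def)

lemma abs_exp_sinh_le: "\<bar>exp_sinh y v\<bar> \<le> exp_cosh y v"
  using abs_sinh_le_cosh[of v] by (simp add: exp_cosh_def exp_sinh_def abs_mult)

lemma exp_le_exp_cosh: "exp y \<le> exp_cosh y v"
  using cosh_real_ge_1[of v] by (simp add: exp_cosh_def)

lemma exp_double_le_exp_cosh: "exp (2 * y) \<le> (exp_cosh y v)\<^sup>2"
  using power_mono[OF exp_le_exp_cosh[of y v], of 2] unfolding exp_double by simp

lemma exp_cosh_square_diff: "(exp_cosh y v)\<^sup>2 - (exp_sinh y v)\<^sup>2 = exp (2 * y)"
  unfolding exp_double by (simp add: exp_cosh_def exp_sinh_def power_mult_distrib cosh_square_eq algebra_simps)

lemma cosh_ker'_exp_sinh: "cosh_ker' y v = exp_sinh y v * exp (- exp_cosh y v)"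
  by (simp add: cosh_ker'_eq exp_sinh_def exp_cosh_def)

lemma exp_cosh_power_le:
  "exp_cosh y v * exp (- exp_cosh y v) \<le> 1" "(exp_cosh y v)\<^sup>2 * exp (- exp_cosh y v) \<le> 2"
  "exp_cosh y v ^ 3 * exp (- exp_cosh y v) \<le> 6" "exp_cosh y v ^ 4 * exp (- exp_cosh y v) \<le> 24"
  "exp_cosh y v ^ 5 * exp (- exp_cosh y v) \<le> 120"
  using power_mult_exp_minus_le_fact[OF exp_cosh_nonneg, of _ _ 1] power_mult_exp_minus_le_fact[OF exp_cosh_nonneg, of _ _ 2]
    power_mult_exp_minus_le_fact[OF exp_cosh_nonneg, of _ _ 3] power_mult_exp_minus_le_fact[OF exp_cosh_nonneg, of _ _ 4]
    power_mult_exp_minus_le_fact[OF exp_cosh_nonneg, of _ _ 5]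
  by (simp_all add: fact_numeral)

lemma abs_monomial_le: "\<bar>exp_sinh y v ^ i * exp_cosh y v ^ j\<bar> \<le> exp_cosh y v ^ (i + j)"
proof -
  have "\<bar>exp_sinh y v\<bar> ^ i * exp_cosh y v ^ j \<le> exp_cosh y v ^ i * exp_cosh y v ^ j"
    by (intro mult_right_mono power_mono abs_exp_sinh_le) (auto simp: exp_cosh_nonneg)
  then show ?thesis
    by (simp add: abs_mult power_abs power_add exp_cosh_nonneg)
qed

lemma abs_cosh_ker'_le_1: "\<bar>cosh_ker' y v\<bar> \<le> 1"
proof -
  have "\<bar>exp_sinh y v\<bar> * exp (- exp_cosh y v) \<le> exp_cosh y v * exp (- exp_cosh y v)"
    by (intro mult_right_mono abs_exp_sinh_le) simp
  also have "\<dots> \<le> 1"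
    by (rule exp_cosh_power_le)
  finally show ?thesis
    by (simp add: cosh_ker'_exp_sinh abs_mult)
qed

lemma exp_sinh_cosh_derivatives:
  "((\<lambda>v. exp_sinh y v) has_real_derivative exp_cosh y v) (at v)"
  "((\<lambda>v. exp_cosh y v) has_real_derivative exp_sinh y v) (at v)"
  "((\<lambda>y. exp_sinh y v) has_real_derivative exp_sinh y v) (at y)"
  "((\<lambda>y. exp_cosh y v) has_real_derivative exp_cosh y v) (at y)"
  unfolding exp_sinh_def exp_cosh_def by (auto intro!: derivative_eq_intros)

text \<open>\<open>ker_v\<close> to \<open>ker_yyy\<close> are the partial derivatives of
  \<open>cosh_ker'\<close>, not of \<open>cosh_ker\<close>. They go up to order three because the
  local errors of the splitting scheme are of third order.\<close>

definition ker_v :: "real \<Rightarrow> real \<Rightarrow> real" where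
  "ker_v y v = (let a = exp_sinh y v; b = exp_cosh y v in (b - a\<^sup>2) * exp (- b))"

definition ker_vv :: "real \<Rightarrow> real \<Rightarrow> real" where
  "ker_vv y v = (let a = exp_sinh y v; b = exp_cosh y v in (a - 3 * a * b + a ^ 3) * exp (- b))"

definition ker_vvv :: "real \<Rightarrow> real \<Rightarrow> real" where
  "ker_vvv y v = (let a = exp_sinh y v; b = exp_cosh y v in
     (b - 3 * b\<^sup>2 - 4 * a\<^sup>2 + 6 * a\<^sup>2 * b - a ^ 4) * exp (- b))"

definition ker_y :: "real \<Rightarrow> real \<Rightarrow> real" where
  "ker_y y v = (let a = exp_sinh y v; b = exp_cosh y v in (a - a * b) * exp (- b))"

definition ker_yy :: "real \<Rightarrow> real \<Rightarrow> real" where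
  "ker_yy y v = (let a = exp_sinh y v; b = exp_cosh y v in (a - 3 * a * b + a * b\<^sup>2) * exp (- b))"

definition ker_yyy :: "real \<Rightarrow> real \<Rightarrow> real" where
  "ker_yyy y v = (let a = exp_sinh y v; b = exp_cosh y v in
     (a - 7 * a * b + 6 * a * b\<^sup>2 - a * b ^ 3) * exp (- b))"

lemma ker_derivatives_v:
  "((\<lambda>v. cosh_ker' y v) has_real_derivative ker_v y v) (at v)"
  "((\<lambda>v. ker_v y v) has_real_derivative ker_vv y v) (at v)"
  "((\<lambda>v. ker_vv y v) has_real_derivative ker_vvv y v) (at v)"
  unfolding cosh_ker'_exp_sinh ker_v_def ker_vv_def ker_vvv_def Let_def
  by (auto intro!: derivative_eq_intros exp_sinh_cosh_derivatives)
     (simp_all add: algebra_simps power2_eq_square power3_eq_cube power4_eq_xxxx)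

lemma ker_derivatives_y:
  "((\<lambda>y. cosh_ker' y v) has_real_derivative ker_y y v) (at y)"
  "((\<lambda>y. ker_y y v) has_real_derivative ker_yy y v) (at y)"
  "((\<lambda>y. ker_yy y v) has_real_derivative ker_yyy y v) (at y)"
  unfolding cosh_ker'_exp_sinh ker_y_def ker_yy_def ker_yyy_def Let_def
  by (auto intro!: derivative_eq_intros exp_sinh_cosh_derivatives)
     (simp_all add: algebra_simps power2_eq_square power3_eq_cube power4_eq_xxxx)

text \<open>The differential form of the intertwining, for \<open>cosh_ker'\<close>; it amounts to
  b^2 - a^2 = e^{2y}.\<close>

lemma ker_vv_eq: "ker_vv y v = ker_yy y v - exp (2 * y) * cosh_ker' y v"
  unfolding ker_vv_def ker_yy_def cosh_ker'_exp_sinh exp_cosh_square_diff[of y v, symmetric] Let_def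
  by (simp add: algebra_simps power2_eq_square power3_eq_cube)

text \<open>By |a| <= b the polynomial is at most b + 7 b^2 + 6 b^3 + b^4, and b^n e^{-b} <= n!
  gives 1 + 14 + 36 + 24 = 75. The y-derivative below meets the same polynomial bound.\<close>

lemma abs_ker_vvv_le: "\<bar>ker_vvv y v\<bar> \<le> 75"
proof -
  let ?a = "exp_sinh y v" and ?b = "exp_cosh y v"
  have "\<bar>?b - 3 * ?b\<^sup>2 - 4 * ?a\<^sup>2 + 6 * ?a\<^sup>2 * ?b - ?a ^ 4\<bar> \<le> ?b + 7 * ?b\<^sup>2 + 6 * ?b ^ 3 + ?b ^ 4"
  proof -
    have "?a\<^sup>2 \<le> ?b\<^sup>2" "?a ^ 4 \<le> ?b ^ 4"
      using abs_monomial_le[of y v 2 0] abs_monomial_le[of y v 4 0] by simp_all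
    moreover from mult_right_mono[OF this(1), of ?b] have "?a\<^sup>2 * ?b \<le> ?b ^ 3"
      by (simp add: exp_cosh_nonneg power2_eq_square power3_eq_cube)
    moreover have "0 \<le> ?b" "0 \<le> ?a\<^sup>2" "0 \<le> ?a\<^sup>2 * ?b" "0 \<le> ?a ^ 4" "0 \<le> ?b\<^sup>2" "0 \<le> ?b ^ 3"
      by (simp_all add: exp_cosh_nonneg)
    ultimately show ?thesis
      unfolding mult.assoc by linarith
  qed
  then have "\<bar>ker_vvv y v\<bar> \<le> (?b + 7 * ?b\<^sup>2 + 6 * ?b ^ 3 + ?b ^ 4) * exp (- ?b)"
    by (simp add: ker_vvv_def Let_def abs_mult)
  also have "\<dots> \<le> 1 + 7 * 2 + 6 * 6 + 24"
    using exp_cosh_power_le[of y v] by (simp add: algebra_simps)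
  finally show ?thesis by simp
qed

lemma abs_ker_yyy_le: "\<bar>ker_yyy y v\<bar> \<le> 75"
proof -
  let ?a = "exp_sinh y v" and ?b = "exp_cosh y v"
  have triangle: "\<bar>p - q + r - s\<bar> \<le> \<bar>p\<bar> + \<bar>q\<bar> + \<bar>r\<bar> + \<bar>s\<bar>" for p q r s :: real
    by linarith
  have "\<bar>?a - 7 * ?a * ?b + 6 * ?a * ?b\<^sup>2 - ?a * ?b ^ 3\<bar> \<le> \<bar>?a\<bar> + 7 * \<bar>?a * ?b\<bar> + 6 * \<bar>?a * ?b\<^sup>2\<bar> + \<bar>?a * ?b ^ 3\<bar>"
    using triangle[of ?a "7 * ?a * ?b" "6 * ?a * ?b\<^sup>2" "?a * ?b ^ 3"] by (simp add: abs_mult)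
  also have "\<dots> \<le> ?b + 7 * ?b\<^sup>2 + 6 * ?b ^ 3 + ?b ^ 4"
    using abs_monomial_le[of y v 1 0] abs_monomial_le[of y v 1 1] abs_monomial_le[of y v 1 2]
      abs_monomial_le[of y v 1 3] by (simp add: numeral_eq_Suc)
  finally have "\<bar>ker_yyy y v\<bar> \<le> (?b + 7 * ?b\<^sup>2 + 6 * ?b ^ 3 + ?b ^ 4) * exp (- ?b)"
    by (simp add: ker_yyy_def Let_def abs_mult)
  also have "\<dots> \<le> 1 + 7 * 2 + 6 * 6 + 24"
    using exp_cosh_power_le[of y v] by (simp add: algebra_simps)
  finally show ?thesis by simp
qed

lemma exp_2_ker_derivative:
  "((\<lambda>y. exp (2 * y) * cosh_ker' y v) has_real_derivative exp (2 * y) * (2 * cosh_ker' y v + ker_y y v)) (at y)"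
  by (auto intro!: derivative_eq_intros ker_derivatives_y simp: algebra_simps)

text \<open>The potential e^{2y} is unbounded, but it is at most b^2 and so is absorbed by e^{-b} as
  well: 3 * 3! + 4! = 42.\<close>

lemma abs_exp_2_ker_derivative_le: "\<bar>exp (2 * y) * (2 * cosh_ker' y v + ker_y y v)\<bar> \<le> 42"
proof -
  let ?a = "exp_sinh y v" and ?b = "exp_cosh y v"
  have "\<bar>2 * ?a + (?a - ?a * ?b)\<bar> \<le> 3 * \<bar>?a\<bar> + \<bar>?a * ?b\<bar>"
    using abs_triangle_ineq4[of "3 * ?a" "?a * ?b"] by (simp add: abs_mult)
  also have "\<dots> \<le> 3 * ?b + ?b\<^sup>2"
    using abs_monomial_le[of y v 1 0] abs_monomial_le[of y v 1 1] by (simp add: power2_eq_square)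
  finally have "exp (2 * y) * \<bar>2 * ?a + (?a - ?a * ?b)\<bar> \<le> ?b\<^sup>2 * (3 * ?b + ?b\<^sup>2)"
    by (intro mult_mono exp_double_le_exp_cosh) auto
  then have "exp (2 * y) * \<bar>2 * ?a + (?a - ?a * ?b)\<bar> * exp (- ?b) \<le> ?b\<^sup>2 * (3 * ?b + ?b\<^sup>2) * exp (- ?b)"
    by (rule mult_right_mono) simp
  also have "\<dots> = 3 * (?b ^ 3 * exp (- ?b)) + ?b ^ 4 * exp (- ?b)"
    by (simp add: algebra_simps numeral_eq_Suc)
  also have "\<dots> \<le> 42"
    using exp_cosh_power_le[of y v] by simp
  finally have "exp (2 * y) * \<bar>2 * ?a + (?a - ?a * ?b)\<bar> * exp (- ?b) \<le> 42" .
  moreover have "2 * cosh_ker' y v + ker_y y v = (2 * ?a + (?a - ?a * ?b)) * exp (- ?b)"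
    by (simp add: cosh_ker'_exp_sinh ker_y_def Let_def algebra_simps)
  ultimately show ?thesis
    by (simp add: abs_mult)
qed

text \<open>The exact semigroup of the potential over a time h^2. Its linearisation 1 - h^2 e^{2y} /
  2 becomes negative for large y, so it would not preserve positivity.\<close>

definition killed :: "real \<Rightarrow> (real \<Rightarrow> real) \<Rightarrow> real \<Rightarrow> real" where
  "killed h f y = exp (- (h\<^sup>2 / 2 * exp (2 * y))) * f y"

text \<open>A symmetric random walk step of size h after killing. Its variance h^2 matches that of
  the Gaussian step \<open>gauss_avg h\<close> in the other variable, and it visibly preserves
  positivity.\<close>

definition euler_step :: "real \<Rightarrow> (real \<Rightarrow> real) \<Rightarrow> real \<Rightarrow> real" where
  "euler_step h f y = (killed h f (y + h) + killed h f (y - h)) / 2"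

lemma abs_exp_minus_le:
  fixes q :: real
  assumes "0 \<le> q"
  shows "\<bar>exp (- q) - (1 - q)\<bar> \<le> q\<^sup>2 / 2"
proof -
  have "exp (- q) \<le> 1 - q + q\<^sup>2 / 2"
  proof -
    have "(\<lambda>q. 1 - q + q\<^sup>2 / 2 - exp (- q)) 0 \<le> (\<lambda>q. 1 - q + q\<^sup>2 / 2 - exp (- q)) q"
    proof (rule DERIV_nonneg_imp_nondecreasing[OF assms])
      fix x :: real
      show "\<exists>d. ((\<lambda>q. 1 - q + q\<^sup>2 / 2 - exp (- q)) has_real_derivative d) (at x) \<and> 0 \<le> d"
        using exp_ge_add_one_self[of "- x"]
        by (intro exI[of _ "- 1 + x + exp (- x)"]) (auto intro!: derivative_eq_intros simp: field_simps)
    qed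
    then show ?thesis by simp
  qed
  then show ?thesis
    using exp_ge_add_one_self[of "- q"] by simp
qed

text \<open>The quadratic remainder of e^{-q} at q = h^2 e^{2y} / 2 carries e^{4y} <= b^4. With |a|
  <= b this meets b^5 e^{-b} <= 120, so the constant is 120 / 8 = 15, and h <= 1 lowers the power of
  h from four to three.\<close>

lemma abs_killed_cosh_ker'_le:
  assumes "0 \<le> h" "h \<le> 1"
  shows "\<bar>killed h (\<lambda>y. cosh_ker' y v) y - (cosh_ker' y v - h\<^sup>2 / 2 * (exp (2 * y) * cosh_ker' y v))\<bar> \<le> 15 * h ^ 3"
proof -
  let ?q = "h\<^sup>2 / 2 * exp (2 * y)" and ?b = "exp_cosh y v"
  have "\<bar>killed h (\<lambda>y. cosh_ker' y v) y - (cosh_ker' y v - h\<^sup>2 / 2 * (exp (2 * y) * cosh_ker' y v))\<bar>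
      = \<bar>exp (- ?q) - (1 - ?q)\<bar> * \<bar>cosh_ker' y v\<bar>"
    by (simp add: killed_def algebra_simps flip: abs_mult)
  also have "\<dots> \<le> ?q\<^sup>2 / 2 * (?b * exp (- ?b))"
    using abs_exp_minus_le[of ?q] abs_exp_sinh_le[of y v]
    by (intro mult_mono) (auto simp: cosh_ker'_exp_sinh abs_mult)
  also have "\<dots> = h ^ 4 / 8 * ((exp (2 * y))\<^sup>2 * (?b * exp (- ?b)))"
    by (simp add: power_mult_distrib power_divide)
  also have "\<dots> \<le> h ^ 4 / 8 * ((?b\<^sup>2)\<^sup>2 * (?b * exp (- ?b)))"
    by (intro mult_left_mono mult_right_mono power_mono exp_double_le_exp_cosh) (auto simp: exp_cosh_nonneg)
  also have "\<dots> = h ^ 4 / 8 * (?b ^ 5 * exp (- ?b))"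
    by (simp add: numeral_eq_Suc)
  also have "\<dots> \<le> h ^ 4 / 8 * 120"
    by (intro mult_left_mono exp_cosh_power_le) simp
  also have "\<dots> \<le> 15 * h ^ 3"
    using assms power_decreasing[of 3 4 h] by simp
  finally show ?thesis .
qed

text \<open>The first-order terms at y + h and y - h cancel and the second-order ones combine to
  \<open>ker_vv\<close>. The constant 49 rounds up 15 + 75/6 + 21: linearising the killing,
  expanding in y, and moving the potential from the shifted point back to y.\<close>

lemma abs_euler_step_cosh_ker'_le:
  assumes h: "0 \<le> h" "h \<le> 1"
  shows "\<bar>euler_step h (\<lambda>y. cosh_ker' y v) y - (cosh_ker' y v + h\<^sup>2 / 2 * ker_vv y v)\<bar> \<le> 49 * h ^ 3"
proof -
  let ?H = "\<lambda>y. cosh_ker' y v" and ?G = "\<lambda>y. exp (2 * y) * cosh_ker' y v"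
  have T: "\<bar>?H (y + s) - (?H y + s * ker_y y v + s\<^sup>2 / 2 * ker_yy y v)\<bar> \<le> 75 / 6 * \<bar>s\<bar> ^ 3" for s
    by (rule taylor_second_order_bound[OF ker_derivatives_y abs_ker_yyy_le])
  have G: "\<bar>?G (y + s) - ?G y\<bar> \<le> 42 * \<bar>s\<bar>" for s
    using field_differentiable_bound[where S = UNIV and f = ?G and f' = "\<lambda>y. exp (2 * y) * (2 * cosh_ker' y v + ker_y y v)" and B = 42 and x = "y + s" and y = y]
      exp_2_ker_derivative abs_exp_2_ker_derivative_le by simp
  have G': "\<bar>h\<^sup>2 / 2 * (?G (y + s) - ?G y)\<bar> \<le> 21 * h ^ 3" if "\<bar>s\<bar> = h" for s
    using mult_left_mono[OF G[of s], of "h\<^sup>2 / 2"] that h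
    by (simp add: abs_mult power2_eq_square power3_eq_cube mult_ac)
  define k where "k = (\<lambda>s. killed h ?H (y + s))"
  have K: "\<bar>k s - (?H y + s * ker_y y v + s\<^sup>2 / 2 * ker_yy y v - h\<^sup>2 / 2 * ?G y)\<bar> \<le> 15 * h ^ 3 + 75 / 6 * h ^ 3 + 21 * h ^ 3"
    if "\<bar>s\<bar> = h" for s
    using abs_killed_cosh_ker'_le[OF h, of v "y + s"] T[of s, unfolded that] G'[OF that] that
    unfolding k_def right_diff_distrib by linarith
  define r where "r s = k s - (?H y + s * ker_y y v + s\<^sup>2 / 2 * ker_yy y v - h\<^sup>2 / 2 * ?G y)" for s
  have eq: "euler_step h ?H y - (?H y + h\<^sup>2 / 2 * ker_vv y v) = (r h + r (- h)) / 2"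
    by (simp add: r_def euler_step_def k_def ker_vv_eq algebra_simps)
  have "\<bar>r h\<bar> \<le> 15 * h ^ 3 + 75 / 6 * h ^ 3 + 21 * h ^ 3" "\<bar>r (- h)\<bar> \<le> 15 * h ^ 3 + 75 / 6 * h ^ 3 + 21 * h ^ 3"
    using K[of h] K[of "- h"] h by (simp_all add: r_def)
  moreover have "0 \<le> h ^ 3"
    using h by simp
  ultimately have "\<bar>(r h + r (- h)) / 2\<bar> \<le> 49 * h ^ 3"
    using abs_triangle_ineq[of "r h" "r (- h)"] by simp
  with eq show ?thesis
    by simp
qed

text \<open>Scaling a standard normal variable keeps \<sigma> = 0 meaningful, where the average is f
  itself; the induction over the steps of the scheme starts there. \<open>normal_density\<close>
  with deviation 0 would give 0 instead.\<close>

definition gauss_avg :: "real \<Rightarrow> (real \<Rightarrow> real) \<Rightarrow> real \<Rightarrow> real" where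
  "gauss_avg \<sigma> f w = (LINT x|lborel. std_normal_density x * f (w + \<sigma> * x))"

definition abs_moment_3 :: real where
  "abs_moment_3 = (LINT x|lborel. std_normal_density x * \<bar>x\<bar> ^ 3)"

lemma abs_moment_3_nonneg: "0 \<le> abs_moment_3"
  unfolding abs_moment_3_def by (rule Bochner_Integration.integral_nonneg) simp

lemma integrable_gauss_avg:
  assumes [measurable]: "f \<in> borel_measurable borel" and "\<And>x. \<bar>f x\<bar> \<le> B"
  shows "integrable lborel (\<lambda>x. std_normal_density x * f (w + \<sigma> * x))"
  by (rule integrable_mult_bounded[where B = B]) (use assms in auto)

text \<open>The first moment of the normal law is 0 and the second is 1, so the average agrees with
  the same second-order expansion as the Euler step. The constant 13 rounds up 75/6.\<close>

lemma abs_gauss_avg_cosh_ker'_le: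
  assumes "0 \<le> h"
  shows "\<bar>gauss_avg h (cosh_ker' y) v - (cosh_ker' y v + h\<^sup>2 / 2 * ker_vv y v)\<bar> \<le> 13 * abs_moment_3 * h ^ 3"
proof -
  let ?n = std_normal_density
  have n1: "(LINT x|lborel. ?n x * x) = 0" "integrable lborel (\<lambda>x. ?n x * x)"
    using normal_moment_nz_1[of 1 0] by (simp_all add: has_bochner_integral_iff)
  have n2: "(LINT x|lborel. ?n x * x\<^sup>2) = 1" "integrable lborel (\<lambda>x. ?n x * x\<^sup>2)"
    using std_normal_moment_even[of 1] by (simp_all add: has_bochner_integral_iff)
  have i: "integrable lborel (\<lambda>x. ?n x * cosh_ker' y (v + h * x))"
    by (rule integrable_gauss_avg[OF _ abs_cosh_ker'_le_1]) measurable
  let ?p = "\<lambda>x. ?n x * cosh_ker' y v + (h * ker_v y v) * (?n x * x) + (h\<^sup>2 / 2 * ker_vv y v) * (?n x * x\<^sup>2)"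
  have ip: "integrable lborel ?p"
    using n1 n2 by auto
  have "(LINT x|lborel. ?p x) = cosh_ker' y v + h\<^sup>2 / 2 * ker_vv y v"
    using n1 n2 by simp
  then have "\<bar>gauss_avg h (cosh_ker' y) v - (cosh_ker' y v + h\<^sup>2 / 2 * ker_vv y v)\<bar>
      = \<bar>LINT x|lborel. ?n x * cosh_ker' y (v + h * x) - ?p x\<bar>"
    using i ip by (simp add: gauss_avg_def)
  also have "\<dots> \<le> (LINT x|lborel. \<bar>?n x * cosh_ker' y (v + h * x) - ?p x\<bar>)"
    by (rule integral_abs_bound)
  also have "\<dots> \<le> (LINT x|lborel. 13 * h ^ 3 * (?n x * \<bar>x\<bar> ^ 3))"
  proof (rule integral_mono)
    show "integrable lborel (\<lambda>x. \<bar>?n x * cosh_ker' y (v + h * x) - ?p x\<bar>)"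
      using i ip by (intro integrable_abs Bochner_Integration.integrable_diff)
    show "integrable lborel (\<lambda>x. 13 * h ^ 3 * (?n x * \<bar>x\<bar> ^ 3))"
      by (intro integrable_mult_right integrable_std_normal_moment_abs)
    fix x :: real
    have "\<bar>cosh_ker' y (v + h * x) - (cosh_ker' y v + h * x * ker_v y v + (h * x)\<^sup>2 / 2 * ker_vv y v)\<bar> \<le> 75 / 6 * \<bar>h * x\<bar> ^ 3"
      by (rule taylor_second_order_bound[OF ker_derivatives_v abs_ker_vvv_le])
    also have "\<dots> \<le> 13 * h ^ 3 * \<bar>x\<bar> ^ 3"
      using assms by (simp add: abs_mult power_mult_distrib mult_right_mono)
    finally have "?n x * \<bar>cosh_ker' y (v + h * x) - (cosh_ker' y v + h * x * ker_v y v + (h * x)\<^sup>2 / 2 * ker_vv y v)\<bar> \<le> ?n x * (13 * h ^ 3 * \<bar>x\<bar> ^ 3)"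
      by (rule mult_left_mono) simp
    moreover have "?n x * cosh_ker' y (v + h * x) - ?p x = ?n x * (cosh_ker' y (v + h * x) - (cosh_ker' y v + h * x * ker_v y v + (h * x)\<^sup>2 / 2 * ker_vv y v))"
      by (simp add: algebra_simps power_mult_distrib)
    ultimately show "\<bar>?n x * cosh_ker' y (v + h * x) - ?p x\<bar> \<le> 13 * h ^ 3 * (?n x * \<bar>x\<bar> ^ 3)"
      by (simp add: abs_mult mult_ac)
  qed
  finally show ?thesis
    unfolding integral_mult_right_zero abs_moment_3_def by (simp add: mult_ac)
qed

lemma gauss_avg_conv_normal:
  assumes "0 < \<sigma>" and [measurable]: "f \<in> borel_measurable borel"
  shows "gauss_avg \<sigma> f w = (LINT v|lborel. normal_density 0 \<sigma> v * f (w + v))"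
proof -
  have "(LINT v|lborel. normal_density 0 \<sigma> v * f (w + v))
     = \<sigma> * (LINT x|lborel. normal_density 0 \<sigma> (0 + \<sigma> * x) * f (w + (0 + \<sigma> * x)))"
    using assms by (subst lborel_integral_real_affine[where c = \<sigma> and t = 0]) auto
  also have "\<dots> = (LINT x|lborel. \<sigma> * (normal_density 0 \<sigma> (\<sigma> * x) * f (w + \<sigma> * x)))"
    by simp
  also have "\<dots> = gauss_avg \<sigma> f w"
    unfolding gauss_avg_def using assms
    by (intro Bochner_Integration.integral_cong refl)
       (simp add: normal_density_def real_sqrt_mult power_mult_distrib)
  finally show ?thesis ..
qed

lemma gauss_avg_eq:
  assumes "0 < \<sigma>" and [measurable]: "f \<in> borel_measurable borel"
  shows "gauss_avg \<sigma> f w = (LINT v|lborel. f v * normal_density w \<sigma> v)"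
proof -
  have "(LINT v|lborel. f v * normal_density w \<sigma> v) = (LINT v|lborel. f (w + 1 * v) * normal_density w \<sigma> (w + 1 * v))"
    by (subst lborel_integral_real_affine[where c = 1 and t = w]) auto
  from this[symmetric] show ?thesis
    by (simp add: gauss_avg_conv_normal[OF assms] normal_density_def mult.commute)
qed

lemma gauss_avg_0: "gauss_avg 0 f w = f w"
  by (simp add: gauss_avg_def)

lemma measurable_gauss_avg [measurable]:
  assumes [measurable]: "f \<in> borel_measurable borel"
  shows "gauss_avg \<sigma> f \<in> borel_measurable borel"
  unfolding gauss_avg_def[abs_def] by measurable

lemma abs_gauss_avg_le:
  assumes f[measurable]: "f \<in> borel_measurable borel" and B: "\<And>x. \<bar>f x\<bar> \<le> B"
  shows "\<bar>gauss_avg \<sigma> f w\<bar> \<le> B"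
proof -
  have "\<bar>gauss_avg \<sigma> f w\<bar> \<le> (LINT x|lborel. \<bar>std_normal_density x * f (w + \<sigma> * x)\<bar>)"
    unfolding gauss_avg_def by (rule integral_abs_bound)
  also have "\<dots> \<le> (LINT x|lborel. std_normal_density x * B)"
    using B by (intro integral_mono integrable_abs integrable_gauss_avg[OF f B])
      (auto simp: abs_mult intro!: mult_left_mono)
  finally show ?thesis
    by simp
qed

text \<open>Variances add under convolution of normal laws, and boundedness of f justifies
  Fubini.\<close>

lemma gauss_avg_gauss_avg:
  assumes \<sigma>: "0 \<le> \<sigma>" and h: "0 < h"
    and f[measurable]: "f \<in> borel_measurable borel" and B: "\<And>x. \<bar>f x\<bar> \<le> B"
  shows "gauss_avg \<sigma> (gauss_avg h f) w = gauss_avg (sqrt (\<sigma>\<^sup>2 + h\<^sup>2)) f w"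
proof (cases "\<sigma> = 0")
  case True
  then show ?thesis using h by (simp add: gauss_avg_0)
next
  case False
  with \<sigma> have \<sigma>: "0 < \<sigma>" by simp
  have s: "0 < sqrt (\<sigma>\<^sup>2 + h\<^sup>2)"
    using h by (simp add: add_nonneg_pos)
  have conv: "(LINT a|lborel. normal_density 0 h (z - a) * normal_density 0 \<sigma> a) = normal_density 0 (sqrt (\<sigma>\<^sup>2 + h\<^sup>2)) z" for z
    using fun_cong[OF conv_normal_density_zero_mean[OF h \<sigma>], of z]
    by (subst integral_eq_nn_integral) (auto simp: add.commute)
  have "gauss_avg \<sigma> (gauss_avg h f) w
      = (LINT a|lborel. LINT z|lborel. normal_density 0 h (z - a) * normal_density 0 \<sigma> a * f (w + z))"
  proof -
    have "gauss_avg h f (w + a) = (LINT z|lborel. normal_density 0 h (z - a) * f (w + z))" for a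
    proof -
      have "(LINT z|lborel. normal_density 0 h (z - a) * f (w + z))
        = (LINT b|lborel. normal_density 0 h (a + 1 * b - a) * f (w + (a + 1 * b)))"
        by (subst lborel_integral_real_affine[where c = 1 and t = a]) auto
      then show ?thesis
        using h by (simp add: gauss_avg_conv_normal add.assoc)
    qed
    then show ?thesis
      using \<sigma> by (simp add: gauss_avg_conv_normal mult_ac flip: integral_mult_right_zero)
  qed
  also have "\<dots> = (LINT z|lborel. LINT a|lborel. normal_density 0 h (z - a) * normal_density 0 \<sigma> a * f (w + z))"
  proof (rule lborel_pair.Fubini_integral)
    have B0: "0 \<le> B" using B[of 0] by linarith
    have p: "integrable (lborel \<Otimes>\<^sub>M lborel) (\<lambda>(z, a). normal_density 0 h (z - a) * normal_density 0 \<sigma> a)"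
    proof (rule lborel_pair.Fubini_integrable)
      show "integrable lborel (\<lambda>z. LINT a|lborel. norm (case (z, a) of (z, a) \<Rightarrow> normal_density 0 h (z - a) * normal_density 0 \<sigma> a))"
        using s by (simp add: abs_mult conv)
      show "AE z in lborel. integrable lborel (\<lambda>a. case (z, a) of (z, a) \<Rightarrow> normal_density 0 h (z - a) * normal_density 0 \<sigma> a)"
      proof (rule AE_I2)
        fix z :: real
        \<comment> \<open>A nonzero value certifies integrability, because the integral of a
          function that is not integrable is 0 by default.\<close>
        have "(LINT a|lborel. normal_density 0 h (z - a) * normal_density 0 \<sigma> a) \<noteq> 0"
          using normal_density_pos[OF s, of 0 z] by (simp add: conv)
        then show "integrable lborel (\<lambda>a. case (z, a) of (z, a) \<Rightarrow> normal_density 0 h (z - a) * normal_density 0 \<sigma> a)"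
          using not_integrable_integral_eq by fastforce
      qed
    qed measurable
    show "integrable (lborel \<Otimes>\<^sub>M lborel) (\<lambda>(z, a). normal_density 0 h (z - a) * normal_density 0 \<sigma> a * f (w + z))"
    proof -
      have "integrable (lborel \<Otimes>\<^sub>M lborel) (\<lambda>p. (case p of (z, a) \<Rightarrow> normal_density 0 h (z - a) * normal_density 0 \<sigma> a) * (case p of (z, a) \<Rightarrow> f (w + z)))"
        by (rule integrable_mult_bounded[OF p, where B = B]) (use B in \<open>auto split: prod.split\<close>)
      then show ?thesis
        by (simp add: case_prod_unfold)
    qed
  qed
  also have "\<dots> = gauss_avg (sqrt (\<sigma>\<^sup>2 + h\<^sup>2)) f w"
    using s by (simp add: conv gauss_avg_conv_normal)
  finally show ?thesis .
qed

text \<open>The Euler step acts in y and the average in v, so they commute. The discrepancy after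
  one more step is thus an average of the local error, and averaging does not enlarge it: the bound
  depends neither on \<sigma> nor on y.\<close>

lemma gauss_avg_sum_step:
  fixes c w :: "'i \<Rightarrow> real" and S :: "'i set"
  defines "V \<equiv> \<lambda>\<sigma> y. \<Sum>k\<in>S. c k * gauss_avg \<sigma> (cosh_ker' y) (w k)"
  assumes \<sigma>: "0 \<le> \<sigma>" and h: "0 < h" "h \<le> 1"
  shows "\<bar>V (sqrt (\<sigma>\<^sup>2 + h\<^sup>2)) y - euler_step h (V \<sigma>) y\<bar> \<le> (\<Sum>k\<in>S. \<bar>c k\<bar>) * ((49 + 13 * abs_moment_3) * h ^ 3)"
proof -
  have es: "euler_step h (V \<sigma>) y = (\<Sum>k\<in>S. c k * gauss_avg \<sigma> (\<lambda>v. euler_step h (\<lambda>y. cosh_ker' y v) y) (w k))"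
  proof -
    have i: "integrable lborel (\<lambda>x. std_normal_density x * cosh_ker' z (w k + \<sigma> * x))" for z k
      by (rule integrable_gauss_avg[OF _ abs_cosh_ker'_le_1]) measurable
    define E1 where "E1 = exp (- (h\<^sup>2 / 2 * exp (2 * (y + h)))) / 2"
    define E2 where "E2 = exp (- (h\<^sup>2 / 2 * exp (2 * (y - h)))) / 2"
    have step: "euler_step h f y = E1 * f (y + h) + E2 * f (y - h)" for f
      by (simp add: euler_step_def killed_def E1_def E2_def add_divide_distrib)
    have "gauss_avg \<sigma> (\<lambda>v. euler_step h (\<lambda>y. cosh_ker' y v) y) (w k)
      = E1 * gauss_avg \<sigma> (cosh_ker' (y + h)) (w k) + E2 * gauss_avg \<sigma> (cosh_ker' (y - h)) (w k)" for k
      unfolding gauss_avg_def integral_lincomb[OF i i, symmetric] step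
      by (intro Bochner_Integration.integral_cong refl) (simp add: algebra_simps)
    then show ?thesis
      by (simp add: step V_def sum_distrib_left distrib_left sum.distrib mult.left_commute)
  qed
  have V': "V (sqrt (\<sigma>\<^sup>2 + h\<^sup>2)) y = (\<Sum>k\<in>S. c k * gauss_avg \<sigma> (gauss_avg h (cosh_ker' y)) (w k))"
    unfolding V_def by (subst gauss_avg_gauss_avg[OF \<sigma> h(1) _ abs_cosh_ker'_le_1]) (auto intro: measurable_cosh_ker')
  have d: "\<bar>gauss_avg h (cosh_ker' y) v - euler_step h (\<lambda>y. cosh_ker' y v) y\<bar> \<le> (49 + 13 * abs_moment_3) * h ^ 3" for v
    using abs_gauss_avg_cosh_ker'_le[of h y v] abs_euler_step_cosh_ker'_le[of h v y] h
    unfolding distrib_right by linarith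
  have [measurable]: "(\<lambda>v. euler_step h (\<lambda>y. cosh_ker' y v) y) \<in> borel_measurable borel"
    unfolding euler_step_def killed_def by measurable
  have [measurable]: "cosh_ker' y \<in> borel_measurable borel"
    by measurable
  have diff: "\<bar>gauss_avg \<sigma> (gauss_avg h (cosh_ker' y)) (w k) - gauss_avg \<sigma> (\<lambda>v. euler_step h (\<lambda>y. cosh_ker' y v) y) (w k)\<bar> \<le> (49 + 13 * abs_moment_3) * h ^ 3" for k
  proof -
    let ?D = "\<lambda>v. gauss_avg h (cosh_ker' y) v - euler_step h (\<lambda>y. cosh_ker' y v) y"
    have g1: "\<bar>gauss_avg h (cosh_ker' y) v\<bar> \<le> 1" for v
      by (rule abs_gauss_avg_le[OF _ abs_cosh_ker'_le_1]) measurable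
    have g2: "\<bar>euler_step h (\<lambda>y. cosh_ker' y v) y\<bar> \<le> 1 + (49 + 13 * abs_moment_3) * h ^ 3" for v
      using g1[of v] d[of v] by linarith
    have "gauss_avg \<sigma> (gauss_avg h (cosh_ker' y)) (w k) - gauss_avg \<sigma> (\<lambda>v. euler_step h (\<lambda>y. cosh_ker' y v) y) (w k) = gauss_avg \<sigma> ?D (w k)"
      unfolding gauss_avg_def[of \<sigma>]
      using integrable_gauss_avg[where f = "gauss_avg h (cosh_ker' y)" and w = "w k" and \<sigma> = \<sigma>, OF _ g1]
        integrable_gauss_avg[where f = "\<lambda>v. euler_step h (\<lambda>y. cosh_ker' y v) y" and w = "w k" and \<sigma> = \<sigma>, OF _ g2]
      by (subst Bochner_Integration.integral_diff[symmetric]) (auto simp: right_diff_distrib)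
    then show ?thesis
      using abs_gauss_avg_le[where f = ?D and \<sigma> = \<sigma> and w = "w k", OF _ d] by simp
  qed
  have "\<bar>V (sqrt (\<sigma>\<^sup>2 + h\<^sup>2)) y - euler_step h (V \<sigma>) y\<bar>
     = \<bar>\<Sum>k\<in>S. c k * (gauss_avg \<sigma> (gauss_avg h (cosh_ker' y)) (w k) - gauss_avg \<sigma> (\<lambda>v. euler_step h (\<lambda>y. cosh_ker' y v) y) (w k))\<bar>"
    by (simp add: es V' right_diff_distrib sum_subtractf)
  also have "\<dots> \<le> (\<Sum>k\<in>S. \<bar>c k\<bar> * ((49 + 13 * abs_moment_3) * h ^ 3))"
    by (rule order_trans[OF sum_abs]) (auto simp: abs_mult intro!: sum_mono mult_left_mono diff)
  finally show ?thesis
    by (simp add: sum_distrib_right)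
qed

text \<open>Splitting \<open>\<partial>\<^sub>v\<^sup>2 = \<partial>\<^sub>y\<^sup>2 - e\<^sup>2\<^sup>y\<close> into positivity preserving steps of local
  error \<open>O(h\<^sup>3)\<close>, of which there are \<open>O(h\<^sup>-\<^sup>2)\<close>.\<close>

lemma gauss_avg_sum_nonneg:
  fixes c w :: "'i \<Rightarrow> real"
  assumes nonneg: "\<And>y. 0 \<le> (\<Sum>k\<in>S. c k * cosh_ker' y (w k))" and \<sigma>: "0 < \<sigma>"
  shows "0 \<le> (\<Sum>k\<in>S. c k * gauss_avg \<sigma> (cosh_ker' y) (w k))"
proof -
  define V where "V = (\<lambda>\<sigma> y. \<Sum>k\<in>S. c k * gauss_avg \<sigma> (cosh_ker' y) (w k))"
  define C where "C = (\<Sum>k\<in>S. \<bar>c k\<bar>) * (49 + 13 * abs_moment_3)"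
  have C: "0 \<le> C"
    unfolding C_def using abs_moment_3_nonneg by (intro mult_nonneg_nonneg sum_nonneg) auto
  have step: "- (real j * (C * h ^ 3)) \<le> V (h * sqrt (real j)) y" if h: "0 < h" "h \<le> 1" for h y j
  proof (induction j arbitrary: y)
    case 0
    show ?case using nonneg by (simp add: V_def gauss_avg_0)
  next
    case (Suc j)
    let ?m = "real j * (C * h ^ 3)"
    \<comment> \<open>Killing multiplies by a factor in [0, 1], so a lower bound that is at most 0
      survives it.\<close>
    have k: "- ?m \<le> killed h (V (h * sqrt (real j))) z" for z
    proof (cases "0 \<le> V (h * sqrt (real j)) z")
      case True
      moreover have "0 \<le> ?m" using C h by simp
      ultimately show ?thesis
        by (smt (verit) killed_def exp_ge_zero mult_nonneg_nonneg)
    next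
      case False
      then have "V (h * sqrt (real j)) z \<le> killed h (V (h * sqrt (real j))) z"
        using mult_nonneg_nonpos[of "1 - exp (- (h\<^sup>2 / 2 * exp (2 * z)))" "V (h * sqrt (real j)) z"]
        by (simp add: killed_def left_diff_distrib)
      then show ?thesis using Suc.IH[of z] by linarith
    qed
    have e: "sqrt ((h * sqrt (real j))\<^sup>2 + h\<^sup>2) = h * sqrt (real (Suc j))"
    proof -
      have "(h * sqrt (real j))\<^sup>2 + h\<^sup>2 = h\<^sup>2 * real (Suc j)"
        by (simp add: power_mult_distrib algebra_simps)
      then show ?thesis
        using h by (simp add: real_sqrt_mult del: of_nat_Suc)
    qed
    have "- ?m \<le> euler_step h (V (h * sqrt (real j))) y"
      using k[of "y + h"] k[of "y - h"] by (simp add: euler_step_def)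
    moreover have "\<bar>V (sqrt ((h * sqrt (real j))\<^sup>2 + h\<^sup>2)) y - euler_step h (V (h * sqrt (real j))) y\<bar> \<le> C * h ^ 3"
      using gauss_avg_sum_step[where \<sigma> = "h * sqrt (real j)" and h = h and S = S and c = c and w = w and y = y] h unfolding V_def C_def by (simp add: mult.assoc)
    ultimately show ?case
      unfolding e by (simp add: algebra_simps)
  qed
  \<comment> \<open>With n steps of size \<sigma> / sqrt n the accumulated error is n C (\<sigma> /
    sqrt n)^3 = C \<sigma>^3 / sqrt n; from n > \<sigma>^2 on the step size is at most 1.\<close>
  have ev: "\<forall>\<^sub>F n in sequentially. - (C * \<sigma> ^ 3 / sqrt (real n)) \<le> V \<sigma> y"
  proof -
    obtain N :: nat where N: "\<sigma>\<^sup>2 < real N"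
      using reals_Archimedean2 by blast
    show ?thesis
      unfolding eventually_sequentially
    proof (intro exI[of _ N] allI impI)
      fix n assume n: "N \<le> n"
      then have n: "\<sigma>\<^sup>2 < real n" "0 < real n"
        using N zero_le_power2[of \<sigma>] by linarith+
      let ?s = "sqrt (real n)"
      have s: "0 < ?s" "\<sigma> \<le> ?s" "real n = ?s * ?s"
        using n \<sigma> by (auto intro: real_le_rsqrt)
      have "- (real n * (C * (\<sigma> / ?s) ^ 3)) \<le> V (\<sigma> / ?s * ?s) y"
        using s \<sigma> by (intro step) auto
      moreover have "real n * (C * (\<sigma> / ?s) ^ 3) = C * \<sigma> ^ 3 / ?s"
        using s(1) by (subst s(3)) (simp add: power_divide power3_eq_cube field_simps)
      ultimately show "- (C * \<sigma> ^ 3 / ?s) \<le> V \<sigma> y"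
        using s by simp
    qed
  qed
  have "(\<lambda>n. - (C * \<sigma> ^ 3 / sqrt (real n))) \<longlonglongrightarrow> 0"
    by real_asymp
  then have "0 \<le> V \<sigma> y"
    using ev by (intro tendsto_upperbound) auto
  then show ?thesis
    by (simp add: V_def)
qed

section \<open>Continuity of the kernel\<close>

lemma cosh_ker_antimono:
  assumes "y \<le> y'"
  shows "cosh_ker y' v \<le> cosh_ker y v"
  using assms cosh_real_nonneg[of v] by (simp add: cosh_ker_def mult_right_mono)

lemma bessel_K_0_exp_antimono:
  assumes "y \<le> y'"
  shows "bessel_K 0 (exp y') \<le> bessel_K 0 (exp y)"
  unfolding bessel_K_0_exp using cosh_ker_antimono[OF assms]
  by (intro divide_right_mono integral_mono integrable_cosh_ker) auto

text \<open>\<open>cosh_ker\<close> and K_0(e^y) decrease in y, so their values at a lower bound of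
  a convergent sequence dominate along the whole sequence.\<close>

lemma LIMSEQ_bounded_below:
  fixes X :: "nat \<Rightarrow> real"
  assumes "X \<longlonglongrightarrow> y"
  obtains B where "\<And>n. - B \<le> X n"
proof -
  have "Bseq X"
    using assms by (intro convergent_imp_Bseq) (auto simp: convergent_def)
  then obtain B where "\<And>n. \<bar>X n\<bar> \<le> B"
    by (auto simp: Bseq_def)
  then show ?thesis
    by (intro that[of B]) (simp add: abs_le_iff minus_le_iff)
qed

lemma isCont_bessel_K: "isCont (\<lambda>y. bessel_K u (exp y)) y"
  unfolding continuous_at_sequentially
proof (intro allI impI)
  fix X :: "nat \<Rightarrow> real" assume X: "X \<longlonglongrightarrow> y"
  obtain B where B: "\<And>n. - B \<le> X n"
    using LIMSEQ_bounded_below[OF X] by blast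
  have "(\<lambda>n. LINT v|lborel. cosh_ker (X n) v * cos (u * v)) \<longlonglongrightarrow> (LINT v|lborel. cosh_ker y v * cos (u * v))"
  proof (rule integral_dominated_convergence)
    show "integrable lborel (cosh_ker (- B))"
      by (rule integrable_cosh_ker)
    show "AE v in lborel. (\<lambda>n. cosh_ker (X n) v * cos (u * v)) \<longlonglongrightarrow> cosh_ker y v * cos (u * v)"
      unfolding cosh_ker_def by (intro AE_I2 tendsto_intros X)
    fix n
    show "AE v in lborel. norm (cosh_ker (X n) v * cos (u * v)) \<le> cosh_ker (- B) v"
    proof (rule AE_I2)
      fix v
      have "cosh_ker (X n) v * \<bar>cos (u * v)\<bar> \<le> cosh_ker (X n) v"
        using cosh_ker_pos[of "X n" v] by (intro mult_left_le) auto
      then show "norm (cosh_ker (X n) v * cos (u * v)) \<le> cosh_ker (- B) v"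
        using order_trans[OF _ cosh_ker_antimono[OF B, of n v]] cosh_ker_pos[of "X n" v] by (simp add: abs_mult)
    qed
  qed measurable
  then show "((\<lambda>y. bessel_K u (exp y)) \<circ> X) \<longlonglongrightarrow> bessel_K u (exp y)"
    unfolding bessel_K_exp_eq o_def by (intro tendsto_intros) auto
qed

text \<open>Continuity is what turns nonnegativity against test functions into nonnegativity at
  every point.\<close>

lemma isCont_yak_kernel:
  assumes t: "0 < t"
  shows "isCont (\<lambda>y. yakubovich_kernel t x y) y"
  unfolding continuous_at_sequentially
proof (intro allI impI)
  fix X :: "nat \<Rightarrow> real" assume X: "X \<longlonglongrightarrow> y"
  obtain B where B: "\<And>n. - B \<le> X n"
    using LIMSEQ_bounded_below[OF X] by blast
  have "(\<lambda>n. LINT u|lborel. yak_weight u * exp (- t * u\<^sup>2) * bessel_K u (exp x) * bessel_K u (exp (X n)))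
      \<longlonglongrightarrow> (LINT u|lborel. yak_weight u * exp (- t * u\<^sup>2) * bessel_K u (exp x) * bessel_K u (exp y))"
  proof (rule integral_dominated_convergence)
    show "integrable lborel (\<lambda>u. yak_weight u * exp (- t * u\<^sup>2) * (bessel_K 0 (exp x) * bessel_K 0 (exp (- B))))"
      by (intro integrable_mult_left integrable_yak_weight t)
    show "AE u in lborel. (\<lambda>n. yak_weight u * exp (- t * u\<^sup>2) * bessel_K u (exp x) * bessel_K u (exp (X n)))
        \<longlonglongrightarrow> yak_weight u * exp (- t * u\<^sup>2) * bessel_K u (exp x) * bessel_K u (exp y)"
      by (intro AE_I2 tendsto_intros isCont_tendsto_compose[OF isCont_bessel_K X])
    fix n
    show "AE u in lborel. norm (yak_weight u * exp (- t * u\<^sup>2) * bessel_K u (exp x) * bessel_K u (exp (X n)))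
        \<le> yak_weight u * exp (- t * u\<^sup>2) * (bessel_K 0 (exp x) * bessel_K 0 (exp (- B)))"
    proof (rule AE_I2)
      fix u
      have "\<bar>bessel_K u (exp x)\<bar> * \<bar>bessel_K u (exp (X n))\<bar> \<le> bessel_K 0 (exp x) * bessel_K 0 (exp (- B))"
        using bessel_K_0_exp_pos[of x]
        by (intro mult_mono abs_bessel_K_le order_trans[OF abs_bessel_K_le bessel_K_0_exp_antimono[OF B]]) auto
      from mult_left_mono[OF this, of "yak_weight u * exp (- t * u\<^sup>2)"]
      show "norm (yak_weight u * exp (- t * u\<^sup>2) * bessel_K u (exp x) * bessel_K u (exp (X n)))
        \<le> yak_weight u * exp (- t * u\<^sup>2) * (bessel_K 0 (exp x) * bessel_K 0 (exp (- B)))"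
        by (simp add: abs_mult yak_weight_nonneg mult.assoc)
    qed
  qed measurable
  then show "((\<lambda>y. yakubovich_kernel t x y) \<circ> X) \<longlonglongrightarrow> yakubovich_kernel t x y"
    unfolding yak_kernel_eq[OF t] o_def .
qed

section \<open>Positivity from test functions\<close>

lemma cosh_ker'_arcosh:
  assumes "1 < s"
  shows "cosh_ker' y (arcosh s) / sinh (arcosh s) = exp y * exp (- exp y * s)" "0 < sinh (arcosh s)" "0 \<le> arcosh s"
proof -
  show p: "0 < sinh (arcosh s)"
    using assms by (simp add: sinh_arcosh_real one_less_power)
  then show "cosh_ker' y (arcosh s) / sinh (arcosh s) = exp y * exp (- exp y * s)"
    using assms by (simp add: cosh_ker'_eq)
  show "0 \<le> arcosh s"
    using assms by (simp add: arcosh_nonneg_real)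
qed

lemma integrable_yak_kernel_exp:
  assumes t: "0 < t" and s: "1 < s"
  shows "integrable lborel (\<lambda>y. yakubovich_kernel t x y * (exp y * exp (- exp y * s)))"
  unfolding cosh_ker'_arcosh(1)[OF s, symmetric]
  using integrable_divide[OF integrable_yak_kernel_cosh_ker'[OF t, of x "arcosh s"], of "sinh (arcosh s)"] by simp

lemma integral_yak_kernel_exp:
  assumes t: "0 < t" and s: "1 < s"
  shows "(LINT y|lborel. yakubovich_kernel t x y * (exp y * exp (- exp y * s)))
     = gauss_avg (sqrt (2 * t)) (cosh_ker' x) (arcosh s) / sinh (arcosh s)"
proof -
  have [measurable]: "cosh_ker' x \<in> borel_measurable borel"
    by measurable
  show ?thesis
    unfolding cosh_ker'_arcosh(1)[OF s, symmetric]
    using yak_kernel_cosh_ker'[OF t cosh_ker'_arcosh(3)[OF s], of x] t by (simp add: gauss_avg_eq)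
qed

text \<open>With v = exp(-e^y), the weight v^2 moves the exponents 0, 1, 2, ... of a polynomial in v
  to 2, 3, 4, ... These are arguments s > 1, for which sinh(arcosh s) does not vanish and the
  intertwining relation can be divided by it.\<close>

lemma exp_power_weight:
  "(exp (- exp y))\<^sup>2 * exp (- exp y) ^ i = exp (- exp y * (real i + 2))"
  by (simp add: algebra_simps exp_add[symmetric] flip: exp_of_nat_mult power_add)

text \<open>The weighted polynomial is a finite combination of functions
  \<open>cosh_ker' y (w i)\<close>, nonnegative in y, and integration against the kernel replaces
  each of them by its Gaussian average. This is exactly the situation of
  \<open>gauss_avg_sum_nonneg\<close>.\<close>

lemma yak_kernel_polynomial_nonneg:
  fixes a :: "nat \<Rightarrow> real" and n :: nat
  defines "P \<equiv> \<lambda>v. \<Sum>i\<le>n. a i * v ^ i"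
  assumes t: "0 < t" and P: "\<And>v. 0 \<le> v \<Longrightarrow> v \<le> 1 \<Longrightarrow> 0 \<le> P v"
  shows "0 \<le> (LINT y|lborel. yakubovich_kernel t x y * (exp y * (exp (- exp y))\<^sup>2 * P (exp (- exp y))))"
proof -
  define w where "w i = arcosh (real i + 2)" for i
  define c where "c i = a i / sinh (w i)" for i
  have eq: "exp y * (exp (- exp y))\<^sup>2 * P (exp (- exp y)) = (\<Sum>i\<le>n. a i * (exp y * exp (- exp y * (real i + 2))))" for y
    by (simp add: P_def sum_distrib_left mult.left_commute mult.assoc exp_power_weight)
  have eq': "exp y * (exp (- exp y))\<^sup>2 * P (exp (- exp y)) = (\<Sum>i\<le>n. c i * cosh_ker' y (w i))" for y
    unfolding eq c_def w_def
    by (intro sum.cong refl) (subst cosh_ker'_arcosh(1)[symmetric], auto)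
  have "(LINT y|lborel. yakubovich_kernel t x y * (exp y * (exp (- exp y))\<^sup>2 * P (exp (- exp y))))
      = (LINT y|lborel. (\<Sum>i\<le>n. a i * (yakubovich_kernel t x y * (exp y * exp (- exp y * (real i + 2))))))"
    by (simp add: eq sum_distrib_left mult.left_commute)
  also have "\<dots> = (\<Sum>i\<le>n. a i * (LINT y|lborel. yakubovich_kernel t x y * (exp y * exp (- exp y * (real i + 2)))))"
    unfolding integral_mult_right_zero[symmetric]
    by (intro Bochner_Integration.integral_sum integrable_mult_right integrable_yak_kernel_exp t) simp
  also have "\<dots> = (\<Sum>i\<le>n. c i * gauss_avg (sqrt (2 * t)) (cosh_ker' x) (w i))"
    using t by (intro sum.cong refl) (subst integral_yak_kernel_exp, auto simp: c_def w_def)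
  also have "\<dots> \<ge> 0"
  proof (rule gauss_avg_sum_nonneg)
    show "0 \<le> (\<Sum>i\<le>n. c i * cosh_ker' y (w i))" for y
      unfolding eq'[symmetric] by (intro mult_nonneg_nonneg P) auto
  qed (use t in simp)
  finally show ?thesis .
qed

lemma yak_kernel_continuous_test:
  assumes t: "0 < t" and cont: "continuous_on {0..1} q" and q: "\<And>v. 0 \<le> v \<Longrightarrow> v \<le> 1 \<Longrightarrow> 0 \<le> q v"
    and [measurable]: "q \<in> borel_measurable borel" and bdd: "\<And>v. \<bar>q v\<bar> \<le> B"
  shows "0 \<le> (LINT y|lborel. yakubovich_kernel t x y * (exp y * (exp (- exp y))\<^sup>2 * q (exp (- exp y))))"
proof (rule field_le_epsilon)
  fix e :: real assume e: "0 < e"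
  let ?p = "\<lambda>y. yakubovich_kernel t x y * (exp y * (exp (- exp y))\<^sup>2)"
  have i: "integrable lborel ?p"
    using integrable_yak_kernel_exp[OF t, of 2 x] by (simp add: mult.commute flip: exp_of_nat_mult exp_of_nat2_mult)
  have [measurable]: "?p \<in> borel_measurable borel"
    using i by auto
  define A where "A = (LINT y|lborel. \<bar>?p y\<bar>)"
  \<comment> \<open>An approximation of q within d, raised by d, is nonnegative on [0, 1] and within
    2d of q. This costs at most 2dA <= e; adding 1 to A guards against A = 0.\<close>
  define d where "d = e / (2 * (A + 1))"
  have A: "0 \<le> A"
    unfolding A_def by simp
  then have d: "0 < d" "2 * d * A \<le> e"
    using e by (auto simp: d_def field_simps)
  obtain g where g: "real_polynomial_function g" "\<And>v. v \<in> {0..1} \<Longrightarrow> \<bar>q v - g v\<bar> < d"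
    using Stone_Weierstrass_real_polynomial_function[OF compact_Icc cont d(1)] by blast
  have "real_polynomial_function (\<lambda>v. g v + d)"
    by (rule real_polynomial_function.intros(3)[OF g(1) real_polynomial_function.intros(2)])
  then obtain a n where P: "(\<lambda>v. g v + d) = (\<lambda>v. \<Sum>i\<le>n. a i * v ^ i)"
    using real_polynomial_function_imp_sum by blast
  let ?P = "\<lambda>v. \<Sum>i\<le>n. a i * v ^ i"
  have near: "\<bar>?P v - q v\<bar> \<le> 2 * d" "0 \<le> ?P v" if "0 \<le> v" "v \<le> 1" for v
    using g(2)[of v] that q[of v] unfolding fun_cong[OF P, symmetric] by auto
  define V where "V y = exp (- exp y)" for y :: real
  have V: "0 \<le> V y" "V y \<le> 1" for y
    by (auto simp: V_def)
  have [measurable]: "V \<in> borel_measurable borel"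
    unfolding V_def[abs_def] by measurable
  have pos: "0 \<le> (LINT y|lborel. ?p y * ?P (V y))"
    using yak_kernel_polynomial_nonneg[OF t near(2), where x = x] by (simp add: V_def mult.assoc)
  have i2: "integrable lborel (\<lambda>y. ?p y * q (V y))"
    by (rule integrable_mult_bounded[OF i _ bdd]) measurable
  have i3: "integrable lborel (\<lambda>y. ?p y * (?P (V y) - q (V y)))"
    by (rule integrable_mult_bounded[OF i _ near(1)[OF V]]) measurable
  have "(LINT y|lborel. ?p y * ?P (V y)) = (LINT y|lborel. ?p y * q (V y)) + (LINT y|lborel. ?p y * (?P (V y) - q (V y)))"
    using i2 i3 by (subst Bochner_Integration.integral_add[symmetric]) (auto simp: right_diff_distrib)
  moreover have "(LINT y|lborel. ?p y * (?P (V y) - q (V y))) \<le> (LINT y|lborel. 2 * d * \<bar>?p y\<bar>)"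
  proof (rule integral_mono[OF i3])
    show "integrable lborel (\<lambda>y. 2 * d * \<bar>?p y\<bar>)"
      using i by auto
    fix y
    have "?p y * (?P (V y) - q (V y)) \<le> \<bar>?p y\<bar> * \<bar>?P (V y) - q (V y)\<bar>"
      unfolding abs_mult[symmetric] by (rule abs_ge_self)
    also have "\<dots> \<le> \<bar>?p y\<bar> * (2 * d)"
      by (intro mult_left_mono near V) auto
    finally show "?p y * (?P (V y) - q (V y)) \<le> 2 * d * \<bar>?p y\<bar>"
      by (simp add: mult.commute)
  qed
  moreover have "(LINT y|lborel. 2 * d * \<bar>?p y\<bar>) = 2 * d * A"
    by (simp add: A_def)
  ultimately have "0 \<le> (LINT y|lborel. ?p y * q (V y)) + e"
    using pos d by linarith
  then show "0 \<le> (LINT y|lborel. yakubovich_kernel t x y * (exp y * (exp (- exp y))\<^sup>2 * q (exp (- exp y)))) + e"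
    by (simp add: V_def mult.assoc)
qed

lemma yak_kernel_nonneg:
  assumes t: "0 < t"
  shows "0 \<le> yakubovich_kernel t x y"
proof (rule ccontr)
  assume neg: "\<not> 0 \<le> yakubovich_kernel t x y"
  let ?k = "yakubovich_kernel t x"
  have "\<forall>\<^sub>F z in at y. ?k z < 0"
    using isCont_yak_kernel[OF t, where x = x and y = y] neg by (intro order_tendstoD) (auto simp: isCont_def)
  then obtain d where d: "0 < d" "\<And>z. dist z y < d \<Longrightarrow> ?k z < 0"
    using neg by (auto simp: eventually_at) (metis not_le dist_self)
  define V where "V y = exp (- exp y)" for y :: real
  \<comment> \<open>A parabola in v = exp(-e^z), truncated at 0. As V is decreasing, it is positive
    exactly where |z - y| < d; cutting it off outside [0, 1] makes it bounded.\<close>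
  define q where "q v = (if 0 \<le> v \<and> v \<le> 1 then max 0 ((v - V (y + d)) * (V (y - d) - v)) else 0)" for v :: real
  have V: "0 \<le> V z" "V z \<le> 1" for z
    by (auto simp: V_def)
  have V_less: "V z < V z' \<longleftrightarrow> z' < z" for z z'
    by (simp add: V_def)
  have q_pos: "0 < q (V z) \<longleftrightarrow> dist z y < d" for z
    using V[of z] d(1) by (auto simp: q_def zero_less_mult_iff V_less dist_real_def less_max_iff_disj)
  have q0: "0 \<le> q v" for v
    by (simp add: q_def)
  have [measurable]: "q \<in> borel_measurable borel"
    unfolding q_def[abs_def] by measurable
  have qB: "\<bar>q v\<bar> \<le> 1" for v
  proof (cases "0 \<le> v \<and> v \<le> 1")
    case True
    then have "\<bar>v - V (y + d)\<bar> * \<bar>V (y - d) - v\<bar> \<le> 1 * 1"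
      using V[of "y + d"] V[of "y - d"] by (intro mult_mono) auto
    then show ?thesis
      using True by (simp add: q_def abs_mult[symmetric] max_def) (meson abs_ge_self order_trans)
  qed (auto simp: q_def)
  have cont: "continuous_on {0..1} q"
  proof -
    have "continuous_on {0..1} (\<lambda>v. max 0 ((v - V (y + d)) * (V (y - d) - v)))"
      by (intro continuous_intros)
    then show ?thesis
      by (rule continuous_on_eq) (simp add: q_def)
  qed
  define F where "F z = ?k z * (exp z * (exp (- exp z))\<^sup>2 * q (exp (- exp z)))" for z
  have int: "0 \<le> (LINT z|lborel. F z)"
    unfolding F_def using yak_kernel_continuous_test[OF t cont q0 _ qB] by simp
  have le: "F z \<le> 0" for z
  proof (cases "dist z y < d")
    case True
    then show ?thesis
      unfolding F_def using d(2)[OF True] q0[of "V z"] by (intro mult_nonpos_nonneg) (auto simp: V_def less_imp_le)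
  next
    case False
    then have "q (V z) = 0"
      using q_pos[of z] q0[of "V z"] by linarith
    then show ?thesis
      by (simp add: F_def V_def)
  qed
  have iF: "integrable lborel F"
  proof -
    have i: "integrable lborel (\<lambda>z. ?k z * (exp z * (exp (- exp z))\<^sup>2))"
      using integrable_yak_kernel_exp[OF t, of 2 x] by (simp add: mult.commute flip: exp_of_nat_mult exp_of_nat2_mult)
    have "integrable lborel (\<lambda>z. ?k z * (exp z * (exp (- exp z))\<^sup>2) * q (exp (- exp z)))"
      by (rule integrable_mult_bounded[OF i _ qB]) measurable
    then show ?thesis
      by (simp add: F_def[abs_def] mult.assoc)
  qed
  have "(LINT z|lborel. - F z) = 0"
    using int le by (intro antisym Bochner_Integration.integral_nonneg) auto
  then have "AE z in lborel. - F z = 0"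
    using iF le by (subst (asm) integral_nonneg_eq_0_iff_AE) auto
  then have "AE z in lborel. z \<notin> {y - d<..<y + d}"
  proof eventually_elim
    case (elim z)
    show ?case
    proof
      assume "z \<in> {y - d<..<y + d}"
      then have "dist z y < d" by (auto simp: dist_real_def)
      then have "F z < 0"
        unfolding F_def using d(2)[of z] q_pos[of z] by (intro mult_neg_pos) (auto simp: V_def)
      with elim show False by simp
    qed
  qed
  then have "emeasure lborel {y - d<..<y + d} = 0"
    by (subst (asm) AE_iff_measurable[of "{y - d<..<y + d}"]) auto
  then show False
    using d(1) by simp
qed

section \<open>The semigroup property\<close>

lemma integral_FTC_greaterThan:
  fixes f F :: "real \<Rightarrow> real"
  assumes F: "\<And>x. (F has_real_derivative f x) (at x)" and cont: "\<And>x. isCont f x"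
    and int: "integrable lborel f" and B: "(F \<longlongrightarrow> B) at_top"
  shows "(LINT x|lborel. indicator {a<..} x * f x) = B - F a"
proof -
  have int_a: "integrable lborel (\<lambda>x. indicator {a<..} x * f x)"
    using int by (rule Bochner_Integration.integrable_bound) (use int in \<open>auto simp: indicator_def\<close>)
  have "isCont F a"
    using F by (rule DERIV_isCont)
  then have "(F \<longlongrightarrow> F a) (at_right a)"
    by (auto simp: isCont_def intro: tendsto_within_subset)
  then have "(LBINT x=ereal a..\<infinity>. f x) = B - F a"
    by (intro interval_integral_FTC_integrable)
       (use assms int_a in \<open>auto simp: has_real_derivative_iff_has_vector_derivative set_integrable_def ereal_tendsto_simps\<close>)
  then show ?thesis
    by (simp add: interval_lebesgue_integral_def set_lebesgue_integral_def)
qed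

text \<open>\<open>cosh_ker'\<close> is minus the derivative of \<open>cosh_ker\<close>, which
  vanishes at infinity. The shift s leaves room for the Gaussian displacement.\<close>

lemma integral_cosh_ker'_greaterThan:
  "(LINT v|lborel. indicator {w<..} v * cosh_ker' x (v + s)) = cosh_ker x (w + s)"
proof -
  have "(LINT v|lborel. indicator {w<..} v * cosh_ker' x (v + s)) = 0 - (- cosh_ker x (w + s))"
  proof (rule integral_FTC_greaterThan[where F = "\<lambda>v. - cosh_ker x (v + s)"])
    show "((\<lambda>v. - cosh_ker x (v + s)) has_real_derivative cosh_ker' x (v + s)) (at v)" for v
      using DERIV_minus[OF cosh_ker_has_derivative[of x "v + s"]]
        DERIV_shift[of "\<lambda>v. - cosh_ker x v" "cosh_ker' x (v + s)" v s] by simp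
    show "isCont (\<lambda>v. cosh_ker' x (v + s)) v" for v
      unfolding cosh_ker'_def cosh_ker_def by (intro continuous_intros)
    show "integrable lborel (\<lambda>v. cosh_ker' x (v + s))"
      using lborel_integrable_real_affine[OF integrable_cosh_ker'[of x], of 1 s] by (simp add: add.commute)
    have "((\<lambda>v. cosh_ker x (v + s)) \<longlongrightarrow> 0) at_top"
      by (rule filterlim_compose[OF cosh_ker_tendsto_0(1)]) (rule filterlim_tendsto_add_at_top[of "\<lambda>_. s" s, OF tendsto_const filterlim_ident, unfolded add.commute[of s]])
    then show "((\<lambda>v. - cosh_ker x (v + s)) \<longlongrightarrow> 0) at_top"
      by (auto intro: tendsto_eq_intros)
  qed
  then show ?thesis by simp
qed

lemma abs_cosh_ker_le_1: "\<bar>cosh_ker x v\<bar> \<le> 1"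
  using cosh_ker_pos[of x v] cosh_ker_le_1[of x v] by simp

lemma cosh_ker'_nonneg: "0 \<le> w \<Longrightarrow> 0 \<le> cosh_ker' y w"
  using cosh_ker_pos[of y w] by (simp add: cosh_ker'_def)

lemma gauss_avg_nonneg:
  assumes "\<And>v. 0 \<le> f v"
  shows "0 \<le> gauss_avg \<sigma> f w"
  unfolding gauss_avg_def using assms by (intro Bochner_Integration.integral_nonneg) auto

lemma gauss_avg_even:
  assumes [measurable]: "f \<in> borel_measurable borel" and even: "\<And>v. f (- v) = f v"
  shows "gauss_avg \<sigma> f (- w) = gauss_avg \<sigma> f w"
proof -
  have "gauss_avg \<sigma> f (- w) = (LINT x|lborel. std_normal_density (0 + (-1) * x) * f (- w + \<sigma> * (0 + (-1) * x)))"
    unfolding gauss_avg_def by (subst lborel_integral_real_affine[where c = "-1" and t = 0]) auto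
  also have "\<dots> = (LINT x|lborel. std_normal_density x * f (- (w + \<sigma> * x)))"
    by (simp add: std_normal_density_def)
  finally show ?thesis
    by (simp only: even gauss_avg_def)
qed

text \<open>By translation invariance the inner integral of |f| does not depend on z.\<close>

lemma integrable_pair_gauss_shift:
  assumes f: "integrable lborel f"
  shows "integrable (lborel \<Otimes>\<^sub>M lborel) (\<lambda>(z, v). std_normal_density z * f (v + \<sigma> * z))"
proof (rule lborel_pair.Fubini_integrable)
  have [measurable]: "f \<in> borel_measurable borel"
    using f by auto
  show "(\<lambda>(z, v). std_normal_density z * f (v + \<sigma> * z)) \<in> borel_measurable (lborel \<Otimes>\<^sub>M lborel)"
    by measurable
  have sh: "integrable lborel (\<lambda>v. f (v + s))" for s
    using lborel_integrable_real_affine[OF f, of 1 s] by (simp add: add.commute)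
  have "(LINT v|lborel. \<bar>f (v + s)\<bar>) = (LINT v|lborel. \<bar>f v\<bar>)" for s
    using lborel_integral_real_affine[of 1 "\<lambda>v. \<bar>f v\<bar>" s] by (simp add: add.commute)
  then show "integrable lborel (\<lambda>z. LINT v|lborel. norm (case (z, v) of (z, v) \<Rightarrow> std_normal_density z * f (v + \<sigma> * z)))"
    by (simp add: abs_mult)
  show "AE z in lborel. integrable lborel (\<lambda>v. case (z, v) of (z, v) \<Rightarrow> std_normal_density z * f (v + \<sigma> * z))"
    using sh by simp
qed

lemma integral_gauss_avg_cosh_ker'_greaterThan:
  "integrable lborel (\<lambda>v. indicator {w<..} v * gauss_avg \<sigma> (cosh_ker' x) v)"
  "(LINT v|lborel. indicator {w<..} v * gauss_avg \<sigma> (cosh_ker' x) v) = gauss_avg \<sigma> (cosh_ker x) w"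
proof -
  let ?I = "indicator {w<..} :: real \<Rightarrow> real"
  have p: "integrable (lborel \<Otimes>\<^sub>M lborel) (\<lambda>(z, v). ?I v * (std_normal_density z * cosh_ker' x (v + \<sigma> * z)))"
    by (rule Bochner_Integration.integrable_bound[OF integrable_pair_gauss_shift[OF integrable_cosh_ker'[of x], of \<sigma>]])
       (auto simp: abs_mult indicator_def intro!: AE_I2)
  have eq: "?I v * gauss_avg \<sigma> (cosh_ker' x) v = (LINT z|lborel. ?I v * (std_normal_density z * cosh_ker' x (v + \<sigma> * z)))" for v
    by (simp add: gauss_avg_def)
  show "integrable lborel (\<lambda>v. ?I v * gauss_avg \<sigma> (cosh_ker' x) v)"
    unfolding eq using lborel_pair.integrable_snd[OF p] by simp
  have "(LINT v|lborel. ?I v * gauss_avg \<sigma> (cosh_ker' x) v)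
      = (LINT z|lborel. LINT v|lborel. ?I v * (std_normal_density z * cosh_ker' x (v + \<sigma> * z)))"
    unfolding eq by (rule lborel_pair.Fubini_integral[OF p])
  also have "\<dots> = (LINT z|lborel. std_normal_density z * (LINT v|lborel. ?I v * cosh_ker' x (v + \<sigma> * z)))"
    by (simp add: mult.left_commute flip: integral_mult_right_zero)
  also have "\<dots> = gauss_avg \<sigma> (cosh_ker x) w"
    by (simp add: integral_cosh_ker'_greaterThan gauss_avg_def)
  finally show "(LINT v|lborel. ?I v * gauss_avg \<sigma> (cosh_ker' x) v) = gauss_avg \<sigma> (cosh_ker x) w" .
qed

lemma measurable_yak_kernel_right:
  assumes t: "0 < t"
  shows "yakubovich_kernel t x \<in> borel_measurable borel"
proof -
  have "(\<lambda>y. yakubovich_kernel t x y) \<in> borel_measurable borel"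
    by (rule measurable_yak_kernel[OF t]) measurable
  then show ?thesis .
qed

text \<open>Now that the kernel is known to be nonnegative, Tonelli integrates the relation for
  \<open>cosh_ker'\<close> over (w, \<infinity>) and yields the one for \<open>cosh_ker\<close>. For
  w >= 0 the derivative has constant sign on this half line.\<close>

lemma nn_integral_yak_kernel_cosh_ker_nonneg:
  assumes t: "0 < t" and w: "0 \<le> w"
  shows "(\<integral>\<^sup>+y. yakubovich_kernel t x y * cosh_ker y w \<partial>lborel) = gauss_avg (sqrt (2 * t)) (cosh_ker x) w"
proof -
  let ?k = "yakubovich_kernel t x" and ?I = "indicator {w<..} :: real \<Rightarrow> real" and ?s = "sqrt (2 * t)"
  note [measurable] = measurable_yak_kernel_right[OF t]
  have [measurable]: "cosh_ker' x \<in> borel_measurable borel"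
    by measurable
  have inner: "(\<integral>\<^sup>+v. ?I v * cosh_ker' y v \<partial>lborel) = cosh_ker y w" for y
  proof (subst nn_integral_eq_integral)
    show "integrable lborel (\<lambda>v. ?I v * cosh_ker' y v)"
      by (rule Bochner_Integration.integrable_bound[OF integrable_cosh_ker'[of y]]) (auto simp: indicator_def)
    show "AE v in lborel. 0 \<le> ?I v * cosh_ker' y v"
      using w by (auto simp: indicator_def cosh_ker'_nonneg)
  qed (use integral_cosh_ker'_greaterThan[of w y 0] in simp)
  have inner2: "(\<integral>\<^sup>+y. ?k y * (?I v * cosh_ker' y v) \<partial>lborel) = ?I v * gauss_avg ?s (cosh_ker' x) v" for v
  proof (cases "w < v")
    case True
    have "(\<integral>\<^sup>+y. ?k y * cosh_ker' y v \<partial>lborel) = (LINT y|lborel. ?k y * cosh_ker' y v)"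
      using True w by (intro nn_integral_eq_integral integrable_yak_kernel_cosh_ker' t)
        (auto intro!: mult_nonneg_nonneg yak_kernel_nonneg cosh_ker'_nonneg t)
    also have "\<dots> = gauss_avg ?s (cosh_ker' x) v"
      using yak_kernel_cosh_ker'[OF t, of v x] True w t by (simp add: gauss_avg_eq)
    finally show ?thesis
      using True by simp
  qed simp
  have "(\<integral>\<^sup>+y. ?k y * cosh_ker y w \<partial>lborel) = (\<integral>\<^sup>+y. (\<integral>\<^sup>+v. ?k y * (?I v * cosh_ker' y v) \<partial>lborel) \<partial>lborel)"
  proof (intro nn_integral_cong)
    fix y
    have "ennreal (?k y * cosh_ker y w) = ennreal (?k y) * (\<integral>\<^sup>+v. ?I v * cosh_ker' y v \<partial>lborel)"
      unfolding inner using yak_kernel_nonneg[OF t] cosh_ker_pos by (simp add: ennreal_mult less_imp_le)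
    also have "\<dots> = (\<integral>\<^sup>+v. ennreal (?k y) * ennreal (?I v * cosh_ker' y v) \<partial>lborel)"
      by (rule nn_integral_cmult[symmetric]) measurable
    also have "\<dots> = (\<integral>\<^sup>+v. ?k y * (?I v * cosh_ker' y v) \<partial>lborel)"
      by (simp add: ennreal_mult' yak_kernel_nonneg[OF t])
    finally show "ennreal (?k y * cosh_ker y w) = (\<integral>\<^sup>+v. ?k y * (?I v * cosh_ker' y v) \<partial>lborel)" .
  qed
  also have "\<dots> = (\<integral>\<^sup>+v. (\<integral>\<^sup>+y. ?k y * (?I v * cosh_ker' y v) \<partial>lborel) \<partial>lborel)"
    by (rule lborel_pair.Fubini') measurable
  also have "\<dots> = (\<integral>\<^sup>+v. ?I v * gauss_avg ?s (cosh_ker' x) v \<partial>lborel)"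
    unfolding inner2 ..
  also have "\<dots> = (LINT v|lborel. ?I v * gauss_avg ?s (cosh_ker' x) v)"
  proof (rule nn_integral_eq_integral[OF integral_gauss_avg_cosh_ker'_greaterThan(1)])
    show "AE v in lborel. 0 \<le> ?I v * gauss_avg ?s (cosh_ker' x) v"
    proof (rule AE_I2)
      fix v
      \<comment> \<open>\<open>cosh_ker' x\<close> is odd, so the sign of its average is not
        immediate; the intertwining relation exhibits the average as an integral of nonnegative
        functions.\<close>
      have "0 \<le> gauss_avg ?s (cosh_ker' x) v" if "w < v"
      proof -
        have "gauss_avg ?s (cosh_ker' x) v = (LINT y|lborel. ?k y * cosh_ker' y v)"
          using yak_kernel_cosh_ker'[OF t, of v x] that w t by (simp add: gauss_avg_eq)
        also have "0 \<le> \<dots>"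
          using that w by (intro Bochner_Integration.integral_nonneg mult_nonneg_nonneg yak_kernel_nonneg cosh_ker'_nonneg t) auto
        finally show ?thesis .
      qed
      then show "0 \<le> ?I v * gauss_avg ?s (cosh_ker' x) v"
        by (simp add: indicator_def)
    qed
  qed
  finally show ?thesis
    by (simp add: integral_gauss_avg_cosh_ker'_greaterThan(2))
qed

lemma nn_integral_yak_kernel_cosh_ker:
  assumes t: "0 < t"
  shows "(\<integral>\<^sup>+y. yakubovich_kernel t x y * cosh_ker y w \<partial>lborel) = gauss_avg (sqrt (2 * t)) (cosh_ker x) w"
proof (cases "0 \<le> w")
  case True
  then show ?thesis by (rule nn_integral_yak_kernel_cosh_ker_nonneg[OF t])
next
  case False
  have "cosh_ker x \<in> borel_measurable borel"
    by measurable
  then have "gauss_avg (sqrt (2 * t)) (cosh_ker x) (- w) = gauss_avg (sqrt (2 * t)) (cosh_ker x) w"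
    by (rule gauss_avg_even) simp
  then show ?thesis
    using nn_integral_yak_kernel_cosh_ker_nonneg[OF t, of "- w" x] False by simp
qed

lemma integrable_yak_kernel_cosh_ker:
  assumes t: "0 < t"
  shows "integrable lborel (\<lambda>y. yakubovich_kernel t x y * cosh_ker y w)"
    "(LINT y|lborel. yakubovich_kernel t x y * cosh_ker y w) = gauss_avg (sqrt (2 * t)) (cosh_ker x) w"
proof -
  note [measurable] = measurable_yak_kernel_right[OF t]
  have nonneg: "0 \<le> yakubovich_kernel t x y * cosh_ker y w" for y
    using yak_kernel_nonneg[OF t] cosh_ker_pos by (simp add: less_imp_le)
  show "integrable lborel (\<lambda>y. yakubovich_kernel t x y * cosh_ker y w)"
    using nonneg by (intro integrableI_nonneg) (simp_all add: nn_integral_yak_kernel_cosh_ker[OF t])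
  show "(LINT y|lborel. yakubovich_kernel t x y * cosh_ker y w) = gauss_avg (sqrt (2 * t)) (cosh_ker x) w"
    using nonneg by (subst integral_eq_nn_integral)
      (auto simp: nn_integral_yak_kernel_cosh_ker[OF t] gauss_avg_nonneg cosh_ker_pos less_imp_le)
qed

text \<open>Averaging is convolution with a normal law, hence multiplication by its characteristic
  function on the Fourier side; evenness of f removes the sine part.\<close>

lemma integral_gauss_avg_cos:
  assumes f: "integrable lborel f" and even: "\<And>v. f (- v) = f v"
  shows "integrable lborel (gauss_avg \<sigma> f)"
    "(LINT v|lborel. gauss_avg \<sigma> f v * cos (u * v)) = exp (- (\<sigma> * u)\<^sup>2 / 2) * (LINT v|lborel. f v * cos (u * v))"
proof -
  have [measurable]: "f \<in> borel_measurable borel"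
    using f by auto
  note p0 = integrable_pair_gauss_shift[OF f, of \<sigma>]
  show "integrable lborel (gauss_avg \<sigma> f)"
    unfolding gauss_avg_def[abs_def] using lborel_pair.integrable_snd[OF p0] by simp
  have p: "integrable (lborel \<Otimes>\<^sub>M lborel) (\<lambda>(z, v). std_normal_density z * f (v + \<sigma> * z) * cos (u * v))"
    by (rule Bochner_Integration.integrable_bound[OF p0])
       (auto simp: abs_mult mult_left_le intro!: AE_I2)
  have i: "integrable lborel (\<lambda>v. f v * cos (u * v))" "integrable lborel (\<lambda>v. f v * sin (u * v))"
    by (rule integrable_mult_bounded[OF f, where B = 1]; simp)+
  have odd: "(LINT v|lborel. f v * sin (u * v)) = 0"
  proof -
    have "(LINT v|lborel. f v * sin (u * v)) = (LINT v|lborel. f (0 + (-1) * v) * sin (u * (0 + (-1) * v)))"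
      by (subst lborel_integral_real_affine[where c = "-1" and t = 0]) auto
    then show ?thesis by (simp add: even)
  qed
  have inner: "(LINT v|lborel. f (v + s) * cos (u * v)) = cos (u * s) * (LINT v|lborel. f v * cos (u * v))" for s
  proof -
    have "(LINT v|lborel. f (v + s) * cos (u * v)) = (LINT v|lborel. f (- s + 1 * v + s) * cos (u * (- s + 1 * v)))"
      by (subst lborel_integral_real_affine[where c = 1 and t = "- s"]) auto
    also have "\<dots> = (LINT v|lborel. cos (u * s) * (f v * cos (u * v)) + sin (u * s) * (f v * sin (u * v)))"
      by (intro Bochner_Integration.integral_cong refl) (simp add: algebra_simps cos_diff)
    finally show ?thesis
      unfolding integral_lincomb[OF i] odd by simp
  qed
  have "(LINT v|lborel. gauss_avg \<sigma> f v * cos (u * v)) = (LINT v|lborel. LINT z|lborel. std_normal_density z * f (v + \<sigma> * z) * cos (u * v))"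
    by (simp add: gauss_avg_def)
  also have "\<dots> = (LINT z|lborel. LINT v|lborel. std_normal_density z * f (v + \<sigma> * z) * cos (u * v))"
    by (rule lborel_pair.Fubini_integral[OF p])
  also have "\<dots> = (LINT z|lborel. std_normal_density z * cos ((\<sigma> * u) * z)) * (LINT v|lborel. f v * cos (u * v))"
    by (simp add: mult.assoc inner) (simp add: mult.commute[of \<sigma>] mult.left_commute[of \<sigma>] mult.assoc flip: integral_mult_left_zero)
  finally show "(LINT v|lborel. gauss_avg \<sigma> f v * cos (u * v)) = exp (- (\<sigma> * u)\<^sup>2 / 2) * (LINT v|lborel. f v * cos (u * v))"
    by (simp only: integral_std_normal_cos)
qed

text \<open>Kernel and \<open>cosh_ker\<close> are nonnegative, so the intertwining relation itself
  verifies absolute integrability in both variables. The deviation \<open>sqrt (2 * t)\<close> gives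
  the eigenvalue e^{-tu^2}.\<close>

lemma yak_kernel_bessel_K:
  assumes t: "0 < t"
  shows "integrable lborel (\<lambda>y. yakubovich_kernel t x y * bessel_K u (exp y))"
    "(LINT y|lborel. yakubovich_kernel t x y * bessel_K u (exp y)) = exp (- t * u\<^sup>2) * bessel_K u (exp x)"
proof -
  note [measurable] = measurable_yak_kernel_right[OF t]
  let ?k = "yakubovich_kernel t x" and ?s = "sqrt (2 * t)"
  note ga = integral_gauss_avg_cos[OF integrable_cosh_ker cosh_ker_minus]
  have p0: "integrable (lborel \<Otimes>\<^sub>M lborel) (\<lambda>(v, y). ?k y * cosh_ker y v)"
  proof (rule lborel_pair.Fubini_integrable)
    show "integrable lborel (\<lambda>v. LINT y|lborel. norm (case (v, y) of (v, y) \<Rightarrow> ?k y * cosh_ker y v))"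
      using ga(1)[of ?s x] by (simp add: abs_mult yak_kernel_nonneg[OF t] less_imp_le[OF cosh_ker_pos] integrable_yak_kernel_cosh_ker[OF t])
    show "AE v in lborel. integrable lborel (\<lambda>y. case (v, y) of (v, y) \<Rightarrow> ?k y * cosh_ker y v)"
      using integrable_yak_kernel_cosh_ker[OF t] by simp
  qed measurable
  have p: "integrable (lborel \<Otimes>\<^sub>M lborel) (\<lambda>(v, y). ?k y * cosh_ker y v * cos (u * v))"
    by (rule Bochner_Integration.integrable_bound[OF p0])
       (auto simp: abs_mult mult_left_le intro!: AE_I2)
  have eq: "?k y * bessel_K u (exp y) = (LINT v|lborel. ?k y * cosh_ker y v * cos (u * v)) / 2" for y
    by (simp add: bessel_K_exp_eq mult.assoc)
  show "integrable lborel (\<lambda>y. ?k y * bessel_K u (exp y))"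
    unfolding eq using lborel_pair.integrable_snd[OF p] by simp
  have "(LINT y|lborel. ?k y * bessel_K u (exp y)) = (LINT v|lborel. LINT y|lborel. ?k y * cosh_ker y v * cos (u * v)) / 2"
    unfolding eq using lborel_pair.Fubini_integral[OF p] by simp
  also have "\<dots> = (LINT v|lborel. gauss_avg ?s (cosh_ker x) v * cos (u * v)) / 2"
    by (simp add: integrable_yak_kernel_cosh_ker(2)[OF t])
  also have "\<dots> = exp (- t * u\<^sup>2) * bessel_K u (exp x)"
    using t by (simp add: ga(2) bessel_K_exp_eq power_mult_distrib)
  finally show "(LINT y|lborel. ?k y * bessel_K u (exp y)) = exp (- t * u\<^sup>2) * bessel_K u (exp x)" .
qed

text \<open>The second kernel is expanded over u, and the first acts on each K_iu by its eigenvalue.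
  The case u = 0 of the eigenfunction property makes K_0 integrable against the first kernel and
  thereby supplies the majorant for Fubini.\<close>

theorem yak_kernel_chapman_kolmogorov:
  assumes s: "0 < s" and t: "0 < t"
  shows "(\<integral>\<^sup>+y. ennreal (yakubovich_kernel s x y) * ennreal (yakubovich_kernel t y z) \<partial>lborel) = yakubovich_kernel (s + t) x z"
proof -
  note [measurable] = measurable_yak_kernel_right[OF s] measurable_yak_kernel_right[OF t]
  let ?k = "yakubovich_kernel s x"
  let ?f = "\<lambda>u y. ?k y * (yak_weight u * exp (- t * u\<^sup>2) * bessel_K u (exp y) * bessel_K u (exp z))"
  have dom: "\<bar>?f u y\<bar> \<le> (yak_weight u * exp (- t * u\<^sup>2) * bessel_K 0 (exp z)) * (?k y * bessel_K 0 (exp y))" for u y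
  proof -
    have "\<bar>bessel_K u (exp y)\<bar> * \<bar>bessel_K u (exp z)\<bar> \<le> bessel_K 0 (exp y) * bessel_K 0 (exp z)"
      by (intro mult_mono abs_bessel_K_le) (auto simp: bessel_K_0_exp_pos less_imp_le)
    from mult_left_mono[OF this, of "?k y * (yak_weight u * exp (- t * u\<^sup>2))"]
    show ?thesis
      by (simp add: abs_mult yak_weight_nonneg yak_kernel_nonneg[OF s] mult_ac)
  qed
  note dom_int = integrable_mult_left[OF integrable_yak_weight[OF t], of "bessel_K 0 (exp z)"] yak_kernel_bessel_K(1)[OF s, of x 0]
  have m: "(\<lambda>(u, y). ?f u y) \<in> borel_measurable (borel \<Otimes>\<^sub>M borel)"
    by measurable
  have eq: "?k y * yakubovich_kernel t y z = (LINT u|lborel. ?f u y)" for y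
    by (simp add: yak_kernel_eq[OF t])
  have int: "integrable lborel (\<lambda>y. ?k y * yakubovich_kernel t y z)"
    unfolding eq using lborel_pair.integrable_snd[OF integrable_lborel_prod_bound[OF m dom_int dom]] by simp
  have "(\<integral>\<^sup>+y. ennreal (?k y) * ennreal (yakubovich_kernel t y z) \<partial>lborel) = (\<integral>\<^sup>+y. ?k y * yakubovich_kernel t y z \<partial>lborel)"
    by (simp add: ennreal_mult yak_kernel_nonneg s t)
  also have "\<dots> = (LINT y|lborel. ?k y * yakubovich_kernel t y z)"
    by (intro nn_integral_eq_integral int AE_I2 mult_nonneg_nonneg yak_kernel_nonneg s t)
  also have "(LINT y|lborel. ?k y * yakubovich_kernel t y z) = (LINT u|lborel. LINT y|lborel. ?f u y)"
    unfolding eq by (rule lborel_integral_swap[OF m dom_int dom])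
  also have "\<dots> = (LINT u|lborel. yak_weight u * exp (- (s + t) * u\<^sup>2) * bessel_K u (exp x) * bessel_K u (exp z))"
  proof (intro Bochner_Integration.integral_cong refl)
    fix u
    have "(LINT y|lborel. ?f u y) = yak_weight u * exp (- t * u\<^sup>2) * bessel_K u (exp z) * (LINT y|lborel. ?k y * bessel_K u (exp y))"
      by (simp only: integral_mult_right_zero[symmetric] mult_ac)
    then show "(LINT y|lborel. ?f u y) = yak_weight u * exp (- (s + t) * u\<^sup>2) * bessel_K u (exp x) * bessel_K u (exp z)"
      unfolding yak_kernel_bessel_K(2)[OF s] by (simp add: distrib_right exp_add exp_diff exp_minus field_simps)
  qed
  also have "\<dots> = yakubovich_kernel (s + t) x z"
    using s t by (simp only: yak_kernel_eq[of "s + t"] add_pos_pos)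
  finally show ?thesis .
qed

section \<open>Exponential moments\<close>

lemma cosh_powr_le:
  fixes \<alpha> v :: real
  assumes "0 \<le> \<alpha>"
  shows "cosh v powr (- \<alpha>) \<le> 2 powr \<alpha> * exp (- \<alpha> * \<bar>v\<bar>)"
proof -
  have "cosh v powr (- \<alpha>) \<le> (exp \<bar>v\<bar> / 2) powr (- \<alpha>)"
    using exp_abs_le_cosh[of v] assms by (intro powr_mono2') auto
  also have "\<dots> = 2 powr \<alpha> * exp (- \<alpha> * \<bar>v\<bar>)"
    by (simp add: powr_def ln_div right_diff_distrib flip: exp_add)
  finally show ?thesis .
qed

text \<open>Integrating in y first gives Gamma(\<alpha>) (cosh v)^(-\<alpha>), which decays
  exponentially in |v|.\<close>

lemma integrable_exp_bessel_K_0: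
  assumes "0 < \<alpha>"
  shows "integrable lborel (\<lambda>y. exp (\<alpha> * y) * bessel_K 0 (exp y))"
proof -
  have p: "integrable (lborel \<Otimes>\<^sub>M lborel) (\<lambda>(v, y). exp (\<alpha> * y) * cosh_ker y v)"
  proof (rule lborel_pair.Fubini_integrable)
    have int: "integrable lborel (\<lambda>y. exp (\<alpha> * y) * cosh_ker y v)" for v
      unfolding cosh_ker_def by (rule integrable_exp_minus_exp[OF assms]) simp
    have val: "(LINT y|lborel. exp (\<alpha> * y) * cosh_ker y v) = gumbel_moment \<alpha> * cosh v powr (- \<alpha>)" for v
      unfolding cosh_ker_def by (rule integral_exp_minus_exp) simp
    show "integrable lborel (\<lambda>v. LINT y|lborel. norm (case (v, y) of (v, y) \<Rightarrow> exp (\<alpha> * y) * cosh_ker y v))"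
    proof (rule Bochner_Integration.integrable_bound)
      show "integrable lborel (\<lambda>v::real. gumbel_moment \<alpha> * 2 powr \<alpha> * exp (- \<alpha> * \<bar>v\<bar>))"
        by (intro integrable_mult_right integrable_exp_minus_abs assms)
      show "AE v in lborel. norm (LINT y|lborel. norm (case (v, y) of (v, y) \<Rightarrow> exp (\<alpha> * y) * cosh_ker y v))
          \<le> norm (gumbel_moment \<alpha> * 2 powr \<alpha> * exp (- \<alpha> * \<bar>v\<bar>))"
      proof (rule AE_I2)
        fix v :: real
        have "gumbel_moment \<alpha> * cosh v powr (- \<alpha>) \<le> gumbel_moment \<alpha> * (2 powr \<alpha> * exp (- \<alpha> * \<bar>v\<bar>))"
          by (intro mult_left_mono cosh_powr_le gumbel_moment_nonneg less_imp_le[OF assms])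
        then show "norm (LINT y|lborel. norm (case (v, y) of (v, y) \<Rightarrow> exp (\<alpha> * y) * cosh_ker y v))
          \<le> norm (gumbel_moment \<alpha> * 2 powr \<alpha> * exp (- \<alpha> * \<bar>v\<bar>))"
          by (simp add: abs_mult less_imp_le[OF cosh_ker_pos] val gumbel_moment_nonneg mult.assoc)
      qed
    qed measurable
    show "AE v in lborel. integrable lborel (\<lambda>y. case (v, y) of (v, y) \<Rightarrow> exp (\<alpha> * y) * cosh_ker y v)"
      using int by simp
  qed measurable
  show ?thesis
    unfolding bessel_K_0_exp using integrable_divide[OF lborel_pair.integrable_snd[OF p], of 2] by simp
qed

text \<open>For b > 0 this is comparable to the Bessel function K_b(e^x) of real order, hence to
  e^{-bx} as x -> -\<infinity>. As a mixture of functions \<open>cosh_ker x v\<close> over v it is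
  controlled by the intertwining relation, which e^{-bx} itself is not directly.\<close>

definition exp_cosh_ker_mass :: "real \<Rightarrow> real \<Rightarrow> ennreal" where
  "exp_cosh_ker_mass b x = (\<integral>\<^sup>+v. exp (b * \<bar>v\<bar>) * cosh_ker x v \<partial>lborel)"

lemma exp_cosh_ker_mass_finite: "exp_cosh_ker_mass b x < \<infinity>"
  using integrable_exp_cosh_ker[of b x] cosh_ker_pos[of x]
  unfolding exp_cosh_ker_mass_def by (simp add: integrable_iff_bounded less_imp_le)

lemma measurable_exp_cosh_ker_mass [measurable]: "exp_cosh_ker_mass b \<in> borel_measurable borel"
  unfolding exp_cosh_ker_mass_def[abs_def] by measurable

text \<open>On the window [-y, 1 - y] of length 1 one has e^{b|v|} >= e^{-by}, while e^y cosh v <=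
  e^{y+v} <= e keeps \<open>cosh_ker\<close> above exp(-e).\<close>

lemma exp_le_exp_cosh_ker_mass:
  assumes b: "0 < b" and y: "y < 0"
  shows "ennreal (exp (- b * y)) \<le> ennreal (exp (exp 1)) * exp_cosh_ker_mass b y"
proof -
  have *: "exp (- b * y) \<le> exp (exp 1) * (exp (b * \<bar>v\<bar>) * cosh_ker y v)" if v: "- y \<le> v" "v \<le> 1 - y" for v
  proof -
    have "cosh v \<le> exp v"
      using v y by (simp add: cosh_field_def)
    then have "exp y * cosh v \<le> exp (y + v)"
      by (simp add: exp_add)
    also have "\<dots> \<le> exp 1"
      using v by simp
    finally have "exp (- exp 1) \<le> cosh_ker y v"
      by (simp add: cosh_ker_def)
    then have "1 \<le> exp (exp 1) * cosh_ker y v"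
      by (simp add: exp_minus field_simps)
    moreover have "exp (- b * y) \<le> exp (b * \<bar>v\<bar>)"
      using v y mult_left_mono[of "- y" v b] b by simp
    ultimately have "exp (- b * y) * 1 \<le> exp (b * \<bar>v\<bar>) * (exp (exp 1) * cosh_ker y v)"
      by (intro mult_mono) auto
    then show ?thesis
      by (simp add: mult_ac)
  qed
  have "ennreal (exp (- b * y)) = (\<integral>\<^sup>+v. ennreal (exp (- b * y)) * indicator {- y..1 - y} v \<partial>lborel)"
    by (subst nn_integral_cmult_indicator) auto
  also have "\<dots> \<le> (\<integral>\<^sup>+v. ennreal (exp (exp 1)) * ennreal (exp (b * \<bar>v\<bar>) * cosh_ker y v) \<partial>lborel)"
    using * by (intro nn_integral_mono) (auto simp: indicator_def ennreal_leI less_imp_le[OF cosh_ker_pos] simp flip: ennreal_mult)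
  also have "\<dots> = ennreal (exp (exp 1)) * exp_cosh_ker_mass b y"
    unfolding exp_cosh_ker_mass_def by (rule nn_integral_cmult) measurable
  finally show ?thesis .
qed

lemma nn_integral_std_normal_exp_abs_finite: "(\<integral>\<^sup>+z. std_normal_density z * exp (k * \<bar>z\<bar>) \<partial>lborel) < \<infinity>"
proof -
  have "integrable lborel (\<lambda>z. 1 / sqrt (2 * pi) * (exp (- (1 / 2) * z\<^sup>2) * exp (k * \<bar>z\<bar>)))"
    by (intro integrable_mult_right integrable_gauss_exp_abs) simp
  then have "integrable lborel (\<lambda>z. std_normal_density z * exp (k * \<bar>z\<bar>))"
    by (simp add: std_normal_density_def)
  then show ?thesis
    by (simp add: integrable_iff_bounded abs_mult)
qed

text \<open>The kernel acts by a Gaussian displacement of v. Undoing it costs the factor exp(b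
  sqrt(2t) |z|), whose normal expectation is the constant D, independent of x.\<close>

lemma nn_integral_yak_kernel_exp_cosh_ker_mass:
  assumes t: "0 < t" and b: "0 < b"
  obtains D :: ennreal where "D < \<infinity>"
    "\<And>x. (\<integral>\<^sup>+y. yakubovich_kernel t x y * exp_cosh_ker_mass b y \<partial>lborel) \<le> D * exp_cosh_ker_mass b x"
proof
  let ?s = "sqrt (2 * t)"
  let ?D = "\<integral>\<^sup>+z. std_normal_density z * exp ((b * ?s) * \<bar>z\<bar>) \<partial>lborel"
  show "?D < \<infinity>"
    by (rule nn_integral_std_normal_exp_abs_finite)
  fix x
  note [measurable] = measurable_yak_kernel_right[OF t]
  have "(\<integral>\<^sup>+y. yakubovich_kernel t x y * exp_cosh_ker_mass b y \<partial>lborel)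
      = (\<integral>\<^sup>+y. (\<integral>\<^sup>+v. ennreal (exp (b * \<bar>v\<bar>)) * ennreal (yakubovich_kernel t x y * cosh_ker y v) \<partial>lborel) \<partial>lborel)"
    unfolding exp_cosh_ker_mass_def
    by (subst nn_integral_cmult[symmetric])
       (auto intro!: nn_integral_cong simp: yak_kernel_nonneg[OF t] less_imp_le[OF cosh_ker_pos] mult_ac simp flip: ennreal_mult)
  also have "\<dots> = (\<integral>\<^sup>+v. (\<integral>\<^sup>+y. ennreal (exp (b * \<bar>v\<bar>)) * ennreal (yakubovich_kernel t x y * cosh_ker y v) \<partial>lborel) \<partial>lborel)"
    by (rule lborel_pair.Fubini') measurable
  also have "\<dots> = (\<integral>\<^sup>+v. ennreal (exp (b * \<bar>v\<bar>)) * ennreal (gauss_avg ?s (cosh_ker x) v) \<partial>lborel)"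
    by (subst nn_integral_cmult) (auto simp: nn_integral_yak_kernel_cosh_ker[OF t])
  also have "\<dots> = (\<integral>\<^sup>+v. (\<integral>\<^sup>+z. ennreal (exp (b * \<bar>v\<bar>)) * ennreal (std_normal_density z * cosh_ker x (v + ?s * z)) \<partial>lborel) \<partial>lborel)"
  proof (intro nn_integral_cong)
    fix v
    have "ennreal (gauss_avg ?s (cosh_ker x) v) = (\<integral>\<^sup>+z. std_normal_density z * cosh_ker x (v + ?s * z) \<partial>lborel)"
      unfolding gauss_avg_def
      by (intro nn_integral_eq_integral[symmetric] integrable_gauss_avg[where B = 1] abs_cosh_ker_le_1)
         (auto intro!: mult_nonneg_nonneg less_imp_le[OF cosh_ker_pos])
    then show "ennreal (exp (b * \<bar>v\<bar>)) * ennreal (gauss_avg ?s (cosh_ker x) v)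
        = (\<integral>\<^sup>+z. ennreal (exp (b * \<bar>v\<bar>)) * ennreal (std_normal_density z * cosh_ker x (v + ?s * z)) \<partial>lborel)"
      by (subst nn_integral_cmult) auto
  qed
  also have "\<dots> = (\<integral>\<^sup>+z. (\<integral>\<^sup>+v. ennreal (exp (b * \<bar>v\<bar>)) * ennreal (std_normal_density z * cosh_ker x (v + ?s * z)) \<partial>lborel) \<partial>lborel)"
    by (rule lborel_pair.Fubini') measurable
  also have "\<dots> \<le> (\<integral>\<^sup>+z. ennreal (std_normal_density z * exp ((b * ?s) * \<bar>z\<bar>)) * exp_cosh_ker_mass b x \<partial>lborel)"
  proof (intro nn_integral_mono)
    fix z :: real
    have "(\<integral>\<^sup>+v. ennreal (exp (b * \<bar>v\<bar>)) * ennreal (std_normal_density z * cosh_ker x (v + ?s * z)) \<partial>lborel)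
        = (\<integral>\<^sup>+v. ennreal (exp (b * \<bar>- (?s * z) + 1 * v\<bar>)) * ennreal (std_normal_density z * cosh_ker x (- (?s * z) + 1 * v + ?s * z)) \<partial>lborel)"
      by (subst nn_integral_real_affine[where c = 1 and t = "- (?s * z)"]) auto
    also have "\<dots> \<le> (\<integral>\<^sup>+v. ennreal (std_normal_density z * exp ((b * ?s) * \<bar>z\<bar>)) * ennreal (exp (b * \<bar>v\<bar>) * cosh_ker x v) \<partial>lborel)"
    proof (intro nn_integral_mono)
      fix v
      have "\<bar>- (?s * z) + v\<bar> \<le> ?s * \<bar>z\<bar> + \<bar>v\<bar>"
        using abs_triangle_ineq[of "- (?s * z)" v] t by (simp add: abs_mult)
      from mult_left_mono[OF this, of b] have "b * \<bar>- (?s * z) + v\<bar> \<le> (b * ?s) * \<bar>z\<bar> + b * \<bar>v\<bar>"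
        using b by (simp add: distrib_left mult.assoc)
      then have "exp (b * \<bar>- (?s * z) + v\<bar>) \<le> exp ((b * ?s) * \<bar>z\<bar>) * exp (b * \<bar>v\<bar>)"
        by (simp flip: exp_add)
      from mult_right_mono[OF this, of "std_normal_density z * cosh_ker x v"]
      show "ennreal (exp (b * \<bar>- (?s * z) + 1 * v\<bar>)) * ennreal (std_normal_density z * cosh_ker x (- (?s * z) + 1 * v + ?s * z))
          \<le> ennreal (std_normal_density z * exp ((b * ?s) * \<bar>z\<bar>)) * ennreal (exp (b * \<bar>v\<bar>) * cosh_ker x v)"
        using cosh_ker_pos[of x v] by (simp add: mult_ac less_imp_le ennreal_leI flip: ennreal_mult)
    qed
    also have "\<dots> = ennreal (std_normal_density z * exp ((b * ?s) * \<bar>z\<bar>)) * exp_cosh_ker_mass b x"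
      unfolding exp_cosh_ker_mass_def by (rule nn_integral_cmult) measurable
    finally show "(\<integral>\<^sup>+v. ennreal (exp (b * \<bar>v\<bar>)) * ennreal (std_normal_density z * cosh_ker x (v + ?s * z)) \<partial>lborel)
        \<le> ennreal (std_normal_density z * exp ((b * ?s) * \<bar>z\<bar>)) * exp_cosh_ker_mass b x" .
  qed
  also have "\<dots> = ?D * exp_cosh_ker_mass b x"
    by (rule nn_integral_multc) measurable
  finally show "(\<integral>\<^sup>+y. yakubovich_kernel t x y * exp_cosh_ker_mass b y \<partial>lborel) \<le> ?D * exp_cosh_ker_mass b x" .
qed

text \<open>For y >= 0 the bound by K_0(e^x) K_0(e^y) suffices. For y < 0 one has e^{cy} <= e^{-by},
  which is dominated by the mixture above and so keeps its shape under the kernel.\<close>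

lemma yak_kernel_exp_moment_bound:
  assumes t: "0 < t" and b: "0 < b" and c: "- b \<le> c"
  obtains A B :: ennreal where "A < \<infinity>" "B < \<infinity>"
    "\<And>x. (\<integral>\<^sup>+y. yakubovich_kernel t x y * exp (c * y) \<partial>lborel) \<le> A * bessel_K 0 (exp x) + B * exp_cosh_ker_mass b x"
proof -
  obtain D :: ennreal where D: "D < \<infinity>"
    "\<And>x. (\<integral>\<^sup>+y. yakubovich_kernel t x y * exp_cosh_ker_mass b y \<partial>lborel) \<le> D * exp_cosh_ker_mass b x"
    using nn_integral_yak_kernel_exp_cosh_ker_mass[OF t b] by blast
  \<comment> \<open>Any exponent that is positive and at least c would do: the first gives
    integrability at -\<infinity>, the second dominates e^{cy} on y >= 0.\<close>
  let ?\<alpha> = "\<bar>c\<bar> + 1"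
  define A where "A = (\<integral>\<^sup>+y. yak_mass t * (exp (?\<alpha> * y) * bessel_K 0 (exp y)) \<partial>lborel)"
  have "A < \<infinity>"
  proof -
    have "integrable lborel (\<lambda>y. yak_mass t * (exp (?\<alpha> * y) * bessel_K 0 (exp y)))"
      by (intro integrable_mult_right integrable_exp_bessel_K_0) simp
    then show ?thesis
      unfolding A_def
      by (subst nn_integral_eq_integral) (auto intro!: AE_I2 mult_nonneg_nonneg yak_mass_nonneg less_imp_le[OF bessel_K_0_exp_pos])
  qed
  moreover have "ennreal (exp (exp 1)) * D < \<infinity>"
    using D(1) by (simp add: ennreal_mult_less_top)
  moreover have "(\<integral>\<^sup>+y. yakubovich_kernel t x y * exp (c * y) \<partial>lborel)
     \<le> A * bessel_K 0 (exp x) + ennreal (exp (exp 1)) * D * exp_cosh_ker_mass b x" for x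
  proof -
    note [measurable] = measurable_yak_kernel_right[OF t]
    have "ennreal (yakubovich_kernel t x y * exp (c * y))
       \<le> ennreal (yak_mass t * (exp (?\<alpha> * y) * bessel_K 0 (exp y))) * ennreal (bessel_K 0 (exp x))
         + ennreal (exp (exp 1)) * (ennreal (yakubovich_kernel t x y) * exp_cosh_ker_mass b y)" for y
    proof (cases "0 \<le> y")
      case True
      have "c * y \<le> ?\<alpha> * y"
        using True by (intro mult_right_mono) auto
      then have "yakubovich_kernel t x y * exp (c * y) \<le> (yak_mass t * bessel_K 0 (exp x) * bessel_K 0 (exp y)) * exp (?\<alpha> * y)"
        using abs_yak_kernel_le[OF t, of x y] by (intro mult_mono) (auto intro!: mult_nonneg_nonneg yak_mass_nonneg less_imp_le[OF bessel_K_0_exp_pos])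
      then have "ennreal (yakubovich_kernel t x y * exp (c * y)) \<le> ennreal (yak_mass t * (exp (?\<alpha> * y) * bessel_K 0 (exp y))) * ennreal (bessel_K 0 (exp x))"
        by (subst ennreal_mult[symmetric])
           (auto intro!: ennreal_leI mult_nonneg_nonneg yak_mass_nonneg less_imp_le[OF bessel_K_0_exp_pos] simp: mult_ac)
      then show ?thesis
        by (rule add_increasing2[rotated]) simp
    next
      case False
      then have "exp (c * y) \<le> exp (- b * y)"
        using c mult_right_mono_neg[of "- b" c y] by simp
      then have "ennreal (yakubovich_kernel t x y * exp (c * y)) \<le> ennreal (yakubovich_kernel t x y) * ennreal (exp (- b * y))"
        using yak_kernel_nonneg[OF t, of x y] by (simp add: ennreal_leI mult_left_mono flip: ennreal_mult)
      also have "\<dots> \<le> ennreal (yakubovich_kernel t x y) * (ennreal (exp (exp 1)) * exp_cosh_ker_mass b y)"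
        using False by (intro mult_left_mono exp_le_exp_cosh_ker_mass b) auto
      finally show ?thesis
        by (intro add_increasing) (auto simp: mult_ac)
    qed
    then have "(\<integral>\<^sup>+y. yakubovich_kernel t x y * exp (c * y) \<partial>lborel)
      \<le> (\<integral>\<^sup>+y. ennreal (yak_mass t * (exp (?\<alpha> * y) * bessel_K 0 (exp y))) * ennreal (bessel_K 0 (exp x))
         + ennreal (exp (exp 1)) * (ennreal (yakubovich_kernel t x y) * exp_cosh_ker_mass b y) \<partial>lborel)"
      by (rule nn_integral_mono)
    also have "\<dots> = A * bessel_K 0 (exp x) + ennreal (exp (exp 1)) * (\<integral>\<^sup>+y. yakubovich_kernel t x y * exp_cosh_ker_mass b y \<partial>lborel)"
      unfolding A_def by (subst nn_integral_add) (auto simp: nn_integral_multc nn_integral_cmult)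
    also have "\<dots> \<le> A * bessel_K 0 (exp x) + ennreal (exp (exp 1)) * (D * exp_cosh_ker_mass b x)"
      by (intro add_left_mono mult_left_mono D) auto
    finally show ?thesis
      by (simp add: mult.assoc)
  qed
  ultimately show ?thesis
    by (rule that)
qed

lemma yak_kernel_exp_moment_finite:
  assumes t: "0 < t"
  shows "(\<integral>\<^sup>+y. yakubovich_kernel t x y * exp (c * y) \<partial>lborel) < \<infinity>"
proof -
  have b: "0 < \<bar>c\<bar> + 1" "- (\<bar>c\<bar> + 1) \<le> c"
    by auto
  obtain A B :: ennreal where AB: "A < \<infinity>" "B < \<infinity>"
    "\<And>x. (\<integral>\<^sup>+y. yakubovich_kernel t x y * exp (c * y) \<partial>lborel) \<le> A * bessel_K 0 (exp x) + B * exp_cosh_ker_mass (\<bar>c\<bar> + 1) x"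
    using yak_kernel_exp_moment_bound[OF t b] by blast
  have "A * bessel_K 0 (exp x) + B * exp_cosh_ker_mass (\<bar>c\<bar> + 1) x < \<infinity>"
    using AB(1,2) exp_cosh_ker_mass_finite[of "\<bar>c\<bar> + 1" x] by (simp add: ennreal_mult_less_top)
  then show ?thesis
    using AB(3)[of x] by (rule le_less_trans[rotated])
qed

text \<open>The kernel is known to be nonnegative, not strictly positive. That it does not vanish
  almost everywhere follows from the positive Gaussian average of \<open>cosh_ker x\<close>.\<close>

lemma yak_kernel_exp_moment_pos:
  assumes t: "0 < t"
  shows "0 < (\<integral>\<^sup>+y. yakubovich_kernel t x y * exp (c * y) \<partial>lborel)"
proof -
  note [measurable] = measurable_yak_kernel_right[OF t]
  have "(\<integral>\<^sup>+y. yakubovich_kernel t x y * exp (c * y) \<partial>lborel) \<noteq> 0"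
  proof
    assume "(\<integral>\<^sup>+y. yakubovich_kernel t x y * exp (c * y) \<partial>lborel) = 0"
    then have "AE y in lborel. yakubovich_kernel t x y * exp (c * y) \<le> 0"
      by (subst (asm) nn_integral_0_iff_AE) (auto elim!: eventually_mono simp: ennreal_eq_0_iff)
    then have "AE y in lborel. yakubovich_kernel t x y = 0"
      by eventually_elim (use yak_kernel_nonneg[OF t] in \<open>auto simp: mult_le_0_iff intro: antisym\<close>)
    then have "(\<integral>\<^sup>+y. yakubovich_kernel t x y * cosh_ker y 0 \<partial>lborel) = (\<integral>\<^sup>+y. 0 \<partial>(lborel :: real measure))"
      by (intro nn_integral_cong_AE) (auto elim!: eventually_mono)
    then have "gauss_avg (sqrt (2 * t)) (cosh_ker x) 0 \<le> 0"
      by (simp add: nn_integral_yak_kernel_cosh_ker[OF t] ennreal_eq_0_iff)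
    moreover have "0 < gauss_avg (sqrt (2 * t)) (cosh_ker x) 0"
      unfolding gauss_avg_def
      by (intro lborel_integral_pos integrable_gauss_avg[where B = 1] mult_pos_pos abs_cosh_ker_le_1 cosh_ker_pos)
         (auto simp: normal_density_pos)
    ultimately show False by simp
  qed
  then show ?thesis
    by (simp add: zero_less_iff_neq_zero)
qed

text \<open>Integrating in x first leaves (cosh v)^(-a), and e^{b|v|} is integrable against it
  because b < a.\<close>

lemma nn_integral_exp_cosh_ker_mass_finite:
  assumes "0 < b" "b < a"
  shows "(\<integral>\<^sup>+x. exp (a * x) * exp_cosh_ker_mass b x \<partial>lborel) < \<infinity>"
proof -
  have a: "0 < a" using assms by simp
  have "(\<integral>\<^sup>+x. exp (a * x) * exp_cosh_ker_mass b x \<partial>lborel)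
     = (\<integral>\<^sup>+x. (\<integral>\<^sup>+v. ennreal (exp (b * \<bar>v\<bar>)) * ennreal (exp (a * x) * cosh_ker x v) \<partial>lborel) \<partial>lborel)"
    unfolding exp_cosh_ker_mass_def
    by (subst nn_integral_cmult[symmetric])
       (auto intro!: nn_integral_cong simp: less_imp_le[OF cosh_ker_pos] mult_ac simp flip: ennreal_mult)
  also have "\<dots> = (\<integral>\<^sup>+v. (\<integral>\<^sup>+x. ennreal (exp (b * \<bar>v\<bar>)) * ennreal (exp (a * x) * cosh_ker x v) \<partial>lborel) \<partial>lborel)"
    by (rule lborel_pair.Fubini') measurable
  also have "\<dots> = (\<integral>\<^sup>+v. ennreal (exp (b * \<bar>v\<bar>)) * ennreal (gumbel_moment a * cosh v powr (- a)) \<partial>lborel)"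
  proof (intro nn_integral_cong)
    fix v :: real
    have "(\<integral>\<^sup>+x. exp (a * x) * cosh_ker x v \<partial>lborel) = (LINT x|lborel. exp (a * x) * cosh_ker x v)"
      unfolding cosh_ker_def using a by (intro nn_integral_eq_integral integrable_exp_minus_exp) auto
    also have "\<dots> = gumbel_moment a * cosh v powr (- a)"
      unfolding cosh_ker_def by (subst integral_exp_minus_exp) auto
    finally show "(\<integral>\<^sup>+x. ennreal (exp (b * \<bar>v\<bar>)) * ennreal (exp (a * x) * cosh_ker x v) \<partial>lborel)
       = ennreal (exp (b * \<bar>v\<bar>)) * ennreal (gumbel_moment a * cosh v powr (- a))"
      by (subst nn_integral_cmult) auto
  qed
  also have "\<dots> \<le> (\<integral>\<^sup>+v. ennreal (gumbel_moment a * 2 powr a * exp (- (a - b) * \<bar>v\<bar>)) \<partial>lborel)"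
  proof (intro nn_integral_mono)
    fix v :: real
    have "gumbel_moment a * cosh v powr (- a) \<le> gumbel_moment a * (2 powr a * exp (- a * \<bar>v\<bar>))"
      by (intro mult_left_mono cosh_powr_le gumbel_moment_nonneg less_imp_le[OF a])
    then have "exp (b * \<bar>v\<bar>) * (gumbel_moment a * cosh v powr (- a)) \<le> exp (b * \<bar>v\<bar>) * (gumbel_moment a * (2 powr a * exp (- a * \<bar>v\<bar>)))"
      by (rule mult_left_mono) simp
    also have "\<dots> = gumbel_moment a * 2 powr a * exp (- (a - b) * \<bar>v\<bar>)"
    proof -
      have "- (a - b) * \<bar>v\<bar> = b * \<bar>v\<bar> + - a * \<bar>v\<bar>"
        by (simp add: algebra_simps)
      then show ?thesis
        by (simp only: exp_add mult_ac)
    qed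
    finally show "ennreal (exp (b * \<bar>v\<bar>)) * ennreal (gumbel_moment a * cosh v powr (- a)) \<le> ennreal (gumbel_moment a * 2 powr a * exp (- (a - b) * \<bar>v\<bar>))"
      by (simp add: ennreal_leI gumbel_moment_nonneg flip: ennreal_mult)
  qed
  also have "\<dots> < \<infinity>"
  proof -
    have "integrable lborel (\<lambda>v. gumbel_moment a * 2 powr a * exp (- (a - b) * \<bar>v\<bar>))"
      using assms by (intro integrable_mult_right integrable_exp_minus_abs) simp
    then show ?thesis
      by (subst nn_integral_eq_integral) (auto simp: gumbel_moment_nonneg)
  qed
  finally show ?thesis .
qed

text \<open>Since a + c > 0, one of the exponents is positive; symmetry of the kernel allows it to
  be the one attached to the outer variable.\<close>

lemma yak_kernel_two_sided_moment_finite: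
  assumes t: "0 < t" and ac: "0 < a + c"
  shows "(\<integral>\<^sup>+x. exp (a * x) * (\<integral>\<^sup>+y. yakubovich_kernel t x y * exp (c * y) \<partial>lborel) \<partial>lborel) < \<infinity>"
proof -
  have main: "(\<integral>\<^sup>+x. exp (a * x) * (\<integral>\<^sup>+y. yakubovich_kernel t x y * exp (c * y) \<partial>lborel) \<partial>lborel) < \<infinity>"
    if a: "0 < a" and ac: "0 < a + c" for a c
  proof -
    \<comment> \<open>The moment bound asks for b >= -c and the outer integral for 0 < b < a; the
      two are compatible because -c < a.\<close>
    define b where "b = max (a / 2) (- c)"
    have b: "0 < b" "b < a" "- b \<le> c"
      using a ac by (auto simp: b_def)
    obtain A B :: ennreal where AB: "A < \<infinity>" "B < \<infinity>"
      "\<And>x. (\<integral>\<^sup>+y. yakubovich_kernel t x y * exp (c * y) \<partial>lborel) \<le> A * bessel_K 0 (exp x) + B * exp_cosh_ker_mass b x"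
      using yak_kernel_exp_moment_bound[OF t b(1,3)] by blast
    have "(\<integral>\<^sup>+x. exp (a * x) * (\<integral>\<^sup>+y. yakubovich_kernel t x y * exp (c * y) \<partial>lborel) \<partial>lborel)
      \<le> (\<integral>\<^sup>+x. A * ennreal (exp (a * x) * bessel_K 0 (exp x)) + B * (exp (a * x) * exp_cosh_ker_mass b x) \<partial>lborel)"
    proof (rule nn_integral_mono)
      fix x :: real
      have "exp (a * x) * (\<integral>\<^sup>+y. yakubovich_kernel t x y * exp (c * y) \<partial>lborel) \<le> exp (a * x) * (A * bessel_K 0 (exp x) + B * exp_cosh_ker_mass b x)"
        by (intro mult_left_mono AB) simp
      then show "exp (a * x) * (\<integral>\<^sup>+y. yakubovich_kernel t x y * exp (c * y) \<partial>lborel)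
        \<le> A * ennreal (exp (a * x) * bessel_K 0 (exp x)) + B * (exp (a * x) * exp_cosh_ker_mass b x)"
        by (simp add: ennreal_mult less_imp_le[OF bessel_K_0_exp_pos] distrib_left mult_ac)
    qed
    also have "\<dots> = A * (\<integral>\<^sup>+x. exp (a * x) * bessel_K 0 (exp x) \<partial>lborel) + B * (\<integral>\<^sup>+x. exp (a * x) * exp_cosh_ker_mass b x \<partial>lborel)"
      by (subst nn_integral_add) (auto simp: nn_integral_cmult)
    also have "\<dots> < \<infinity>"
    proof -
      have "(\<integral>\<^sup>+x. exp (a * x) * bessel_K 0 (exp x) \<partial>lborel) < \<infinity>"
        using integrable_exp_bessel_K_0[OF a] by (simp add: integrable_iff_bounded abs_mult less_imp_le[OF bessel_K_0_exp_pos])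
      then show ?thesis
        using AB(1,2) nn_integral_exp_cosh_ker_mass_finite[OF b(1,2)] by (simp add: ennreal_mult_less_top)
    qed
    finally show ?thesis .
  qed
  have meas: "(\<lambda>(x, y). yakubovich_kernel t x y) \<in> borel_measurable (borel \<Otimes>\<^sub>M borel)"
    using measurable_yak_kernel[OF t measurable_fst measurable_snd] by (simp add: case_prod_unfold)
  note [measurable] = measurable_yak_kernel[OF t]
  have swap: "(\<integral>\<^sup>+x. exp (a * x) * (\<integral>\<^sup>+y. yakubovich_kernel t x y * exp (c * y) \<partial>lborel) \<partial>lborel)
     = (\<integral>\<^sup>+x. exp (c * x) * (\<integral>\<^sup>+y. yakubovich_kernel t x y * exp (a * y) \<partial>lborel) \<partial>lborel)"
  proof -
    have "(\<integral>\<^sup>+x. exp (a * x) * (\<integral>\<^sup>+y. yakubovich_kernel t x y * exp (c * y) \<partial>lborel) \<partial>lborel)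
        = (\<integral>\<^sup>+x. (\<integral>\<^sup>+y. ennreal (exp (a * x)) * ennreal (yakubovich_kernel t x y * exp (c * y)) \<partial>lborel) \<partial>lborel)"
      by (subst nn_integral_cmult) auto
    also have "\<dots> = (\<integral>\<^sup>+y. (\<integral>\<^sup>+x. ennreal (exp (a * x)) * ennreal (yakubovich_kernel t x y * exp (c * y)) \<partial>lborel) \<partial>lborel)"
      by (rule lborel_pair.Fubini') measurable
    also have "\<dots> = (\<integral>\<^sup>+y. (\<integral>\<^sup>+x. ennreal (exp (c * y)) * ennreal (yakubovich_kernel t y x * exp (a * x)) \<partial>lborel) \<partial>lborel)"
      by (intro nn_integral_cong) (simp add: yak_kernel_sym[of t] yak_kernel_nonneg[OF t] mult_ac flip: ennreal_mult)
    also have "\<dots> = (\<integral>\<^sup>+x. exp (c * x) * (\<integral>\<^sup>+y. yakubovich_kernel t x y * exp (a * y) \<partial>lborel) \<partial>lborel)"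
      by (subst nn_integral_cmult) auto
    finally show ?thesis .
  qed
  show ?thesis
  proof (cases "0 < a")
    case True
    then show ?thesis using main ac by blast
  next
    case False
    then show ?thesis
      unfolding swap using ac by (intro main) auto
  qed
qed

section \<open>Markov processes from transition densities\<close>

abbreviation (input) borel_PiM :: "'i set \<Rightarrow> ('i \<Rightarrow> real) measure" where
  "borel_PiM J \<equiv> Pi\<^sub>M J (\<lambda>_. borel)"

abbreviation (input) lborel_PiM :: "'i set \<Rightarrow> ('i \<Rightarrow> real) measure" where
  "lborel_PiM J \<equiv> Pi\<^sub>M J (\<lambda>_. lborel)"

abbreviation (input) restrict_law :: "'i set \<Rightarrow> ('i \<Rightarrow> real) measure \<Rightarrow> ('i \<Rightarrow> real) measure" where
  "restrict_law J M \<equiv> distr M (borel_PiM J) (\<lambda>\<omega>. restrict \<omega> J)"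

text \<open>Kolmogorov extension works with finite sets of times, which carry no enumeration;
  consecutive times are therefore expressed through the predecessor.\<close>

definition preceding :: "real set \<Rightarrow> real \<Rightarrow> real" where
  "preceding J j = Max {i \<in> J. i < j}"

lemma preceding_eqI:
  assumes "finite J" "i \<in> J" "i < j" "\<And>l. l \<in> J \<Longrightarrow> l < j \<Longrightarrow> l \<le> i"
  shows "preceding J j = i"
  unfolding preceding_def using assms by (intro Max_eqI) auto

lemma preceding_in:
  assumes "finite J" "i \<in> J" "i < j"
  shows "preceding J j \<in> J" "preceding J j < j"
proof -
  have "Max {i \<in> J. i < j} \<in> {i \<in> J. i < j}"
    using assms by (intro Max_in) auto
  then show "preceding J j \<in> J" "preceding J j < j"
    by (auto simp: preceding_def)
qed

lemma preceding_ge: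
  assumes "finite J" "i \<in> J" "i < j"
  shows "i \<le> preceding J j"
  unfolding preceding_def using assms by (intro Max_ge) auto

text \<open>\<open>lborel_PiM\<close> carries the densities, while the extension theorem is phrased
  over \<open>borel_PiM\<close>.\<close>

lemma sets_PiM_lborel: "sets (lborel_PiM J) = sets (borel_PiM J)"
  by (intro sets_PiM_cong) auto

lemma space_PiM_lborel: "space (lborel_PiM J) = space (borel_PiM J)"
  by (simp add: space_PiM)

lemma measurable_restrict_borel:
  assumes "J \<subseteq> K"
  shows "(\<lambda>\<omega>. restrict \<omega> J) \<in> measurable (borel_PiM K) (borel_PiM J)"
  using assms by (rule measurable_restrict_subset)

text \<open>The densities depend on both times, since the h-transform destroys homogeneity. The
  identities hold at every point, so no exceptional null sets accumulate when times are
  inserted.\<close>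

locale markov_densities =
  fixes \<tau> :: real and \<pi> :: "real \<Rightarrow> ennreal" and q :: "real \<Rightarrow> real \<Rightarrow> real \<Rightarrow> real \<Rightarrow> ennreal"
  assumes tau_nonneg: "0 \<le> \<tau>"
    and pi_measurable [measurable]: "\<pi> \<in> borel_measurable borel"
    and pi_total: "(\<integral>\<^sup>+x. \<pi> x \<partial>lborel) = 1"
    and q_measurable: "\<And>s t. 0 \<le> s \<Longrightarrow> s < t \<Longrightarrow> t \<le> \<tau> \<Longrightarrow> (\<lambda>(x, y). q s t x y) \<in> borel_measurable (borel \<Otimes>\<^sub>M borel)"
    and q_total: "\<And>s t x. 0 \<le> s \<Longrightarrow> s < t \<Longrightarrow> t \<le> \<tau> \<Longrightarrow> (\<integral>\<^sup>+y. q s t x y \<partial>lborel) = 1"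
    and q_compose: "\<And>r s t x z. 0 \<le> r \<Longrightarrow> r < s \<Longrightarrow> s < t \<Longrightarrow> t \<le> \<tau> \<Longrightarrow>
      (\<integral>\<^sup>+y. q r s x y * q s t y z \<partial>lborel) = q r t x z"
begin

lemma measurable_q:
  assumes "0 \<le> s" "s < t" "t \<le> \<tau>"
    and [measurable]: "f \<in> borel_measurable N" "g \<in> borel_measurable N"
  shows "(\<lambda>\<omega>. q s t (f \<omega>) (g \<omega>)) \<in> borel_measurable N"
proof -
  note [measurable] = q_measurable[OF assms(1-3)]
  have "(\<lambda>\<omega>. (\<lambda>(x, y). q s t x y) (f \<omega>, g \<omega>)) \<in> borel_measurable N"
    by measurable
  then show ?thesis by simp
qed

definition time_set :: "real set \<Rightarrow> bool" where
  "time_set J \<longleftrightarrow> finite J \<and> 0 \<in> J \<and> J \<subseteq> {0..\<tau>}"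

lemma time_set_insert: "time_set J \<Longrightarrow> k \<in> {0..\<tau>} \<Longrightarrow> time_set (insert k J)"
  by (auto simp: time_set_def)

lemma time_set_preceding:
  assumes "time_set J" "j \<in> J - {0}"
  shows "preceding J j \<in> J" "preceding J j < j" "0 \<le> preceding J j" "j \<le> \<tau>"
  using preceding_in[of J 0 j] preceding_ge[of J 0 j] assms by (auto simp: time_set_def)

definition path_density :: "real set \<Rightarrow> (real \<Rightarrow> real) \<Rightarrow> ennreal" where
  "path_density J x = \<pi> (x 0) * (\<Prod>j\<in>J - {0}. q (preceding J j) j (x (preceding J j)) (x j))"

lemma measurable_path_density:
  assumes J: "time_set J"
  shows "path_density J \<in> borel_measurable (lborel_PiM J)"
proof -
  have comp: "(\<lambda>x. x i) \<in> borel_measurable (lborel_PiM J)" if "i \<in> J" for i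
    using measurable_component_singleton[OF that, of "\<lambda>_. lborel :: real measure"] by simp
  have "(\<lambda>x. \<pi> (x 0)) \<in> borel_measurable (lborel_PiM J)"
    using J comp[of 0] by (intro measurable_compose[OF _ pi_measurable]) (auto simp: time_set_def)
  then show ?thesis
    unfolding path_density_def[abs_def] using time_set_preceding[OF J] comp
    by (intro borel_measurable_times_ennreal borel_measurable_prod_ennreal measurable_q) auto
qed

lemma path_density_insert_last:
  assumes J: "time_set J" and k: "\<And>j. j \<in> J \<Longrightarrow> j < k" and s: "s \<in> J" "\<And>j. j \<in> J \<Longrightarrow> j \<le> s"
  shows "path_density (insert k J) (x(k := y)) = path_density J x * q s k (x s) y"
proof -
  have fin: "finite J" and J0: "0 \<in> J"
    using J by (auto simp: time_set_def)
  have kJ: "k \<notin> J" "k \<noteq> 0"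
    using k J0 by force+
  have pk: "preceding (insert k J) k = s"
    using fin s k by (intro preceding_eqI) auto
  have pj: "preceding (insert k J) j = preceding J j" if "j \<in> J" for j
  proof -
    have "{i \<in> insert k J. i < j} = {i \<in> J. i < j}"
      using k[OF that] by auto
    then show ?thesis by (simp add: preceding_def)
  qed
  have "path_density (insert k J) (x(k := y)) = \<pi> (x 0) *
     (q s k (x s) y * (\<Prod>j\<in>J - {0}. q (preceding (insert k J) j) j ((x(k := y)) (preceding (insert k J) j)) ((x(k := y)) j)))"
    using fin kJ pk s(1) by (auto simp: path_density_def insert_Diff_if)
  also have "(\<Prod>j\<in>J - {0}. q (preceding (insert k J) j) j ((x(k := y)) (preceding (insert k J) j)) ((x(k := y)) j))
     = (\<Prod>j\<in>J - {0}. q (preceding J j) j (x (preceding J j)) (x j))"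
    using kJ pj time_set_preceding[OF J] by (intro prod.cong refl) (auto simp: fun_upd_def)
  finally show ?thesis
    by (simp add: path_density_def mult_ac)
qed

text \<open>A time k inserted between consecutive times m and n replaces one factor by two; every
  other time keeps its predecessor.\<close>

lemma path_density_insert_middle:
  assumes J: "time_set J" and k: "k \<notin> J" "0 < k" and n: "n \<in> J" "k < n" "\<forall>j\<in>J. k < j \<longrightarrow> n \<le> j"
  defines "m \<equiv> preceding J n"
  shows "m \<in> J" "m < k" "n \<noteq> 0"
    "path_density (insert k J) (x(k := y)) = (\<pi> (x 0) * (\<Prod>j\<in>J - {0} - {n}. q (preceding J j) j (x (preceding J j)) (x j)))
       * (q m k (x m) y * q k n y (x n))"
    "path_density J x = (\<pi> (x 0) * (\<Prod>j\<in>J - {0} - {n}. q (preceding J j) j (x (preceding J j)) (x j))) * q m n (x m) (x n)"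
proof -
  have fin: "finite J" and J0: "0 \<in> J"
    using J by (auto simp: time_set_def)
  show n0: "n \<noteq> 0" using k n by auto
  have mJ: "m \<in> J" "m < n"
    unfolding m_def using preceding_in[OF fin J0, of n] k n by auto
  show "m \<in> J" by fact
  have "m \<noteq> k" using mJ k by auto
  then show mk: "m < k"
    using bspec[OF n(3) mJ(1)] mJ(2) by (metis linorder_neqE_linordered_idom not_le)
  have m_max: "j \<le> m" if "j \<in> J" "j < n" for j
    unfolding m_def by (rule preceding_ge[OF fin that])
  have pk: "preceding (insert k J) k = m"
    using fin mJ mk m_max n by (intro preceding_eqI) auto
  have pn: "preceding (insert k J) n = k"
    using fin n mk by (intro preceding_eqI) (auto dest: m_max)
  have pj: "preceding (insert k J) j = preceding J j" if "j \<in> J - {0} - {n}" for j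
  proof (cases "k < j")
    case True
    then have nj: "n < j" using bspec[OF n(3), of j] that by auto
    have "n \<le> preceding J j"
      using fin n nj by (intro preceding_ge) auto
    then show ?thesis
      using fin preceding_in[OF fin n(1) nj] preceding_ge[OF fin, of _ j] n(2)
      by (intro preceding_eqI) auto
  next
    case False
    then have "{i \<in> insert k J. i < j} = {i \<in> J. i < j}"
      by auto
    then show ?thesis by (simp add: preceding_def)
  qed
  define R where "R = J - {0} - {n}"
  have R: "insert k J - {0} = insert k (insert n R)" "finite R" "n \<notin> R" "k \<notin> insert n R"
    using k n n0 fin by (auto simp: R_def)
  have "path_density (insert k J) (x(k := y)) = \<pi> (x 0) *
     (q m k (x m) y * (q k n y (x n) * (\<Prod>j\<in>R. q (preceding (insert k J) j) j ((x(k := y)) (preceding (insert k J) j)) ((x(k := y)) j))))"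
    unfolding path_density_def R(1) using R(2-4) k n pk pn mk by simp
  also have "(\<Prod>j\<in>R. q (preceding (insert k J) j) j ((x(k := y)) (preceding (insert k J) j)) ((x(k := y)) j))
     = (\<Prod>j\<in>J - {0} - {n}. q (preceding J j) j (x (preceding J j)) (x j))"
    using k pj time_set_preceding[OF J] by (intro prod.cong) (auto simp: R_def fun_upd_def)
  finally show "path_density (insert k J) (x(k := y)) = (\<pi> (x 0) * (\<Prod>j\<in>J - {0} - {n}. q (preceding J j) j (x (preceding J j)) (x j)))
       * (q m k (x m) y * q k n y (x n))"
    by (simp only: mult_ac)
  show "path_density J x = (\<pi> (x 0) * (\<Prod>j\<in>J - {0} - {n}. q (preceding J j) j (x (preceding J j)) (x j))) * q m n (x m) (x n)"
    unfolding path_density_def using fin n n0 by (subst prod.remove[of _ n]) (auto simp: m_def mult_ac)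
qed

text \<open>As 0 is in \<open>J\<close>, a new time lies either after all others, where total mass 1
  removes it, or in a gap, where the composition law does.\<close>

lemma nn_integral_path_density_insert:
  assumes J: "time_set J" and k: "k \<notin> J" "k \<in> {0..\<tau>}"
  shows "(\<integral>\<^sup>+y. path_density (insert k J) (x(k := y)) \<partial>lborel) = path_density J x"
proof -
  have fin: "finite J" and J0: "0 \<in> J" and sub: "J \<subseteq> {0..\<tau>}"
    using J by (auto simp: time_set_def)
  have k0: "0 < k" "k \<le> \<tau>" using k J0 by (auto simp: less_le)
  have meas: "(\<lambda>y. q s t (f y) (g y)) \<in> borel_measurable lborel"
    if "s \<in> insert k J" "t \<in> insert k J" "s < t" "f \<in> borel_measurable borel" "g \<in> borel_measurable borel" for s t f g
    using that k0 sub by (intro measurable_q) auto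
  show ?thesis
  proof (cases "\<exists>n\<in>J. k < n")
    case False
    then have last: "j < k" if "j \<in> J" for j
      using that k by (metis linorder_neqE_linordered_idom)
    define s where "s = Max J"
    have s: "s \<in> J" "\<And>j. j \<in> J \<Longrightarrow> j \<le> s"
      using fin J0 by (auto simp: s_def intro!: Max_in)
    have "path_density (insert k J) (x(k := y)) = path_density J x * q s k (x s) y" for y
      using path_density_insert_last[OF J, of k s x y] last s by blast
    then have "(\<integral>\<^sup>+y. path_density (insert k J) (x(k := y)) \<partial>lborel) = (\<integral>\<^sup>+y. path_density J x * q s k (x s) y \<partial>lborel)"
      by simp
    also have "\<dots> = path_density J x * (\<integral>\<^sup>+y. q s k (x s) y \<partial>lborel)"
      using s(1) last[OF s(1)] by (intro nn_integral_cmult meas) auto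
    finally show ?thesis
      using s(1) last[OF s(1)] sub k0 by (subst (asm) q_total) auto
  next
    case True
    define n where "n = Min {j \<in> J. k < j}"
    have "n \<in> {j \<in> J. k < j}"
      unfolding n_def using fin True by (intro Min_in) auto
    moreover have "\<forall>j\<in>J. k < j \<longrightarrow> n \<le> j"
      unfolding n_def using fin by (auto intro!: Min_le)
    ultimately have n: "n \<in> J" "k < n" "\<forall>j\<in>J. k < j \<longrightarrow> n \<le> j"
      by auto
    note mid = path_density_insert_middle[OF J k(1) k0(1) n]
    let ?m = "preceding J n"
    have "0 \<le> ?m" "n \<le> \<tau>"
      using mid(1) n(1) sub by auto
    then have comp: "(\<integral>\<^sup>+y. q ?m k (x ?m) y * q k n y (x n) \<partial>lborel) = q ?m n (x ?m) (x n)"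
      using mid(2) n(2) by (intro q_compose)
    show ?thesis
      unfolding mid(4) mid(5) comp[symmetric]
      using mid(1,2) n(1,2) by (intro nn_integral_cmult borel_measurable_times_ennreal meas) auto
  qed
qed

section \<open>Consistency of the finite-dimensional laws\<close>

definition path_measure :: "real set \<Rightarrow> (real \<Rightarrow> real) measure" where
  "path_measure J = density (lborel_PiM J) (path_density J)"

lemma sets_path_measure: "sets (path_measure J) = sets (borel_PiM J)"
  by (simp add: path_measure_def sets_PiM_lborel)

lemma space_path_measure: "space (path_measure J) = space (borel_PiM J)"
  by (simp add: path_measure_def space_PiM_lborel)

lemma measurable_restrict_path_measure:
  assumes "J \<subseteq> K"
  shows "(\<lambda>\<omega>. restrict \<omega> J) \<in> measurable (path_measure K) (borel_PiM J)"
  using measurable_restrict_borel[OF assms] by (simp add: measurable_cong_sets[OF sets_path_measure refl])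

lemma nn_integral_path_measure:
  assumes J: "time_set J" and f: "f \<in> borel_measurable (lborel_PiM J)"
  shows "(\<integral>\<^sup>+x. f x \<partial>path_measure J) = (\<integral>\<^sup>+x. path_density J x * f x \<partial>(lborel_PiM J))"
  unfolding path_measure_def by (rule nn_integral_density[OF measurable_path_density[OF J] f])

lemma nn_integral_PiM_lborel_insert:
  fixes J :: "real set"
  assumes "finite J" "k \<notin> J" and f: "f \<in> borel_measurable (lborel_PiM (insert k J))"
  shows "(\<integral>\<^sup>+x. f x \<partial>(lborel_PiM (insert k J))) = (\<integral>\<^sup>+x. (\<integral>\<^sup>+y. f (x(k := y)) \<partial>lborel) \<partial>(lborel_PiM J))"
proof -
  interpret product_sigma_finite "\<lambda>_ :: real. lborel :: real measure" ..
  show ?thesis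
    by (rule product_nn_integral_insert) fact+
qed

lemma restrict_fun_upd_PiM:
  assumes "x \<in> space (lborel_PiM J)" "k \<notin> J"
  shows "restrict (x(k := y)) J = x"
  using assms by (auto simp: space_PiM PiE_def extensional_def restrict_def fun_eq_iff)

lemma distr_path_measure_insert:
  assumes J: "time_set J" and k: "k \<in> {0..\<tau>}"
  shows "restrict_law J (path_measure (insert k J)) = path_measure J"
proof (cases "k \<in> J")
  case True
  have "restrict_law J (path_measure J) = distr (path_measure J) (path_measure J) (\<lambda>\<omega>. \<omega>)"
    by (intro distr_cong) (auto simp: sets_path_measure space_path_measure space_PiM intro: PiE_restrict)
  then show ?thesis
    using True by (simp add: insert_absorb)
next
  case False
  note kJ = False
  have fin: "finite J" using J by (simp add: time_set_def)
  have J': "time_set (insert k J)" using J k by (rule time_set_insert)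
  have rm: "(\<lambda>\<omega>. restrict \<omega> J) \<in> measurable (path_measure (insert k J)) (borel_PiM J)"
    by (rule measurable_restrict_path_measure) auto
  show ?thesis
  proof (rule measure_eqI)
    fix A assume "A \<in> sets (restrict_law J (path_measure (insert k J)))"
    then have A: "A \<in> sets (borel_PiM J)" by simp
    have A': "A \<in> sets (lborel_PiM J)"
      using A by (simp add: sets_PiM_lborel)
    have indm: "(\<lambda>\<omega>. indicator A (restrict \<omega> J) :: ennreal) \<in> borel_measurable (lborel_PiM (insert k J))"
      by (rule measurable_compose[OF measurable_restrict_subset borel_measurable_indicator[OF A']]) auto
    have "emeasure (restrict_law J (path_measure (insert k J))) A
        = (\<integral>\<^sup>+\<omega>. indicator A \<omega> \<partial>restrict_law J (path_measure (insert k J)))"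
      using A by simp
    also have "\<dots> = (\<integral>\<^sup>+\<omega>. indicator A (restrict \<omega> J) \<partial>path_measure (insert k J))"
      using A by (intro nn_integral_distr[OF rm]) simp
    also have "\<dots> = (\<integral>\<^sup>+x. path_density (insert k J) x * indicator A (restrict x J) \<partial>(lborel_PiM (insert k J)))"
      by (rule nn_integral_path_measure[OF J' indm])
    also have "\<dots> = (\<integral>\<^sup>+x. (\<integral>\<^sup>+y. path_density (insert k J) (x(k := y)) * indicator A (restrict (x(k := y)) J) \<partial>lborel) \<partial>(lborel_PiM J))"
      by (rule nn_integral_PiM_lborel_insert[OF fin kJ]) (intro borel_measurable_times_ennreal measurable_path_density J' indm)
    also have "\<dots> = (\<integral>\<^sup>+x. path_density J x * indicator A x \<partial>(lborel_PiM J))"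
    proof (intro nn_integral_cong)
      fix x assume x: "x \<in> space (lborel_PiM J)"
      show "(\<integral>\<^sup>+y. path_density (insert k J) (x(k := y)) * indicator A (restrict (x(k := y)) J) \<partial>lborel) = path_density J x * indicator A x"
        unfolding restrict_fun_upd_PiM[OF x kJ]
        by (cases "x \<in> A") (auto simp: nn_integral_path_density_insert[OF J kJ k])
    qed
    also have "\<dots> = emeasure (path_measure J) A"
      unfolding path_measure_def by (rule emeasure_density[symmetric, OF measurable_path_density[OF J] A'])
    finally show "emeasure (restrict_law J (path_measure (insert k J))) A = emeasure (path_measure J) A" .
  qed (simp add: sets_path_measure)
qed

lemma distr_path_measure_Un:
  assumes J: "time_set J" and K: "finite K" "K \<subseteq> {0..\<tau>}"
  shows "restrict_law J (path_measure (J \<union> K)) = path_measure J"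
  using K
proof (induction K rule: finite_induct)
  case empty
  \<comment> \<open>The base case says that restriction to \<open>J\<close> does nothing to the law;
    it is the insertion lemma for the time 0, which is already present.\<close>
  have J0: "insert 0 J = J"
    using J by (auto simp: time_set_def)
  show ?case
    unfolding Un_empty_right
    by (rule distr_path_measure_insert[OF J, of 0, unfolded J0]) (simp add: tau_nonneg)
next
  case (insert k K)
  have JK: "time_set (J \<union> K)"
    using J insert by (auto simp: time_set_def)
  have "restrict_law J (path_measure (J \<union> insert k K))
      = distr (path_measure (insert k (J \<union> K))) (borel_PiM J) ((\<lambda>\<omega>. restrict \<omega> J) \<circ> (\<lambda>\<omega>. restrict \<omega> (J \<union> K)))"
    by (intro distr_cong) (auto simp: restrict_def fun_eq_iff)
  also have "\<dots> = distr (restrict_law (J \<union> K) (path_measure (insert k (J \<union> K)))) (borel_PiM J) (\<lambda>\<omega>. restrict \<omega> J)"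
    by (intro distr_distr[symmetric] measurable_restrict_borel measurable_restrict_path_measure) auto
  also have "restrict_law (J \<union> K) (path_measure (insert k (J \<union> K))) = path_measure (J \<union> K)"
    using insert.prems by (intro distr_path_measure_insert[OF JK]) simp
  also have "restrict_law J (path_measure (J \<union> K)) = path_measure J"
    using insert.prems by (intro insert.IH) simp
  finally show ?case .
qed

lemma distr_path_measure_subset:
  assumes J: "time_set J" and K: "time_set K" "J \<subseteq> K"
  shows "restrict_law J (path_measure K) = path_measure J"
  using distr_path_measure_Un[OF J, of K] K by (simp add: time_set_def Un_absorb1)

text \<open>Consistency reduces the total mass to that at the single time 0, which is the integral
  of the initial density.\<close>

lemma prob_space_path_measure:
  assumes J: "time_set J"
  shows "prob_space (path_measure J)"
proof
  interpret product_sigma_finite "\<lambda>_ :: real. lborel :: real measure" ..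
  have T: "time_set {0}" "time_set J" "{0} \<subseteq> J"
    using J tau_nonneg by (auto simp: time_set_def)
  have "emeasure (path_measure {0}) (space (path_measure {0})) = (\<integral>\<^sup>+x. 1 \<partial>path_measure {0})"
    by simp
  also have "\<dots> = (\<integral>\<^sup>+x. \<pi> (x 0) \<partial>(lborel_PiM {0::real}))"
    by (subst nn_integral_path_measure[OF T(1)]) (auto simp: path_density_def)
  also have "\<dots> = 1"
    using product_nn_integral_singleton[of \<pi> 0] by (simp add: pi_total)
  finally have "emeasure (distr (path_measure J) (borel_PiM {0}) (\<lambda>\<omega>. restrict \<omega> {0})) (space (borel_PiM {0})) = 1"
    unfolding distr_path_measure_subset[OF T] by (simp add: space_path_measure)
  moreover have "(\<lambda>\<omega>. restrict \<omega> {0}) -` space (borel_PiM {0}) \<inter> space (path_measure J) = space (path_measure J)"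
    using measurable_space[OF measurable_restrict_path_measure[OF T(3)]] by auto
  ultimately show "emeasure (path_measure J) (space (path_measure J)) = 1"
    using T(3) by (subst (asm) emeasure_distr) (auto intro: measurable_restrict_path_measure)
qed

text \<open>The extension theorem asks for a law for every finite set of times, also without 0,
  whereas path densities start at 0; so 0 is added and projected out again.\<close>

definition marginal :: "real set \<Rightarrow> (real \<Rightarrow> real) measure" where
  "marginal J = restrict_law J (path_measure (insert 0 J))"

lemma marginal_time_set:
  assumes "time_set J"
  shows "marginal J = path_measure J"
  using distr_path_measure_insert[OF assms, of 0] tau_nonneg by (simp add: marginal_def)

text \<open>Both laws are images of the one over \<open>insert 0 H\<close>, and restriction to
  \<open>J\<close> factors through \<open>insert 0 J\<close> as well as through
  \<open>H\<close>.\<close>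

lemma polish_projective_marginal: "polish_projective {0..\<tau>} marginal"
proof (intro polish_projective.intro projective_family.intro)
  fix J H :: "real set" assume JH: "J \<subseteq> H" "finite H" "H \<subseteq> {0..\<tau>}"
  have T: "time_set (insert 0 J)" "time_set (insert 0 H)" "insert 0 J \<subseteq> insert 0 H"
    using JH tau_nonneg finite_subset by (auto simp: time_set_def)
  have "marginal J = restrict_law J (restrict_law (insert 0 J) (path_measure (insert 0 H)))"
    unfolding marginal_def distr_path_measure_subset[OF T] ..
  also have "\<dots> = distr (path_measure (insert 0 H)) (borel_PiM J) ((\<lambda>\<omega>. restrict \<omega> J) \<circ> (\<lambda>\<omega>. restrict \<omega> (insert 0 J)))"
    using T by (intro distr_distr measurable_restrict_borel measurable_restrict_path_measure) auto
  also have "\<dots> = distr (path_measure (insert 0 H)) (borel_PiM J) ((\<lambda>\<omega>. restrict \<omega> J) \<circ> (\<lambda>\<omega>. restrict \<omega> H))"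
    using JH by (intro distr_cong) (auto simp: restrict_def fun_eq_iff)
  also have "\<dots> = restrict_law J (marginal H)"
    unfolding marginal_def using JH
    by (intro distr_distr[symmetric] measurable_restrict_borel measurable_restrict_path_measure) auto
  finally show "marginal J = restrict_law J (marginal H)" .
next
  fix J :: "real set" assume "finite J" "J \<subseteq> {0..\<tau>}"
  then have T: "time_set (insert 0 J)"
    using tau_nonneg by (auto simp: time_set_def)
  show "prob_space (marginal J)"
    unfolding marginal_def
    by (intro prob_space.prob_space_distr prob_space_path_measure T measurable_restrict_path_measure) auto
qed

section \<open>The law on path space\<close>

definition process_law :: "(real \<Rightarrow> real) measure" where
  "process_law = projective_family.lim {0..\<tau>} marginal (\<lambda>_. borel)"

lemma sets_process_law [measurable_cong]: "sets process_law = sets (borel_PiM {0..\<tau>})"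
  and space_process_law: "space process_law = space (borel_PiM {0..\<tau>})"
  and prob_space_process_law: "prob_space process_law"
proof -
  interpret polish_projective "{0..\<tau>}" marginal
    by (rule polish_projective_marginal)
  show "sets process_law = sets (borel_PiM {0..\<tau>})" "space process_law = space (borel_PiM {0..\<tau>})"
    by (simp_all add: process_law_def)
  show "prob_space process_law"
    unfolding process_law_def by (rule P.prob_space_axioms)
qed

lemma distr_process_law:
  assumes J: "time_set J"
  shows "restrict_law J process_law = path_measure J"
proof (rule measure_eqI)
  interpret polish_projective "{0..\<tau>}" marginal
    by (rule polish_projective_marginal)
  fix A assume "A \<in> sets (restrict_law J process_law)"
  then have A: "A \<in> sets (borel_PiM J)" by simp
  have "emeasure (restrict_law J process_law) A = emeasure process_law (prod_emb {0..\<tau>} (\<lambda>_. borel) J A)"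
    using J A by (intro emeasure_distr_restrict) (auto simp: time_set_def sets_process_law)
  also have "\<dots> = emeasure (path_measure J) A"
    unfolding process_law_def using J A by (subst emeasure_lim_emb) (auto simp: time_set_def marginal_time_set)
  finally show "emeasure (restrict_law J process_law) A = emeasure (path_measure J) A" .
qed (simp add: sets_path_measure)

lemma measurable_restrict_process_law:
  assumes "J \<subseteq> {0..\<tau>}"
  shows "(\<lambda>\<omega>. restrict \<omega> J) \<in> measurable process_law (borel_PiM J)"
  using measurable_restrict_borel[OF assms] by (simp add: measurable_cong_sets[OF sets_process_law refl])

lemma measurable_process_component:
  assumes "t \<in> {0..\<tau>}"
  shows "(\<lambda>\<omega>. \<omega> t) \<in> borel_measurable process_law"
  using measurable_component_singleton[OF assms, of "\<lambda>_. borel :: real measure"]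
  by (simp add: measurable_cong_sets[OF sets_process_law refl])

lemma nn_integral_process_law:
  assumes J: "time_set J" and f: "f \<in> borel_measurable (borel_PiM J)"
  shows "(\<integral>\<^sup>+\<omega>. f (restrict \<omega> J) \<partial>process_law) = (\<integral>\<^sup>+x. path_density J x * f x \<partial>(lborel_PiM J))"
proof -
  have f': "f \<in> borel_measurable (lborel_PiM J)"
    using f by (simp add: measurable_cong_sets[OF sets_PiM_lborel refl])
  have "(\<integral>\<^sup>+\<omega>. f (restrict \<omega> J) \<partial>process_law) = (\<integral>\<^sup>+x. f x \<partial>restrict_law J process_law)"
    using J f by (intro nn_integral_distr[symmetric] measurable_restrict_process_law) (auto simp: time_set_def)
  then show ?thesis
    by (simp add: distr_process_law[OF J] nn_integral_path_measure[OF J f'])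
qed

section \<open>The Markov property\<close>

definition transition :: "real \<Rightarrow> real \<Rightarrow> real set \<Rightarrow> real \<Rightarrow> ennreal" where
  "transition s t A x = (\<integral>\<^sup>+y. q s t x y * indicator A y \<partial>lborel)"

lemma measurable_transition:
  assumes "0 \<le> s" "s < t" "t \<le> \<tau>" and [measurable]: "A \<in> sets borel"
  shows "transition s t A \<in> borel_measurable borel"
proof -
  note [measurable] = q_measurable[OF assms(1-3)]
  have "(\<lambda>x. \<integral>\<^sup>+y. (\<lambda>(x, y). q s t x y) (x, y) * indicator A y \<partial>lborel) \<in> borel_measurable borel"
    by measurable
  then show ?thesis
    by (simp add: transition_def[abs_def])
qed

lemma transition_le_1:
  assumes "0 \<le> s" "s < t" "t \<le> \<tau>"
  shows "transition s t A x \<le> 1"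
  unfolding transition_def q_total[OF assms, of x, symmetric]
  by (intro nn_integral_mono) (auto simp: indicator_def)

text \<open>Including \<open>0\<close> loses no generality and makes \<open>path_density\<close> available; including \<open>s\<close> makes it the
  last time, so that a later time \<open>t\<close> contributes just one factor \<open>q s t\<close>.\<close>

definition past_cylinders :: "real \<Rightarrow> (real \<Rightarrow> real) set set" where
  "past_cylinders s = {(\<lambda>\<omega>. restrict \<omega> J) -` X \<inter> space process_law | J X.
     finite J \<and> 0 \<in> J \<and> s \<in> J \<and> J \<subseteq> {0..s} \<and> X \<in> sets (borel_PiM J)}"

lemma past_cylindersI:
  assumes "finite J" "0 \<in> J" "s \<in> J" "J \<subseteq> {0..s}" "X \<in> sets (borel_PiM J)"
  shows "(\<lambda>\<omega>. restrict \<omega> J) -` X \<inter> space process_law \<in> past_cylinders s"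
  using assms unfolding past_cylinders_def by blast

lemma past_cylinder_extend:
  assumes J: "J \<subseteq> K" and X: "X \<in> sets (borel_PiM J)" and K: "K \<subseteq> {0..\<tau>}"
  obtains X' where "X' \<in> sets (borel_PiM K)"
    "(\<lambda>\<omega>. restrict \<omega> J) -` X \<inter> space process_law = (\<lambda>\<omega>. restrict \<omega> K) -` X' \<inter> space process_law"
proof
  let ?X' = "(\<lambda>\<omega>. restrict \<omega> J) -` X \<inter> space (borel_PiM K)"
  show "?X' \<in> sets (borel_PiM K)"
    by (rule measurable_sets[OF measurable_restrict_borel[OF J] X])
  have "restrict (restrict \<omega> K) J = restrict \<omega> J" for \<omega> :: "real \<Rightarrow> real"
    using J by (simp add: Int_absorb1)
  moreover have "restrict \<omega> K \<in> space (borel_PiM K)" for \<omega> :: "real \<Rightarrow> real"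
    by (simp add: space_PiM)
  ultimately show "(\<lambda>\<omega>. restrict \<omega> J) -` X \<inter> space process_law = (\<lambda>\<omega>. restrict \<omega> K) -` ?X' \<inter> space process_law"
    by auto
qed

text \<open>Two cylinders are rewritten over the union of their time sets, where only the base sets
  have to be intersected.\<close>

lemma Int_stable_past_cylinders:
  assumes s: "s \<in> {0..\<tau>}"
  shows "Int_stable (past_cylinders s)"
proof (rule Int_stableI)
  fix A B assume "A \<in> past_cylinders s" "B \<in> past_cylinders s"
  then obtain J X K Z where J: "finite J" "0 \<in> J" "s \<in> J" "J \<subseteq> {0..s}" "X \<in> sets (borel_PiM J)"
      "A = (\<lambda>\<omega>. restrict \<omega> J) -` X \<inter> space process_law"
    and K: "finite K" "0 \<in> K" "s \<in> K" "K \<subseteq> {0..s}" "Z \<in> sets (borel_PiM K)"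
      "B = (\<lambda>\<omega>. restrict \<omega> K) -` Z \<inter> space process_law"
    unfolding past_cylinders_def by blast
  have JK: "J \<union> K \<subseteq> {0..\<tau>}"
    using J(4) K(4) s by fastforce
  obtain X' where X': "X' \<in> sets (borel_PiM (J \<union> K))" "A = (\<lambda>\<omega>. restrict \<omega> (J \<union> K)) -` X' \<inter> space process_law"
    using past_cylinder_extend[OF _ J(5) JK] J(6) by (metis Un_upper1)
  obtain Z' where Z': "Z' \<in> sets (borel_PiM (J \<union> K))" "B = (\<lambda>\<omega>. restrict \<omega> (J \<union> K)) -` Z' \<inter> space process_law"
    using past_cylinder_extend[OF _ K(5) JK] K(6) by (metis Un_upper2)
  have "A \<inter> B = (\<lambda>\<omega>. restrict \<omega> (J \<union> K)) -` (X' \<inter> Z') \<inter> space process_law"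
    using X'(2) Z'(2) by auto
  then show "A \<inter> B \<in> past_cylinders s"
    using J K X' Z' past_cylindersI[of "J \<union> K" s "X' \<inter> Z'"] by auto
qed

lemma nn_integral_past_cylinder:
  assumes s: "0 \<le> s" "s < t" "t \<le> \<tau>" and A: "A \<in> sets borel" and B: "B \<in> past_cylinders s"
  shows "(\<integral>\<^sup>+\<omega>. indicator B \<omega> * indicator A (\<omega> t) \<partial>process_law)
     = (\<integral>\<^sup>+\<omega>. indicator B \<omega> * transition s t A (\<omega> s) \<partial>process_law)"
proof -
  obtain J X where J: "finite J" "0 \<in> J" "s \<in> J" "J \<subseteq> {0..s}" and X: "X \<in> sets (borel_PiM J)"
    and B_eq: "B = (\<lambda>\<omega>. restrict \<omega> J) -` X \<inter> space process_law"
    using B unfolding past_cylinders_def by blast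
  have T: "time_set J" "time_set (insert t J)"
    using J s by (auto simp: time_set_def)
  have tJ: "t \<notin> J" "\<And>j. j \<in> J \<Longrightarrow> j < t" "\<And>j. j \<in> J \<Longrightarrow> j \<le> s"
    using J(4) s by force+
  have mX: "(\<lambda>\<omega>. indicator X (restrict \<omega> J) :: ennreal) \<in> borel_measurable (borel_PiM (insert t J))"
    by (rule measurable_compose[OF measurable_restrict_borel borel_measurable_indicator[OF X]]) auto
  have comp: "(\<lambda>\<omega>. \<omega> t) \<in> borel_measurable (borel_PiM (insert t J))"
    "(\<lambda>\<omega>. \<omega> s) \<in> borel_measurable (borel_PiM J)"
    using measurable_component_singleton[of t "insert t J" "\<lambda>_. borel :: real measure"]
      measurable_component_singleton[of s J "\<lambda>_. borel :: real measure"] J(3) by simp_all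
  have f1: "(\<lambda>\<omega>. indicator X (restrict \<omega> J) * indicator A (\<omega> t) :: ennreal) \<in> borel_measurable (borel_PiM (insert t J))"
    by (intro borel_measurable_times_ennreal mX measurable_compose[OF comp(1)] borel_measurable_indicator A)
  have f1': "(\<lambda>\<omega>. indicator X (restrict \<omega> J) * indicator A (\<omega> t) :: ennreal) \<in> borel_measurable (lborel_PiM (insert t J))"
    using f1 by (simp add: measurable_cong_sets[OF sets_PiM_lborel refl])
  have f2: "(\<lambda>\<omega>. indicator X \<omega> * transition s t A (\<omega> s)) \<in> borel_measurable (borel_PiM J)"
    by (intro borel_measurable_times_ennreal measurable_compose[OF comp(2)] borel_measurable_indicator X measurable_transition s A)
  have ind: "indicator B \<omega> = (indicator X (restrict \<omega> J) :: ennreal)" if "\<omega> \<in> space process_law" for \<omega>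
    using that by (auto simp: B_eq indicator_def)
  have "(\<integral>\<^sup>+\<omega>. indicator B \<omega> * indicator A (\<omega> t) \<partial>process_law)
      = (\<integral>\<^sup>+\<omega>. indicator X (restrict (restrict \<omega> (insert t J)) J) * indicator A (restrict \<omega> (insert t J) t) \<partial>process_law)"
    by (intro nn_integral_cong) (simp add: ind Int_absorb1 subset_insertI)
  also have "\<dots> = (\<integral>\<^sup>+x. path_density (insert t J) x * (indicator X (restrict x J) * indicator A (x t)) \<partial>(lborel_PiM (insert t J)))"
    by (rule nn_integral_process_law[OF T(2) f1])
  also have "\<dots> = (\<integral>\<^sup>+x. (\<integral>\<^sup>+y. path_density (insert t J) (x(t := y)) * (indicator X (restrict (x(t := y)) J) * indicator A ((x(t := y)) t)) \<partial>lborel) \<partial>(lborel_PiM J))"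
    by (intro nn_integral_PiM_lborel_insert J tJ borel_measurable_times_ennreal measurable_path_density T f1')
  also have "\<dots> = (\<integral>\<^sup>+x. path_density J x * (indicator X x * transition s t A (x s)) \<partial>(lborel_PiM J))"
  proof (intro nn_integral_cong)
    fix x assume x: "x \<in> space (lborel_PiM J)"
    have pd: "path_density (insert t J) (x(t := y)) = path_density J x * q s t (x s) y" for y
      using path_density_insert_last[OF T(1), of t s x y] tJ J(3) by blast
    have "(\<integral>\<^sup>+y. path_density (insert t J) (x(t := y)) * (indicator X (restrict (x(t := y)) J) * indicator A ((x(t := y)) t)) \<partial>lborel)
        = (\<integral>\<^sup>+y. (path_density J x * indicator X x) * (q s t (x s) y * indicator A y) \<partial>lborel)"
      unfolding pd restrict_fun_upd_PiM[OF x tJ(1)] by (simp add: mult_ac)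
    also have "\<dots> = (path_density J x * indicator X x) * transition s t A (x s)"
      unfolding transition_def using A s
      by (intro nn_integral_cmult borel_measurable_times_ennreal measurable_q borel_measurable_indicator) auto
    finally show "(\<integral>\<^sup>+y. path_density (insert t J) (x(t := y)) * (indicator X (restrict (x(t := y)) J) * indicator A ((x(t := y)) t)) \<partial>lborel)
        = path_density J x * (indicator X x * transition s t A (x s))"
      by (simp add: mult.assoc)
  qed
  also have "\<dots> = (\<integral>\<^sup>+\<omega>. indicator X (restrict \<omega> J) * transition s t A (restrict \<omega> J s) \<partial>process_law)"
    by (rule nn_integral_process_law[OF T(1) f2, symmetric])
  also have "\<dots> = (\<integral>\<^sup>+\<omega>. indicator B \<omega> * transition s t A (\<omega> s) \<partial>process_law)"
    using J(3) by (intro nn_integral_cong) (simp add: ind)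
  finally show ?thesis .
qed

text \<open>An event at a single time r is a cylinder over {0, r, s} that imposes no condition at
  the two added times.\<close>

lemma past_algebra_sets:
  assumes s: "s \<in> {0..\<tau>}"
  shows "sets (past_algebra process_law {0..\<tau>} (\<lambda>t \<omega>. \<omega> t) s) \<subseteq> sigma_sets (space process_law) (past_cylinders s)"
    "past_cylinders s \<subseteq> sets process_law"
proof -
  let ?\<Omega> = "space process_law"
  let ?G = "{(\<lambda>\<omega>. \<omega> r) -` A \<inter> ?\<Omega> | r A. r \<in> {0..\<tau>} \<and> r \<le> s \<and> A \<in> sets (borel :: real measure)}"
  have "?G \<subseteq> past_cylinders s"
  proof safe
    fix r and A :: "real set" assume r: "r \<in> {0..\<tau>}" "r \<le> s" and A: "A \<in> sets borel"
    let ?J = "{0, r, s}"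
    let ?X = "(\<lambda>\<omega>. \<omega> r) -` A \<inter> space (borel_PiM ?J)"
    have "?X \<in> sets (borel_PiM ?J)"
      by (rule measurable_sets[OF _ A]) (simp add: measurable_component_singleton)
    moreover have "(\<lambda>\<omega>. \<omega> r) -` A \<inter> ?\<Omega> = (\<lambda>\<omega>. restrict \<omega> ?J) -` ?X \<inter> ?\<Omega>"
      by (auto simp: space_PiM)
    ultimately show "(\<lambda>\<omega>. \<omega> r) -` A \<inter> ?\<Omega> \<in> past_cylinders s"
      using past_cylindersI[of ?J s ?X] r s by auto
  qed
  moreover have "?G \<subseteq> Pow ?\<Omega>"
    by auto
  ultimately show "sets (past_algebra process_law {0..\<tau>} (\<lambda>t \<omega>. \<omega> t) s) \<subseteq> sigma_sets ?\<Omega> (past_cylinders s)"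
    unfolding past_algebra_def by (simp add: sets_measure_of sigma_sets_mono')
  show "past_cylinders s \<subseteq> sets process_law"
  proof
    fix B assume "B \<in> past_cylinders s"
    then obtain J X where "J \<subseteq> {0..s}" "X \<in> sets (borel_PiM J)" "B = (\<lambda>\<omega>. restrict \<omega> J) -` X \<inter> ?\<Omega>"
      unfolding past_cylinders_def by blast
    then show "B \<in> sets process_law"
      using s by (auto intro!: measurable_sets[OF measurable_restrict_process_law])
  qed
qed

lemma subalgebra_past_algebra:
  assumes s: "s \<in> {0..\<tau>}"
  shows "subalgebra process_law (past_algebra process_law {0..\<tau>} (\<lambda>t \<omega>. \<omega> t) s)"
    "subalgebra process_law (vimage_algebra (space process_law) (\<lambda>\<omega>. \<omega> s) borel)"
    "sets (vimage_algebra (space process_law) (\<lambda>\<omega>. \<omega> s) borel) \<subseteq> sets (past_algebra process_law {0..\<tau>} (\<lambda>t \<omega>. \<omega> t) s)"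
proof -
  let ?\<Omega> = "space process_law"
  let ?G = "{(\<lambda>\<omega>. \<omega> r) -` A \<inter> ?\<Omega> | r A. r \<in> {0..\<tau>} \<and> r \<le> s \<and> A \<in> sets (borel :: real measure)}"
  have G: "?G \<subseteq> Pow ?\<Omega>"
    by auto
  show sub: "sets (vimage_algebra ?\<Omega> (\<lambda>\<omega>. \<omega> s) borel) \<subseteq> sets (past_algebra process_law {0..\<tau>} (\<lambda>t \<omega>. \<omega> t) s)"
    unfolding past_algebra_def sets_measure_of[OF G] sets_vimage_algebra
    using s by (intro sigma_sets_mono') auto
  have "sets (past_algebra process_law {0..\<tau>} (\<lambda>t \<omega>. \<omega> t) s) \<subseteq> sets process_law"
    using past_algebra_sets[OF s] sets.sigma_sets_subset[of "past_cylinders s" process_law] by blast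
  then show "subalgebra process_law (past_algebra process_law {0..\<tau>} (\<lambda>t \<omega>. \<omega> t) s)"
    unfolding subalgebra_def by (intro conjI) (simp_all only: past_algebra_def space_measure_of[OF G])
  then show "subalgebra process_law (vimage_algebra ?\<Omega> (\<lambda>\<omega>. \<omega> s) borel)"
    using sub unfolding subalgebra_def by auto
qed

text \<open>Both sides are finite measures in \<open>B\<close> that agree on cylinders, an
  intersection-stable generator containing the whole space; Dynkin's argument extends the
  equality.\<close>

lemma nn_integral_past_algebra:
  assumes s: "0 \<le> s" "s < t" "t \<le> \<tau>" and A: "A \<in> sets borel"
    and B: "B \<in> sets (past_algebra process_law {0..\<tau>} (\<lambda>t \<omega>. \<omega> t) s)"
  shows "(\<integral>\<^sup>+\<omega>. indicator B \<omega> * indicator A (\<omega> t) \<partial>process_law)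
     = (\<integral>\<^sup>+\<omega>. indicator B \<omega> * transition s t A (\<omega> s) \<partial>process_law)"
proof -
  interpret prob_space process_law by (rule prob_space_process_law)
  let ?\<Omega> = "space process_law"
  have sI: "s \<in> {0..\<tau>}" and tI: "t \<in> {0..\<tau>}"
    using s by auto
  have mA [measurable]: "(\<lambda>\<omega>. indicator A (\<omega> t) :: ennreal) \<in> borel_measurable process_law"
    by (intro measurable_compose[OF measurable_process_component[OF tI]] borel_measurable_indicator A)
  have mT [measurable]: "(\<lambda>\<omega>. transition s t A (\<omega> s)) \<in> borel_measurable process_law"
    by (intro measurable_compose[OF measurable_process_component[OF sI]] measurable_transition s A)
  note cyl = past_algebra_sets[OF sI]
  have pow: "past_cylinders s \<subseteq> Pow ?\<Omega>"
    by (auto simp: past_cylinders_def)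
  have Omega: "?\<Omega> \<in> past_cylinders s"
  proof -
    have "(\<lambda>\<omega>. restrict \<omega> {0, s}) -` space (borel_PiM {0, s}) \<inter> ?\<Omega> = ?\<Omega>"
      by (auto simp: space_PiM)
    then show ?thesis
      using past_cylindersI[of "{0, s}" s "space (borel_PiM {0, s})"] s by auto
  qed
  have "B \<in> sigma_sets ?\<Omega> (past_cylinders s)"
    using B cyl(1) by auto
  with Int_stable_past_cylinders[OF sI] pow show ?thesis
  proof (induction rule: sigma_sets_induct_disjoint)
    case (basic B)
    then show ?case by (rule nn_integral_past_cylinder[OF s A])
  next
    case empty
    show ?case by simp
  next
    case (compl B)
    have [measurable]: "B \<in> sets process_law"
      using compl(1) sets.sigma_sets_subset[OF cyl(2)] by blast
    have split: "(\<integral>\<^sup>+\<omega>. f \<omega> \<partial>process_law) = (\<integral>\<^sup>+\<omega>. indicator B \<omega> * f \<omega> \<partial>process_law) + (\<integral>\<^sup>+\<omega>. indicator (?\<Omega> - B) \<omega> * f \<omega> \<partial>process_law)"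
      if [measurable]: "f \<in> borel_measurable process_law" for f :: "_ \<Rightarrow> ennreal"
      by (subst nn_integral_add[symmetric]) (auto intro!: nn_integral_cong simp: indicator_def)
    have total: "(\<integral>\<^sup>+\<omega>. indicator A (\<omega> t) \<partial>process_law) = (\<integral>\<^sup>+\<omega>. transition s t A (\<omega> s) \<partial>process_law)"
    proof -
      have "(\<integral>\<^sup>+\<omega>. f \<omega> \<partial>process_law) = (\<integral>\<^sup>+\<omega>. indicator ?\<Omega> \<omega> * f \<omega> \<partial>process_law)" for f :: "_ \<Rightarrow> ennreal"
        by (intro nn_integral_cong) simp
      then show ?thesis
        using nn_integral_past_cylinder[OF s A Omega] by simp
    qed
    have "(\<integral>\<^sup>+\<omega>. indicator B \<omega> * indicator A (\<omega> t) \<partial>process_law) \<le> (\<integral>\<^sup>+\<omega>. 1 \<partial>process_law)"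
      by (intro nn_integral_mono) (auto simp: indicator_def)
    \<comment> \<open>Passing to complements cancels a summand in the extended reals, which is
      legitimate only when it is finite.\<close>
    then have fin: "(\<integral>\<^sup>+\<omega>. indicator B \<omega> * indicator A (\<omega> t) \<partial>process_law) \<noteq> \<infinity>"
      by (auto simp: emeasure_space_1 top_unique)
    let ?X = "\<integral>\<^sup>+\<omega>. indicator B \<omega> * indicator A (\<omega> t) \<partial>process_law"
    have "?X + (\<integral>\<^sup>+\<omega>. indicator (?\<Omega> - B) \<omega> * indicator A (\<omega> t) \<partial>process_law)
        = ?X + (\<integral>\<^sup>+\<omega>. indicator (?\<Omega> - B) \<omega> * transition s t A (\<omega> s) \<partial>process_law)"
      using split[OF mA] split[OF mT] total compl.IH by (simp only:)
    then show ?case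
      using fin by (simp only: ennreal_add_left_cancel) simp
  next
    case (union B)
    have meas: "B i \<in> sets process_law" for i
      using union(2) sets.sigma_sets_subset[OF cyl(2)] by blast
    have sum: "(\<integral>\<^sup>+\<omega>. indicator (\<Union>i. B i) \<omega> * f \<omega> \<partial>process_law) = (\<Sum>i. \<integral>\<^sup>+\<omega>. indicator (B i) \<omega> * f \<omega> \<partial>process_law)"
      if [measurable]: "f \<in> borel_measurable process_law" for f :: "_ \<Rightarrow> ennreal"
    proof -
      have "(\<integral>\<^sup>+\<omega>. indicator (\<Union>i. B i) \<omega> * f \<omega> \<partial>process_law) = (\<integral>\<^sup>+\<omega>. (\<Sum>i. indicator (B i) \<omega> * f \<omega>) \<partial>process_law)"
        by (simp only: suminf_indicator[OF union(1), symmetric] ennreal_suminf_multc)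
      also have "\<dots> = (\<Sum>i. \<integral>\<^sup>+\<omega>. indicator (B i) \<omega> * f \<omega> \<partial>process_law)"
        by (intro nn_integral_suminf borel_measurable_times_ennreal borel_measurable_indicator meas that)
      finally show ?thesis .
    qed
    show ?case
      unfolding sum[OF mA] sum[OF mT] union.IH ..
  qed
qed

text \<open>A single function of the present state is a version of both conditional expectations: it
  is measurable for the smaller sigma-algebra and has the right integrals over the sets of the
  larger one.\<close>

theorem markov_process_law: "markov_process process_law {0..\<tau>} (\<lambda>t \<omega>. \<omega> t)"
  unfolding markov_process_def
proof (intro conjI ballI impI)
  show "prob_space process_law"
    by (rule prob_space_process_law)
  then interpret prob_space process_law .
  show "(\<lambda>\<omega>. \<omega> t) \<in> borel_measurable process_law" if "t \<in> {0..\<tau>}" for t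
    by (rule measurable_process_component[OF that])
  fix s t :: real and A :: "real set"
  assume s: "s \<in> {0..\<tau>}" and t: "t \<in> {0..\<tau>}" and st: "s \<le> t" and A: "A \<in> sets borel"
  let ?F = "past_algebra process_law {0..\<tau>} (\<lambda>t \<omega>. \<omega> t) s"
  let ?G = "vimage_algebra (space process_law) (\<lambda>\<omega>. \<omega> s) (borel :: real measure)"
  note sub = subalgebra_past_algebra[OF s]
  interpret F: sigma_finite_subalgebra process_law ?F
    by (intro finite_measure_subalgebra_is_sigma_finite finite_measure_subalgebra.intro finite_measure_axioms
        finite_measure_subalgebra_axioms.intro sub)
  interpret G: sigma_finite_subalgebra process_law ?G
    by (intro finite_measure_subalgebra_is_sigma_finite finite_measure_subalgebra.intro finite_measure_axioms
        finite_measure_subalgebra_axioms.intro sub)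
  let ?f = "\<lambda>\<omega>. indicator A (\<omega> t) :: real"
  have mf [measurable]: "?f \<in> borel_measurable process_law"
    by (intro measurable_compose[OF measurable_process_component[OF t]] borel_measurable_indicator A)
  have intf: "integrable process_law ?f"
    by (rule integrable_const_bound[of _ 1]) (auto simp: mf)
  \<comment> \<open>The case s = t is separate because the transition law is then a point mass and
    has no density.\<close>
  define g where "g x = (if s = t then indicator A x else enn2real (transition s t A x))" for x
  have mg: "g \<in> borel_measurable borel"
  proof (cases "s = t")
    case True
    then show ?thesis using A by (simp add: g_def[abs_def])
  next
    case False
    then have "0 \<le> s" "s < t" "t \<le> \<tau>"
      using s t st by auto
    then show ?thesis
      using False measurable_transition[OF _ _ _ A, of s t] by (simp add: g_def[abs_def])
  qed
  have mgG: "(\<lambda>\<omega>. g (\<omega> s)) \<in> borel_measurable ?G"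
    by (rule measurable_compose[OF _ mg]) (auto intro!: measurable_vimage_algebra1 simp: space_process_law)
  have mgF: "(\<lambda>\<omega>. g (\<omega> s)) \<in> borel_measurable ?F"
    by (rule measurable_from_subalg[OF _ mgG]) (use sub in \<open>auto simp: subalgebra_def\<close>)
  have mgM [measurable]: "(\<lambda>\<omega>. g (\<omega> s)) \<in> borel_measurable process_law"
    by (rule measurable_from_subalg[OF sub(2) mgG])
  have gb: "0 \<le> g x" "g x \<le> 1" for x
  proof -
    show "0 \<le> g x" by (simp add: g_def)
    show "g x \<le> 1"
    proof (cases "s = t")
      case False
      then have "0 \<le> s" "s < t" "t \<le> \<tau>"
        using s t st by auto
      then have "enn2real (transition s t A x) \<le> enn2real 1"
        by (intro enn2real_mono transition_le_1) auto
      then show ?thesis using False by (simp add: g_def)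
    qed (simp add: g_def)
  qed
  have intg: "integrable process_law (\<lambda>\<omega>. g (\<omega> s))"
    by (rule integrable_const_bound[of _ 1]) (auto simp: gb mgM)
  have key: "(LINT \<omega>:B|process_law. ?f \<omega>) = (LINT \<omega>:B|process_law. g (\<omega> s))" if B: "B \<in> sets ?F" for B
  proof (cases "s = t")
    case True
    then show ?thesis by (simp add: g_def)
  next
    case False
    then have st': "0 \<le> s" "s < t" "t \<le> \<tau>"
      using s t st by auto
    have BM [measurable]: "B \<in> sets process_law"
      using B sub(1) by (auto simp: subalgebra_def)
    have e: "ennreal (g x) = transition s t A x" for x
      using False transition_le_1[OF st', of A x]
      by (simp add: g_def) (metis ennreal_enn2real_if ennreal_one_less_top order_le_less_trans less_irrefl top.not_eq_extremum)
    have "(LINT \<omega>:B|process_law. ?f \<omega>) = enn2real (\<integral>\<^sup>+\<omega>. indicator B \<omega> * indicator A (\<omega> t) \<partial>process_law)"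
      unfolding set_lebesgue_integral_def
      by (subst integral_eq_nn_integral) (auto simp: ennreal_mult ennreal_indicator)
    also have "\<dots> = enn2real (\<integral>\<^sup>+\<omega>. indicator B \<omega> * transition s t A (\<omega> s) \<partial>process_law)"
      by (simp only: nn_integral_past_algebra[OF st' A B])
    also have "\<dots> = (LINT \<omega>:B|process_law. g (\<omega> s))"
      unfolding set_lebesgue_integral_def e[symmetric]
      by (subst integral_eq_nn_integral) (auto simp: gb indicator_def intro!: arg_cong[where f = enn2real] nn_integral_cong)
    finally show ?thesis .
  qed
  have "AE \<omega> in process_law. real_cond_exp process_law ?F ?f \<omega> = g (\<omega> s)"
    by (rule F.real_cond_exp_charact[OF key intf intg mgF])
  moreover have "AE \<omega> in process_law. real_cond_exp process_law ?G ?f \<omega> = g (\<omega> s)"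
    by (rule G.real_cond_exp_charact[OF key intf intg mgG]) (use sub(3) in blast)
  ultimately show "AE \<omega> in process_law. real_cond_exp process_law ?F ?f \<omega> = real_cond_exp process_law ?G ?f \<omega>"
    by eventually_elim simp
qed

text \<open>Passage from sets of times to increasing sequences: \<open>t\<close> is a bijection onto
  its range that carries the index k - 1 to the predecessor of \<open>t k\<close>.\<close>

theorem distr_process_law_increasing:
  fixes n :: nat and t :: "nat \<Rightarrow> real"
  assumes t0: "t 0 = 0" and tn: "t n \<le> \<tau>" and mono: "\<And>k. k < n \<Longrightarrow> t k < t (Suc k)"
  shows "(\<lambda>\<omega>. \<lambda>k\<in>{..n}. \<omega> (t k)) \<in> measurable process_law (\<Pi>\<^sub>M k\<in>{..n}. lborel)"
    "distr process_law (\<Pi>\<^sub>M k\<in>{..n}. lborel) (\<lambda>\<omega>. \<lambda>k\<in>{..n}. \<omega> (t k))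
      = density (\<Pi>\<^sub>M k\<in>{..n}. lborel) (\<lambda>x. \<pi> (x 0) * (\<Prod>k = 1..n. q (t (k - 1)) (t k) (x (k - 1)) (x k)))"
proof -
  let ?J = "t ` {..n}"
  let ?L = "\<Pi>\<^sub>M k\<in>{..n}. (lborel :: real measure)"
  let ?R = "\<lambda>\<omega>. \<lambda>k\<in>{..n}. \<omega> (t k)"
  have less: "t i < t j" if "i < j" "j \<le> n" for i j
    using that
  proof (induction j)
    case (Suc j)
    then show ?case
      using mono[of j] by (cases "i = j") (auto intro: less_trans)
  qed simp
  have le: "t i \<le> t j" if "i \<le> j" "j \<le> n" for i j
    using less[of i j] that by (cases "i = j") auto
  have inj: "inj_on t {..n}"
  proof (rule inj_onI)
    fix i j assume "i \<in> {..n}" "j \<in> {..n}" "t i = t j"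
    then show "i = j"
      using less[of i j] less[of j i] by (cases i j rule: linorder_cases) auto
  qed
  have range: "0 \<le> t k" "t k \<le> \<tau>" if "k \<le> n" for k
    using le[of 0 k] le[of k n] that t0 tn by auto
  have T: "time_set ?J"
    using range t0 by (auto simp: time_set_def intro: image_eqI[of _ _ 0])
  have Rm: "?R \<in> measurable (borel_PiM ?J) ?L"
    by (rule measurable_restrict) (simp add: measurable_component_singleton)
  have Rm': "?R \<in> measurable (lborel_PiM ?J) ?L"
    by (rule measurable_restrict) (simp add: measurable_component_singleton)
  have Jsub: "?J \<subseteq> {0..\<tau>}"
    using T by (simp add: time_set_def)
  have R_restrict: "?R (restrict \<omega> ?J) = ?R \<omega>" for \<omega> :: "real \<Rightarrow> real"
    by (auto simp: restrict_def)
  have "(\<lambda>\<omega>. ?R (restrict \<omega> ?J)) \<in> measurable process_law ?L"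
    by (rule measurable_compose[OF measurable_restrict_process_law[OF Jsub] Rm])
  then show meas: "?R \<in> measurable process_law ?L"
    unfolding R_restrict .
  have pd: "path_density ?J x = \<pi> (?R x 0) * (\<Prod>k = 1..n. q (t (k - 1)) (t k) (?R x (k - 1)) (?R x k))" for x
  proof -
    have J0: "?J - {0} = t ` {1..n}"
    proof -
      have "t k \<noteq> 0" if "1 \<le> k" "k \<le> n" for k
        using less[of 0 k] that t0 by auto
      moreover have "{..n} = insert 0 {1..n}"
        by auto
      ultimately show ?thesis
        using t0 by (auto simp del: atMost_iff)
    qed
    have prec: "preceding ?J (t k) = t (k - 1)" if "k \<in> {1..n}" for k
    proof (rule preceding_eqI)
      show "t (k - 1) < t k"
        using that less[of "k - 1" k] by auto
      fix l assume "l \<in> ?J" "l < t k"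
      then obtain i where i: "i \<le> n" "l = t i" "t i < t k" by auto
      then have "i < k"
        using le[of k i] by (cases "k \<le> i") auto
      then show "l \<le> t (k - 1)"
        using le[of i "k - 1"] that i by auto
    qed (use that in auto)
    have "inj_on t {1..n}"
      by (rule inj_on_subset[OF inj]) auto
    then have "(\<Prod>j\<in>?J - {0}. q (preceding ?J j) j (x (preceding ?J j)) (x j))
        = (\<Prod>k\<in>{1..n}. q (preceding ?J (t k)) (t k) (x (preceding ?J (t k))) (x (t k)))"
      unfolding J0 by (simp add: prod.reindex)
    also have "\<dots> = (\<Prod>k = 1..n. q (t (k - 1)) (t k) (?R x (k - 1)) (?R x k))"
      by (intro prod.cong refl) (auto simp: prec)
    finally show ?thesis
      by (simp add: path_density_def t0)
  qed
  let ?g = "\<lambda>x. \<pi> (x 0) * (\<Prod>k = 1..n. q (t (k - 1)) (t k) (x (k - 1)) (x k))"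
  have comp: "(\<lambda>x. x i) \<in> borel_measurable ?L" if "i \<le> n" for i
    using measurable_component_singleton[of i "{..n}" "\<lambda>_. lborel :: real measure"] that by simp
  have gm: "?g \<in> borel_measurable ?L"
  proof (intro borel_measurable_times_ennreal borel_measurable_prod_ennreal measurable_compose[OF comp pi_measurable])
    fix k assume "k \<in> {1..n}"
    then have "k \<le> n" "k - 1 \<le> n" "k - 1 < k"
      by auto
    then show "(\<lambda>x. q (t (k - 1)) (t k) (x (k - 1)) (x k)) \<in> borel_measurable ?L"
      by (intro measurable_q range less comp)
  qed simp
  \<comment> \<open>Renaming coordinates along the injective \<open>t\<close> preserves product
    Lebesgue measure, as is seen on boxes.\<close>
  have reindex: "distr (lborel_PiM ?J) ?L ?R = ?L"
  proof -
    interpret product_sigma_finite "\<lambda>_ :: nat. lborel :: real measure" ..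
    interpret J: product_sigma_finite "\<lambda>_ :: real. lborel :: real measure" ..
    show ?thesis
    proof (rule PiM_eqI)
      fix A :: "nat \<Rightarrow> real set" assume A: "\<And>i. i \<in> {..n} \<Longrightarrow> A i \<in> sets lborel"
      let ?A = "\<lambda>j. A (the_inv_into {..n} t j)"
      have "?R -` Pi\<^sub>E {..n} A \<inter> space (lborel_PiM ?J) = Pi\<^sub>E ?J ?A"
        by (auto simp: space_PiM PiE_iff the_inv_into_f_f[OF inj])
      moreover have "emeasure (lborel_PiM ?J) (Pi\<^sub>E ?J ?A) = (\<Prod>j\<in>?J. emeasure lborel (?A j))"
        using A by (intro J.emeasure_PiM) (auto simp: the_inv_into_f_f[OF inj])
      moreover have "\<dots> = (\<Prod>i\<in>{..n}. emeasure lborel (A i))"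
        by (subst prod.reindex[OF inj]) (simp add: the_inv_into_f_f[OF inj])
      ultimately show "emeasure (distr (lborel_PiM ?J) ?L ?R) (Pi\<^sub>E {..n} A) = (\<Prod>i\<in>{..n}. emeasure lborel (A i))"
        using A by (subst emeasure_distr[OF Rm']) (auto intro!: sets_PiM_I_finite)
    qed auto
  qed
  have "distr process_law ?L ?R = distr (restrict_law ?J process_law) ?L ?R"
    by (subst distr_distr[OF Rm measurable_restrict_process_law[OF Jsub]]) (simp only: o_def R_restrict)
  also have "\<dots> = distr (density (lborel_PiM ?J) (\<lambda>x. ?g (?R x))) ?L ?R"
    unfolding distr_process_law[OF T] path_measure_def pd ..
  also have "\<dots> = density (distr (lborel_PiM ?J) ?L ?R) ?g"
    by (rule density_distr[OF gm Rm', symmetric])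
  finally show "distr process_law ?L ?R = density ?L ?g"
    unfolding reindex .
qed

end

section \<open>The transformed process\<close>

lemma measurable_yak_kernel_pair:
  assumes "0 < t"
  shows "(\<lambda>(x, y). yakubovich_kernel t x y) \<in> borel_measurable (borel \<Otimes>\<^sub>M borel)"
proof -
  have "(\<lambda>p. yakubovich_kernel t (fst p) (snd p)) \<in> borel_measurable (borel \<Otimes>\<^sub>M borel)"
    by (rule measurable_yak_kernel[OF assms]) measurable
  then show ?thesis
    by (simp add: case_prod_unfold)
qed

text \<open>The kernel \<open>p\<^sub>\<tau>\<^sub>-\<^sub>s\<close> applied to \<open>e\<^sup>a\<^sup>y\<close>; its limit case \<open>s = \<tau>\<close> is set by hand because \<open>p\<^sub>0\<close> is a delta function.\<close>

definition space_time_harmonic :: "real \<Rightarrow> real \<Rightarrow> real \<Rightarrow> real \<Rightarrow> real" where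
  "space_time_harmonic \<tau> a s x =
     (if s < \<tau> then enn2real (\<integral>\<^sup>+y. yakubovich_kernel (\<tau> - s) x y * exp (a * y) \<partial>lborel) else exp (a * x))"

lemma space_time_harmonic_end: "space_time_harmonic \<tau> a \<tau> x = exp (a * x)"
  by (simp add: space_time_harmonic_def)

lemma ennreal_space_time_harmonic:
  assumes "s < \<tau>"
  shows "ennreal (space_time_harmonic \<tau> a s x) = (\<integral>\<^sup>+y. yakubovich_kernel (\<tau> - s) x y * exp (a * y) \<partial>lborel)"
  using yak_kernel_exp_moment_finite[of "\<tau> - s" x a] assms by (simp add: space_time_harmonic_def)

lemma space_time_harmonic_pos: "0 < space_time_harmonic \<tau> a s x"
proof (cases "s < \<tau>")
  case True
  then have "0 < ennreal (space_time_harmonic \<tau> a s x)"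
    using yak_kernel_exp_moment_pos[of "\<tau> - s" x a] by (simp add: ennreal_space_time_harmonic)
  then show ?thesis by simp
qed (simp add: space_time_harmonic_def)

lemma measurable_space_time_harmonic [measurable]:
  "space_time_harmonic \<tau> a s \<in> borel_measurable borel"
proof (cases "s < \<tau>")
  case True
  then have [measurable]: "(\<lambda>(x, y). yakubovich_kernel (\<tau> - s) x y) \<in> borel_measurable (borel \<Otimes>\<^sub>M borel)"
    by (intro measurable_yak_kernel_pair) simp
  have "(\<lambda>x. enn2real (\<integral>\<^sup>+y. (\<lambda>(x, y). yakubovich_kernel (\<tau> - s) x y) (x, y) * exp (a * y) \<partial>lborel)) \<in> borel_measurable borel"
    by measurable
  then show ?thesis
    using True by (simp add: space_time_harmonic_def[abs_def])
qed (simp add: space_time_harmonic_def[abs_def])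

text \<open>Chapman-Kolmogorov integrated against e^{az}; at t = \<tau> it is the
  definition.\<close>

lemma space_time_harmonic_step:
  assumes "s < t" "t \<le> \<tau>"
  shows "(\<integral>\<^sup>+y. ennreal (yakubovich_kernel (t - s) x y) * ennreal (space_time_harmonic \<tau> a t y) \<partial>lborel)
     = space_time_harmonic \<tau> a s x"
proof (cases "t = \<tau>")
  case True
  then show ?thesis
    using assms by (simp add: space_time_harmonic_end ennreal_space_time_harmonic ennreal_mult yak_kernel_nonneg)
next
  case False
  then have t: "0 < t - s" "0 < \<tau> - t" "t < \<tau>" "s < \<tau>"
    using assms by auto
  let ?k = "yakubovich_kernel (t - s)" and ?l = "yakubovich_kernel (\<tau> - t)"
  note [measurable] = measurable_yak_kernel_pair[OF t(1)] measurable_yak_kernel_pair[OF t(2)]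
    measurable_yak_kernel_right[OF t(1)] measurable_yak_kernel_right[OF t(2)]
  have m: "(\<lambda>(z, y). ennreal (?k x y) * (ennreal (?l y z) * ennreal (exp (a * z)))) \<in> borel_measurable (lborel \<Otimes>\<^sub>M lborel)"
    by measurable
  have "(\<integral>\<^sup>+y. ennreal (?k x y) * ennreal (space_time_harmonic \<tau> a t y) \<partial>lborel)
      = (\<integral>\<^sup>+y. (\<integral>\<^sup>+z. ennreal (?k x y) * (ennreal (?l y z) * ennreal (exp (a * z))) \<partial>lborel) \<partial>lborel)"
    unfolding ennreal_space_time_harmonic[OF t(3)]
    by (subst nn_integral_cmult) (auto simp: ennreal_mult yak_kernel_nonneg[OF t(2)])
  also have "\<dots> = (\<integral>\<^sup>+z. (\<integral>\<^sup>+y. ennreal (?k x y) * (ennreal (?l y z) * ennreal (exp (a * z))) \<partial>lborel) \<partial>lborel)"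
    by (rule lborel_pair.Fubini'[OF m])
  also have "\<dots> = (\<integral>\<^sup>+z. yakubovich_kernel (\<tau> - s) x z * exp (a * z) \<partial>lborel)"
  proof (intro nn_integral_cong)
    fix z
    have [measurable]: "(\<lambda>y. ?l y z) \<in> borel_measurable borel"
      by (subst yak_kernel_sym) (rule measurable_yak_kernel_right[OF t(2)])
    have "(\<integral>\<^sup>+y. ennreal (?k x y) * (ennreal (?l y z) * ennreal (exp (a * z))) \<partial>lborel)
        = (\<integral>\<^sup>+y. (ennreal (?k x y) * ennreal (?l y z)) * ennreal (exp (a * z)) \<partial>lborel)"
      by (simp only: mult.assoc)
    also have "\<dots> = (\<integral>\<^sup>+y. ennreal (?k x y) * ennreal (?l y z) \<partial>lborel) * ennreal (exp (a * z))"
      by (rule nn_integral_multc) measurable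
    also have "\<dots> = ennreal (yakubovich_kernel (\<tau> - s) x z * exp (a * z))"
      using yak_kernel_chapman_kolmogorov[OF t(1,2), of x z] t by (simp add: ennreal_mult yak_kernel_nonneg)
    finally show "(\<integral>\<^sup>+y. ennreal (?k x y) * (ennreal (?l y z) * ennreal (exp (a * z))) \<partial>lborel)
        = ennreal (yakubovich_kernel (\<tau> - s) x z * exp (a * z))" .
  qed
  finally show ?thesis
    by (simp add: ennreal_space_time_harmonic[OF t(4)])
qed

text \<open>The constant C as an extended nonnegative integral, where finiteness is a genuine
  statement; the Bochner integral \<open>norm_const\<close> would silently be 0 if it
  diverged.\<close>

definition partition_mass :: "real \<Rightarrow> real \<Rightarrow> real \<Rightarrow> ennreal" where
  "partition_mass \<tau> a c = (\<integral>\<^sup>+x. ennreal (exp (c * x)) * ennreal (space_time_harmonic \<tau> a 0 x) \<partial>lborel)"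

lemma partition_mass_finite:
  assumes "0 < \<tau>" "0 < a + c"
  shows "partition_mass \<tau> a c < \<infinity>"
  unfolding partition_mass_def ennreal_space_time_harmonic[OF assms(1)]
  using yak_kernel_two_sided_moment_finite[OF assms(1), of c a] assms(2) by (simp add: add.commute)

lemma partition_mass_pos: "0 < partition_mass \<tau> a c"
proof -
  have "partition_mass \<tau> a c \<noteq> 0"
  proof
    assume "partition_mass \<tau> a c = 0"
    then have "AE x in (lborel :: real measure). False"
      unfolding partition_mass_def
      by (subst (asm) nn_integral_0_iff_AE) (auto elim!: eventually_mono simp: ennreal_eq_0_iff space_time_harmonic_pos[unfolded not_le[symmetric]] simp flip: ennreal_mult)
    then show False
      by (simp add: AE_iff_measurable[OF _ refl])
  qed
  then show ?thesis
    by (simp add: zero_less_iff_neq_zero)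
qed

lemma integrable_yak_kernel_exp_pair:
  assumes t: "0 < t" and ac: "0 < a + c"
  shows "integrable (lborel \<Otimes>\<^sub>M lborel) (\<lambda>(x, y). exp (a * x + c * y) * yakubovich_kernel t x y)"
proof -
  note [measurable] = measurable_yak_kernel_pair[OF t] measurable_yak_kernel_right[OF t]
  have m: "(\<lambda>(x, y). exp (a * x + c * y) * (\<lambda>(x, y). yakubovich_kernel t x y) (x, y)) \<in> borel_measurable (lborel \<Otimes>\<^sub>M lborel)"
    by measurable
  show ?thesis
  proof (rule integrableI_nonneg)
    show meas: "(\<lambda>(x, y). exp (a * x + c * y) * yakubovich_kernel t x y) \<in> borel_measurable (lborel \<Otimes>\<^sub>M lborel)"
      using m by simp
    show "AE p in lborel \<Otimes>\<^sub>M lborel. 0 \<le> (case p of (x, y) \<Rightarrow> exp (a * x + c * y) * yakubovich_kernel t x y)"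
      using yak_kernel_nonneg[OF t] by auto
    have "(\<integral>\<^sup>+p. ennreal (case p of (x, y) \<Rightarrow> exp (a * x + c * y) * yakubovich_kernel t x y) \<partial>(lborel \<Otimes>\<^sub>M lborel))
        = (\<integral>\<^sup>+x. (\<integral>\<^sup>+y. ennreal (exp (a * x + c * y) * yakubovich_kernel t x y) \<partial>lborel) \<partial>lborel)"
      using meas by (subst lborel.nn_integral_fst[symmetric]) auto
    also have "\<dots> = (\<integral>\<^sup>+x. exp (a * x) * (\<integral>\<^sup>+y. yakubovich_kernel t x y * exp (c * y) \<partial>lborel) \<partial>lborel)"
      by (subst nn_integral_cmult[symmetric])
         (auto intro!: nn_integral_cong simp: exp_add mult_ac yak_kernel_nonneg[OF t] simp flip: ennreal_mult)
    also have "\<dots> < \<infinity>"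
      by (rule yak_kernel_two_sided_moment_finite[OF t ac])
    finally show "(\<integral>\<^sup>+p. ennreal (case p of (x, y) \<Rightarrow> exp (a * x + c * y) * yakubovich_kernel t x y) \<partial>(lborel \<Otimes>\<^sub>M lborel)) < \<infinity>" .
  qed
qed

text \<open>\<open>norm_const\<close> integrates the first argument of the kernel on the inside,
  \<open>space_time_harmonic\<close> the second; symmetry of the kernel reconciles them.\<close>

lemma norm_const_eq:
  assumes \<tau>: "0 < \<tau>" and ac: "0 < a + c"
  shows "norm_const \<tau> a c = enn2real (partition_mass \<tau> a c)"
proof -
  have inner: "(LBINT x. exp (a * x + c * y) * yakubovich_kernel \<tau> x y) = exp (c * y) * space_time_harmonic \<tau> a 0 y" for y
  proof -
    have "(LBINT x. exp (a * x + c * y) * yakubovich_kernel \<tau> x y)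
        = exp (c * y) * (LBINT x. yakubovich_kernel \<tau> y x * exp (a * x))"
      by (simp add: exp_add yak_kernel_sym[of \<tau> _ y] mult_ac flip: integral_mult_right_zero)
    also have "(LBINT x. yakubovich_kernel \<tau> y x * exp (a * x)) = space_time_harmonic \<tau> a 0 y"
      using \<tau> measurable_yak_kernel_right[OF \<tau>, of y]
      by (subst integral_eq_nn_integral) (auto simp: space_time_harmonic_def yak_kernel_nonneg)
    finally show ?thesis .
  qed
  show ?thesis
    unfolding norm_const_def inner partition_mass_def
    by (subst integral_eq_nn_integral)
       (auto simp: less_imp_le[OF space_time_harmonic_pos] ennreal_mult)
qed

section \<open>Densities of the h-transform\<close>

definition initial_density :: "real \<Rightarrow> real \<Rightarrow> real \<Rightarrow> real \<Rightarrow> real" where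
  "initial_density \<tau> a c x = exp (c * x) * space_time_harmonic \<tau> a 0 x / norm_const \<tau> a c"

definition transition_density :: "real \<Rightarrow> real \<Rightarrow> real \<Rightarrow> real \<Rightarrow> real \<Rightarrow> real \<Rightarrow> real" where
  "transition_density \<tau> a s t x y =
     yakubovich_kernel (t - s) x y * space_time_harmonic \<tau> a t y / space_time_harmonic \<tau> a s x"

lemma norm_const_pos:
  assumes \<tau>: "0 < \<tau>" and ac: "0 < a + c"
  shows "0 < norm_const \<tau> a c"
  using partition_mass_finite[OF assms] partition_mass_pos[of \<tau> a c]
  by (simp add: norm_const_eq[OF assms] enn2real_positive_iff)

lemma transition_density_nonneg: "s < t \<Longrightarrow> 0 \<le> transition_density \<tau> a s t x y"
  unfolding transition_density_def
  by (intro divide_nonneg_pos mult_nonneg_nonneg yak_kernel_nonneg less_imp_le[OF space_time_harmonic_pos] space_time_harmonic_pos) simp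

text \<open>The initial mass is 1 by the choice of C, and the transition mass by harmonicity. In the
  composition law the harmonic factors at the intermediate time cancel and Chapman-Kolmogorov
  remains.\<close>

lemma markov_densities_yak:
  assumes \<tau>: "0 < \<tau>" and ac: "0 < a + c"
  shows "markov_densities \<tau> (\<lambda>x. ennreal (initial_density \<tau> a c x)) (\<lambda>s t x y. ennreal (transition_density \<tau> a s t x y))"
proof
  let ?h = "space_time_harmonic \<tau> a"
  note hpos = space_time_harmonic_pos[of \<tau> a] and C = norm_const_pos[OF assms]
  show "0 \<le> \<tau>" using \<tau> by simp
  show "(\<lambda>x. ennreal (initial_density \<tau> a c x)) \<in> borel_measurable borel"
    unfolding initial_density_def by measurable
  have C': "ennreal (norm_const \<tau> a c) = partition_mass \<tau> a c"
    using partition_mass_finite[OF assms] by (simp add: norm_const_eq[OF assms])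
  have "(\<integral>\<^sup>+x. ennreal (initial_density \<tau> a c x) \<partial>lborel)
      = (\<integral>\<^sup>+x. ennreal (exp (c * x)) * ennreal (?h 0 x) * ennreal (1 / norm_const \<tau> a c) \<partial>lborel)"
    using C hpos by (intro nn_integral_cong) (simp add: initial_density_def less_imp_le flip: ennreal_mult)
  also have "\<dots> = partition_mass \<tau> a c * ennreal (1 / norm_const \<tau> a c)"
    unfolding partition_mass_def by (rule nn_integral_multc) measurable
  also have "\<dots> = 1"
    unfolding C'[symmetric] using C by (simp flip: ennreal_mult)
  finally show "(\<integral>\<^sup>+x. ennreal (initial_density \<tau> a c x) \<partial>lborel) = 1" .
next
  fix s t :: real assume st: "0 \<le> s" "s < t" "t \<le> \<tau>"
  then have [measurable]: "(\<lambda>(x, y). yakubovich_kernel (t - s) x y) \<in> borel_measurable (borel \<Otimes>\<^sub>M borel)"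
    by (intro measurable_yak_kernel_pair) simp
  have "(\<lambda>p. ennreal ((\<lambda>(x, y). yakubovich_kernel (t - s) x y) (fst p, snd p) * space_time_harmonic \<tau> a t (snd p) / space_time_harmonic \<tau> a s (fst p)))
      \<in> borel_measurable (borel \<Otimes>\<^sub>M borel)"
    by measurable
  then show "(\<lambda>(x, y). ennreal (transition_density \<tau> a s t x y)) \<in> borel_measurable (borel \<Otimes>\<^sub>M borel)"
    by (simp add: transition_density_def case_prod_unfold)
next
  let ?h = "space_time_harmonic \<tau> a"
  note hpos = space_time_harmonic_pos[of \<tau> a]
  fix s t x :: real assume st: "0 \<le> s" "s < t" "t \<le> \<tau>"
  then have p: "0 < t - s" by simp
  note [measurable] = measurable_yak_kernel_right[OF p]
  have "(\<integral>\<^sup>+y. ennreal (transition_density \<tau> a s t x y) \<partial>lborel)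
      = (\<integral>\<^sup>+y. ennreal (yakubovich_kernel (t - s) x y) * ennreal (?h t y) * ennreal (1 / ?h s x) \<partial>lborel)"
    using hpos yak_kernel_nonneg[OF p]
    by (intro nn_integral_cong) (simp add: transition_density_def less_imp_le flip: ennreal_mult)
  also have "\<dots> = (\<integral>\<^sup>+y. ennreal (yakubovich_kernel (t - s) x y) * ennreal (?h t y) \<partial>lborel) * ennreal (1 / ?h s x)"
    by (rule nn_integral_multc) measurable
  also have "\<dots> = 1"
    unfolding space_time_harmonic_step[OF st(2,3)] using hpos[of s x] by (simp flip: ennreal_mult)
  finally show "(\<integral>\<^sup>+y. ennreal (transition_density \<tau> a s t x y) \<partial>lborel) = 1" .
next
  let ?h = "space_time_harmonic \<tau> a"
  note hpos = space_time_harmonic_pos[of \<tau> a]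
  fix r s t x z :: real assume rst: "0 \<le> r" "r < s" "s < t" "t \<le> \<tau>"
  then have p: "0 < s - r" "0 < t - s" "0 < t - r" by simp_all
  let ?k = "yakubovich_kernel (s - r)" and ?l = "yakubovich_kernel (t - s)"
  have [measurable]: "?k x \<in> borel_measurable borel" "(\<lambda>y. ?l y z) \<in> borel_measurable borel"
    using measurable_yak_kernel_right[OF p(1)] measurable_yak_kernel_right[OF p(2), of z] by (simp_all add: yak_kernel_sym[of _ _ z])
  have "(\<integral>\<^sup>+y. ennreal (transition_density \<tau> a r s x y) * ennreal (transition_density \<tau> a s t y z) \<partial>lborel)
      = (\<integral>\<^sup>+y. ennreal (?k x y) * ennreal (?l y z) * ennreal (?h t z / ?h r x) \<partial>lborel)"
  proof (intro nn_integral_cong)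
    fix y
    have "transition_density \<tau> a r s x y * transition_density \<tau> a s t y z = ?k x y * ?l y z * (?h t z / ?h r x)"
      using hpos[of s y] hpos[of r x] by (simp add: transition_density_def field_simps)
    moreover have "0 \<le> transition_density \<tau> a r s x y" "0 \<le> transition_density \<tau> a s t y z"
      using rst by (simp_all add: transition_density_nonneg)
    ultimately show "ennreal (transition_density \<tau> a r s x y) * ennreal (transition_density \<tau> a s t y z)
        = ennreal (?k x y) * ennreal (?l y z) * ennreal (?h t z / ?h r x)"
      using yak_kernel_nonneg[OF p(1)] yak_kernel_nonneg[OF p(2)] hpos[of t z] hpos[of r x]
      by (simp add: less_imp_le flip: ennreal_mult)
  qed
  also have "\<dots> = (\<integral>\<^sup>+y. ennreal (?k x y) * ennreal (?l y z) \<partial>lborel) * ennreal (?h t z / ?h r x)"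
    by (rule nn_integral_multc) measurable
  also have "\<dots> = ennreal (transition_density \<tau> a r t x z)"
    using yak_kernel_chapman_kolmogorov[OF p(1,2), of x z] hpos[of t z] hpos[of r x] yak_kernel_nonneg[OF p(3), of x z]
    by (simp add: transition_density_def less_imp_le flip: ennreal_mult)
  finally show "(\<integral>\<^sup>+y. ennreal (transition_density \<tau> a r s x y) * ennreal (transition_density \<tau> a s t y z) \<partial>lborel)
      = ennreal (transition_density \<tau> a r t x z)" .
qed

text \<open>The space-time harmonic factors telescope, leaving only the boundary weights.\<close>

lemma fdd_density_eq:
  assumes ac: "0 < \<tau>" "0 < a + c" and t: "t 0 = 0" "t (d + 1) = \<tau>" "\<forall>k\<le>d. t k < t (k + 1)"
  shows "ennreal (initial_density \<tau> a c (x 0)) *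
      (\<Prod>k = 1..d + 1. ennreal (transition_density \<tau> a (t (k - 1)) (t k) (x (k - 1)) (x k))) = ennreal (fdd_density \<tau> a c d t x)"
    "0 \<le> fdd_density \<tau> a c d t x"
proof -
  let ?h = "space_time_harmonic \<tau> a"
  note hpos = space_time_harmonic_pos[of \<tau> a] and C = norm_const_pos[OF ac]
  have less: "t (k - 1) < t k" if "k \<in> {1..d + 1}" for k
    using t(3)[rule_format, of "k - 1"] that by auto
  have prod: "?h (t 0) (x 0) * (\<Prod>k = 1..n. transition_density \<tau> a (t (k - 1)) (t k) (x (k - 1)) (x k))
      = (\<Prod>k = 1..n. yakubovich_kernel (t k - t (k - 1)) (x (k - 1)) (x k)) * ?h (t n) (x n)" for n
  proof (induction n)
    case (Suc n)
    then show ?case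
      using hpos[of "t n" "x n"] by (simp add: transition_density_def field_simps)
  qed simp
  have "initial_density \<tau> a c (x 0) * (\<Prod>k = 1..d + 1. transition_density \<tau> a (t (k - 1)) (t k) (x (k - 1)) (x k))
      = 1 / norm_const \<tau> a c * exp (c * x 0) * (?h (t 0) (x 0) * (\<Prod>k = 1..d + 1. transition_density \<tau> a (t (k - 1)) (t k) (x (k - 1)) (x k)))"
    by (simp add: initial_density_def t(1))
  also have "\<dots> = fdd_density \<tau> a c d t x"
    unfolding prod t(2) by (simp add: fdd_density_def space_time_harmonic_end exp_add mult_ac)
  finally have eq: "initial_density \<tau> a c (x 0) * (\<Prod>k = 1..d + 1. transition_density \<tau> a (t (k - 1)) (t k) (x (k - 1)) (x k))
      = fdd_density \<tau> a c d t x" .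
  have i: "0 \<le> initial_density \<tau> a c (x 0)"
    using C hpos by (simp add: initial_density_def less_imp_le)
  have p: "0 \<le> transition_density \<tau> a (t (k - 1)) (t k) (x (k - 1)) (x k)" if "k \<in> {1..d + 1}" for k
    by (rule transition_density_nonneg[OF less[OF that]])
  have "(\<Prod>k = 1..d + 1. ennreal (transition_density \<tau> a (t (k - 1)) (t k) (x (k - 1)) (x k)))
      = ennreal (\<Prod>k = 1..d + 1. transition_density \<tau> a (t (k - 1)) (t k) (x (k - 1)) (x k))"
    by (rule prod_ennreal[OF p])
  then show "ennreal (initial_density \<tau> a c (x 0)) *
      (\<Prod>k = 1..d + 1. ennreal (transition_density \<tau> a (t (k - 1)) (t k) (x (k - 1)) (x k))) = ennreal (fdd_density \<tau> a c d t x)"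
    using i by (simp only: eq ennreal_mult' [symmetric])
  show "0 \<le> fdd_density \<tau> a c d t x"
    unfolding eq[symmetric] by (intro mult_nonneg_nonneg prod_nonneg i p)
qed

lemma measurable_fdd_density:
  assumes t: "\<forall>k\<le>d. t k < t (k + 1)"
  shows "fdd_density \<tau> a c d t \<in> borel_measurable (\<Pi>\<^sub>M k\<in>{..d + 1}. lborel)"
proof -
  have comp [measurable]: "(\<lambda>x. x i) \<in> borel_measurable (\<Pi>\<^sub>M k\<in>{..d + 1}. (lborel :: real measure))" if "i \<le> d + 1" for i
    using measurable_component_singleton[of i "{..d + 1}" "\<lambda>_. lborel :: real measure"] that by simp
  have "(\<lambda>x. yakubovich_kernel (t k - t (k - 1)) (x (k - 1)) (x k)) \<in> borel_measurable (\<Pi>\<^sub>M k\<in>{..d + 1}. lborel)"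
    if "k \<in> {1..d + 1}" for k
    using that t[rule_format, of "k - 1"] by (intro measurable_yak_kernel comp) auto
  moreover have "(\<lambda>x. exp (c * x 0 + a * x (d + 1))) \<in> borel_measurable (\<Pi>\<^sub>M k\<in>{..d + 1}. lborel)"
    using comp[of 0] comp[of "d + 1"] by measurable
  ultimately show ?thesis
    unfolding fdd_density_def[abs_def]
    by (intro borel_measurable_times borel_measurable_prod borel_measurable_const)
qed

text \<open>Finiteness of C is expressed by integrability on the plane, since a Bochner integral has
  a value even when it diverges. The process consists of the coordinates on path space.\<close>

theorem theorem1p1:
  fixes \<tau> a c :: real
  assumes "\<tau> > 0" and "a + c > 0"
  shows "integrable (lborel \<Otimes>\<^sub>M lborel)
           (\<lambda>(x, y). exp (a * x + c * y) * yakubovich_kernel \<tau> x y)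
    \<and> (\<exists>(M :: (real \<Rightarrow> real) measure) (Y :: real \<Rightarrow> (real \<Rightarrow> real) \<Rightarrow> real).
         markov_process M {0..\<tau>} Y \<and>
         (\<forall>(d :: nat) (t :: nat \<Rightarrow> real).
            t 0 = 0 \<longrightarrow> t (d + 1) = \<tau> \<longrightarrow> (\<forall>k\<le>d. t k < t (k + 1)) \<longrightarrow>
            has_real_density M (\<Pi>\<^sub>M k\<in>{..d + 1}. lborel)
              (\<lambda>\<omega>. \<lambda>k\<in>{..d + 1}. Y (t k) \<omega>)
              (fdd_density \<tau> a c d t)))"
proof (intro conjI)
  show "integrable (lborel \<Otimes>\<^sub>M lborel) (\<lambda>(x, y). exp (a * x + c * y) * yakubovich_kernel \<tau> x y)"
    by (rule integrable_yak_kernel_exp_pair[OF assms])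
  interpret markov_densities \<tau> "\<lambda>x. ennreal (initial_density \<tau> a c x)" "\<lambda>s t x y. ennreal (transition_density \<tau> a s t x y)"
    by (rule markov_densities_yak[OF assms])
  have "has_real_density process_law (\<Pi>\<^sub>M k\<in>{..d + 1}. lborel) (\<lambda>\<omega>. \<lambda>k\<in>{..d + 1}. \<omega> (t k)) (fdd_density \<tau> a c d t)"
    if t: "t 0 = 0" "t (d + 1) = \<tau>" "\<forall>k\<le>d. t k < t (k + 1)" for d t
    unfolding has_real_density_def distributed_def
  proof (intro conjI)
    show "fdd_density \<tau> a c d t \<in> borel_measurable (\<Pi>\<^sub>M k\<in>{..d + 1}. lborel)"
      by (rule measurable_fdd_density[OF t(3)])
    then show "(\<lambda>x. ennreal (fdd_density \<tau> a c d t x)) \<in> borel_measurable (\<Pi>\<^sub>M k\<in>{..d + 1}. lborel)"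
      by simp
    show "AE x in \<Pi>\<^sub>M k\<in>{..d + 1}. lborel. 0 \<le> fdd_density \<tau> a c d t x"
      using fdd_density_eq(2)[OF assms t] by simp
    show "(\<lambda>\<omega>. \<lambda>k\<in>{..d + 1}. \<omega> (t k)) \<in> process_law \<rightarrow>\<^sub>M (\<Pi>\<^sub>M k\<in>{..d + 1}. lborel)"
      by (rule distr_process_law_increasing(1)) (use t in auto)
    show "distr process_law (\<Pi>\<^sub>M k\<in>{..d + 1}. lborel) (\<lambda>\<omega>. \<lambda>k\<in>{..d + 1}. \<omega> (t k))
        = density (\<Pi>\<^sub>M k\<in>{..d + 1}. lborel) (\<lambda>x. ennreal (fdd_density \<tau> a c d t x))"
      unfolding fdd_density_eq(1)[OF assms t, symmetric]
      by (rule distr_process_law_increasing(2)) (use t in auto)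
  qed
  then show "\<exists>(M :: (real \<Rightarrow> real) measure) (Y :: real \<Rightarrow> (real \<Rightarrow> real) \<Rightarrow> real).
         markov_process M {0..\<tau>} Y \<and>
         (\<forall>(d :: nat) (t :: nat \<Rightarrow> real).
            t 0 = 0 \<longrightarrow> t (d + 1) = \<tau> \<longrightarrow> (\<forall>k\<le>d. t k < t (k + 1)) \<longrightarrow>
            has_real_density M (\<Pi>\<^sub>M k\<in>{..d + 1}. lborel)
              (\<lambda>\<omega>. \<lambda>k\<in>{..d + 1}. Y (t k) \<omega>)
              (fdd_density \<tau> a c d t))"
    using markov_process_law by (intro exI[of _ process_law] exI[of _ "\<lambda>t \<omega>. \<omega> t"]) blast
qed

end
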